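(* Let $G$ be a finite group with presentation determined by $F/R$, that is, $F$ is a free group, $R$ is a normal subgroup of $F$, and $G=F/R$. Let $N=S/R$ be a normal subgroup of $G$, where $S$ is a normal subgroup of $F$ containing $R$. Regard $\mathbb{Q}/\mathbb{Z}$ as a trivial $G$-module. Then there is a homomorphism $$\theta:\mathrm{B}_0(G)\to \mathrm{Hom}\Big(\frac{R\cap\langle K(F)\cap S\rangle}{\langle K(F)\cap R\rangle},\mathbb{Q}/\mathbb{Z}\Big)$$ such that the following sequence is exact: $$0\to \mathrm{Hom}\Big(\frac{N\cap G'}{\langle N\cap K(G)\rangle},\mathbb{Q}/\mathbb{Z}\Big)\xrightarrow{\mathrm{tra}}\mathrm{B}_0(G/N)\xrightarrow{\mathrm{inf}}\mathrm{B}_0(G)\xrightarrow{\theta}\mathrm{Hom}\Big(\frac{R\cap\langle K(F)\cap S\rangle}{\langle K(F)\cap R\rangle},\mathbb{Q}/\mathbb{Z}\Big)\to 0.$$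
   Context: For a group $X$, $[x,y]=x^{-1}y^{-1}xy$, $X'$ is the commutator subgroup, and $K(X)=\{[x,y]\mid x,y\in X\}$ is the set of commutators; $\langle T\rangle$ denotes the subgroup generated by a set $T$. For a finite group $G$, the Bogomolov multiplier is $$\mathrm{B}_0(G)=\bigcap_{A\le G,\ A\text{ abelian}}\ker\big(\mathrm{res}^G_A: \mathrm{H}^2(G,\mathbb{Q}/\mathbb{Z})\to \mathrm{H}^2(A,\mathbb{Q}/\mathbb{Z})\big).$$ The inflation map $\mathrm{inf}:\mathrm{B}_0(G/N)\to\mathrm{B}_0(G)$ sends the class of a 2-cocycle $\alpha$ to the class of $\beta(x,y)=\alpha(xN,yN)$. The transgression map $\mathrm{tra}:\mathrm{Hom}\big(N/\langle K(G)\cap N\rangle,\mathbb{Q}/\mathbb{Z}\big)\to\mathrm{B}_0(G/N)$ sends $\chi$ to the class of $\alpha(\bar x,\bar y)=\chi\big(\overline{\mu(\bar x)\mu(\bar y)\mu(\bar x\bar y)^{-1}}\big)$, for any section $\mu:G/N\to G$. On $\mathrm{Hom}\big(\frac{N\cap G'}{\langle N\cap K(G)\rangle},\mathbb{Q}/\mathbb{Z}\big)$ the map $\mathrm{tra}$ is the induced one: a homomorphism $\chi$ is extended to a homomorphism $\tilde\chi$ on $N/\langle K(G)\cap N\rangle$ (possible since $\mathbb{Q}/\mathbb{Z}$ is divisible), and $\mathrm{tra}(\chi):=\mathrm{tra}(\tilde\chi)$, which does not depend on the extension chosen. *)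

theory Defs
  imports "HOL-Algebra.Product_Groups" "HOL-Algebra.Generated_Groups"
begin

subsection \<open>Free groups\<close>

text \<open>A word over \<open>X\<close> is a list of letters \<open>(x, e)\<close>; the letter stands for \<open>x\<close> if \<open>e\<close> is true and
  for the formal inverse of \<open>x\<close> otherwise.\<close>

definition words :: "'x set \<Rightarrow> ('x \<times> bool) list set" where
  "words X = lists (X \<times> UNIV)"

inductive word_eq :: "'x set \<Rightarrow> ('x \<times> bool) list \<Rightarrow> ('x \<times> bool) list \<Rightarrow> bool" for X where
  cancel: "u \<in> words X \<Longrightarrow> v \<in> words X \<Longrightarrow> x \<in> X \<Longrightarrow> word_eq X (u @ [(x, e), (x, \<not> e)] @ v) (u @ v)"
| refl: "u \<in> words X \<Longrightarrow> word_eq X u u"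
| sym: "word_eq X u v \<Longrightarrow> word_eq X v u"
| trans: "word_eq X u v \<Longrightarrow> word_eq X v w \<Longrightarrow> word_eq X u w"

definition word_class :: "'x set \<Rightarrow> ('x \<times> bool) list \<Rightarrow> ('x \<times> bool) list set" where
  "word_class X u = {v. word_eq X u v}"

definition free_group :: "'x set \<Rightarrow> ('x \<times> bool) list set monoid" where
  "free_group X = \<lparr>carrier = word_class X ` words X,
     monoid.mult = (\<lambda>p q. \<Union>u\<in>p. \<Union>v\<in>q. word_class X (u @ v)),
     one = word_class X []\<rparr>"

text \<open>A basis of \<open>F\<close> can be taken inside \<open>F\<close>, so it is enough to let \<open>X\<close> range over sets of elements of
  the type of \<open>F\<close>.\<close>

definition is_free_group :: "('a, 'm) monoid_scheme \<Rightarrow> bool" where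
  "is_free_group F \<longleftrightarrow> group F \<and> (\<exists>X :: 'a set. F \<cong> free_group X)"

lemma word_eq_words: "word_eq X u v \<Longrightarrow> u \<in> words X \<and> v \<in> words X"
  by (induction rule: word_eq.induct) (auto simp: words_def)

lemma word_eq_append_right: "word_eq X u v \<Longrightarrow> w \<in> words X \<Longrightarrow> word_eq X (u @ w) (v @ w)"
proof (induction rule: word_eq.induct)
  case (cancel u v x e)
  then show ?case
    using word_eq.cancel[of u X "v @ w" x e] by (simp add: words_def)
next
  case (refl u)
  then show ?case
    by (simp add: words_def word_eq.refl)
next
  case (sym u v)
  then show ?case
    by (simp add: word_eq.sym)
next
  case (trans u v w')
  then show ?case
    using word_eq.trans by blast
qed

lemma word_eq_append_left: "word_eq X u v \<Longrightarrow> w \<in> words X \<Longrightarrow> word_eq X (w @ u) (w @ v)"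
proof (induction rule: word_eq.induct)
  case (cancel u v x e)
  then show ?case
    using word_eq.cancel[of "w @ u" X v x e] by (simp add: words_def)
next
  case (refl u)
  then show ?case
    by (simp add: words_def word_eq.refl)
next
  case (sym u v)
  then show ?case
    by (simp add: word_eq.sym)
next
  case (trans u v w')
  then show ?case
    using word_eq.trans by blast
qed

lemma word_eq_append:
  assumes "word_eq X u u'" "word_eq X v v'"
  shows "word_eq X (u @ v) (u' @ v')"
  by (rule word_eq.trans[OF word_eq_append_right word_eq_append_left])
    (use assms word_eq_words in blast)+

lemma word_class_eqI: "word_eq X u v \<Longrightarrow> word_class X u = word_class X v"
  unfolding word_class_def using word_eq.sym[of X u v] word_eq.trans[of X u v] word_eq.trans[of X v u]
  by (intro Collect_cong) blast

lemma free_group_mult: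
  assumes "u \<in> words X" "v \<in> words X"
  shows "word_class X u \<otimes>\<^bsub>free_group X\<^esub> word_class X v = word_class X (u @ v)"
proof -
  have u: "u \<in> word_class X u" and v: "v \<in> word_class X v"
    using assms by (simp_all add: word_class_def word_eq.refl)
  have eq: "word_class X (u' @ v') = word_class X (u @ v)"
    if "u' \<in> word_class X u" "v' \<in> word_class X v" for u' v'
    using that word_class_eqI[OF word_eq_append, of X u u' v v'] unfolding word_class_def
    by simp
  have "(\<Union>u'\<in>word_class X u. \<Union>v'\<in>word_class X v. word_class X (u' @ v'))
      = (\<Union>u'\<in>word_class X u. \<Union>v'\<in>word_class X v. word_class X (u @ v))"
    by (rule SUP_cong[OF HOL.refl], rule SUP_cong[OF HOL.refl], rule eq)
  also have "\<dots> = word_class X (u @ v)"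
    using u v by (subst UN_constant)+ auto
  finally show ?thesis
    by (simp add: free_group_def)
qed

lemma word_eq_inverse:
  "u \<in> words X \<Longrightarrow> word_eq X (rev (map (\<lambda>(x, e). (x, \<not> e)) u) @ u) []"
proof (induction u)
  case Nil
  then show ?case by (simp add: word_eq.refl)
next
  case (Cons a u)
  obtain x e where a: "a = (x, e)" by force
  have u: "u \<in> words X" and x: "x \<in> X"
    using Cons.prems a by (auto simp: words_def)
  have r: "rev (map (\<lambda>(x, e). (x, \<not> e)) u) \<in> words X"
    using u by (auto simp: words_def lists_eq_set)
  have "word_eq X (rev (map (\<lambda>(x, e). (x, \<not> e)) u) @ [(x, \<not> e), (x, \<not> \<not> e)] @ u)
          (rev (map (\<lambda>(x, e). (x, \<not> e)) u) @ u)"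
    using word_eq.cancel[OF r u x] by blast
  then show ?case
    using word_eq.trans[OF _ Cons.IH[OF u]] a by simp
qed

lemma group_free_group: "group (free_group X)"
proof (rule groupI)
  have car: "carrier (free_group X) = word_class X ` words X"
    by (simp add: free_group_def)
  have one: "\<one>\<^bsub>free_group X\<^esub> = word_class X []"
    by (simp add: free_group_def)
  have nil: "[] \<in> words X"
    by (simp add: words_def)
  have app: "u @ v \<in> words X" if "u \<in> words X" "v \<in> words X" for u v
    using that by (simp add: words_def)
  show "\<one>\<^bsub>free_group X\<^esub> \<in> carrier (free_group X)"
    using nil by (auto simp: car one)
  show "p \<otimes>\<^bsub>free_group X\<^esub> q \<in> carrier (free_group X)"
    if "p \<in> carrier (free_group X)" "q \<in> carrier (free_group X)" for p q
    using that app by (auto simp: car free_group_mult)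
  show "p \<otimes>\<^bsub>free_group X\<^esub> q \<otimes>\<^bsub>free_group X\<^esub> r = p \<otimes>\<^bsub>free_group X\<^esub> (q \<otimes>\<^bsub>free_group X\<^esub> r)"
    if "p \<in> carrier (free_group X)" "q \<in> carrier (free_group X)" "r \<in> carrier (free_group X)"
    for p q r
    using that app by (auto simp: car free_group_mult)
  show "\<one>\<^bsub>free_group X\<^esub> \<otimes>\<^bsub>free_group X\<^esub> p = p" if "p \<in> carrier (free_group X)" for p
    using that nil by (auto simp: car one free_group_mult)
  show "\<exists>q\<in>carrier (free_group X). q \<otimes>\<^bsub>free_group X\<^esub> p = \<one>\<^bsub>free_group X\<^esub>"
    if p: "p \<in> carrier (free_group X)" for p
  proof -
    obtain u where u: "u \<in> words X" "p = word_class X u"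
      using p by (auto simp: car)
    have r: "rev (map (\<lambda>(x, e). (x, \<not> e)) u) \<in> words X"
      using u by (auto simp: words_def lists_eq_set)
    then have "word_class X (rev (map (\<lambda>(x, e). (x, \<not> e)) u)) \<otimes>\<^bsub>free_group X\<^esub> p = \<one>\<^bsub>free_group X\<^esub>"
      using u word_class_eqI[OF word_eq_inverse] by (simp add: free_group_mult one)
    with r show ?thesis
      by (auto simp: car)
  qed
qed

text \<open>The universal property: every map from \<open>X\<close> to a group extends uniquely to a homomorphism.\<close>

lemma free_group_hom_exists:
  assumes "group H" "h \<in> X \<rightarrow> carrier H"
  shows "\<exists>k \<in> hom (free_group X) H. \<forall>x\<in>X. k (word_class X [(x, True)]) = h x"
proof -
  interpret group H by fact
  define ev where "ev = (\<lambda>u. foldr (\<lambda>(x, e) a. (if e then h x else inv\<^bsub>H\<^esub> h x) \<otimes>\<^bsub>H\<^esub> a) u \<one>\<^bsub>H\<^esub>)"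
  have ev_simps: "ev [] = \<one>\<^bsub>H\<^esub>" "ev ((x, e) # u) = (if e then h x else inv\<^bsub>H\<^esub> h x) \<otimes>\<^bsub>H\<^esub> ev u" for x e u
    by (auto simp: ev_def)
  have hx: "h x \<in> carrier H" if "x \<in> X" for x
    using assms(2) that by auto
  have ev_closed: "ev u \<in> carrier H" if "u \<in> words X" for u
    using that by (induction u) (auto simp: words_def ev_simps hx)
  have ev_append: "ev (u @ v) = ev u \<otimes>\<^bsub>H\<^esub> ev v" if "u \<in> words X" "v \<in> words X" for u v
    using that(1)
  proof (induction u)
    case Nil
    then show ?case using ev_closed[OF that(2)] by (simp add: ev_simps)
  next
    case (Cons a u)
    obtain x e where a: "a = (x, e)" by force
    have "u \<in> words X" "x \<in> X" using Cons.prems a by (auto simp: words_def)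
    then show ?case
      using Cons.IH ev_closed[OF that(2)] ev_closed[of u] hx[of x] a by (simp add: ev_simps m_assoc)
  qed
  have ev_eq: "ev u = ev v" if "word_eq X u v" for u v
    using that
  proof (induction rule: word_eq.induct)
    case (cancel u v x e)
    have "[(x, e), (x, \<not> e)] @ v \<in> words X" using cancel by (auto simp: words_def)
    then have "ev (u @ [(x, e), (x, \<not> e)] @ v) = ev u \<otimes>\<^bsub>H\<^esub> ev ([(x, e), (x, \<not> e)] @ v)"
      using cancel ev_append by blast
    also have "ev ([(x, e), (x, \<not> e)] @ v) = ev v"
      using hx[OF cancel(3)] ev_closed[OF cancel(2)] by (cases e) (simp_all add: ev_simps m_assoc[symmetric])
    finally show ?case using cancel ev_append by simp
  qed simp_all
  define k where "k = (\<lambda>p. ev (SOME u. u \<in> p))"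
  have k: "k (word_class X u) = ev u" if "u \<in> words X" for u
  proof -
    have "u \<in> word_class X u" using that by (simp add: word_class_def word_eq.refl)
    then have "(SOME v. v \<in> word_class X u) \<in> word_class X u" by (rule someI)
    then have "ev u = ev (SOME v. v \<in> word_class X u)" by (intro ev_eq) (simp add: word_class_def)
    then show ?thesis by (simp add: k_def)
  qed
  have app: "u @ v \<in> words X" if "u \<in> words X" "v \<in> words X" for u v
    using that by (simp add: words_def)
  have car: "carrier (free_group X) = word_class X ` words X"
    by (simp add: free_group_def)
  have "k \<in> hom (free_group X) H"
    by (rule homI) (auto simp: car free_group_mult k ev_closed ev_append app)
  moreover have "k (word_class X [(x, True)]) = h x" if "x \<in> X" for x
    using that hx by (simp add: k words_def ev_simps)
  ultimately show ?thesis by blast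
qed

lemma free_group_hom_unique:
  assumes "group H" "k \<in> hom (free_group X) H" "l \<in> hom (free_group X) H"
    and eq: "\<And>x. x \<in> X \<Longrightarrow> k (word_class X [(x, True)]) = l (word_class X [(x, True)])"
    and "p \<in> carrier (free_group X)"
  shows "k p = l p"
proof -
  interpret Fr: group "free_group X" by (rule group_free_group)
  interpret K: group_hom "free_group X" H k
    using assms by (simp add: group_hom_def group_hom_axioms_def group_free_group)
  interpret L: group_hom "free_group X" H l
    using assms by (simp add: group_hom_def group_hom_axioms_def group_free_group)
  have car: "carrier (free_group X) = word_class X ` words X"
    by (simp add: free_group_def)
  have one: "\<one>\<^bsub>free_group X\<^esub> = word_class X []"
    by (simp add: free_group_def)
  have letter: "k (word_class X [(x, e)]) = l (word_class X [(x, e)])" if "x \<in> X" for x e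
  proof (cases e)
    case True
    then show ?thesis using eq that by simp
  next
    case False
    have w: "[(x, b)] \<in> words X" for b using that by (simp add: words_def)
    have "word_eq X ([] @ [(x, False), (x, \<not> False)] @ []) ([] @ [])"
      using that by (intro word_eq.cancel) (simp_all add: words_def)
    then have "word_class X [(x, False)] \<otimes>\<^bsub>free_group X\<^esub> word_class X [(x, True)] = \<one>\<^bsub>free_group X\<^esub>"
      using word_class_eqI by (fastforce simp: free_group_mult w one)
    then have "word_class X [(x, False)] = inv\<^bsub>free_group X\<^esub> word_class X [(x, True)]"
      using w by (intro Fr.inv_equality[symmetric]) (auto simp: car)
    moreover have "word_class X [(x, True)] \<in> carrier (free_group X)" using w by (simp add: car)
    ultimately show ?thesis using False eq that by simp
  qed
  have "k (word_class X u) = l (word_class X u)" if "u \<in> words X" for u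
    using that
  proof (induction u)
    case Nil
    then show ?case using K.hom_one L.hom_one by (simp add: one)
  next
    case (Cons a u)
    obtain x e where a: "a = (x, e)" by force
    have u: "u \<in> words X" "x \<in> X" "[(x, e)] \<in> words X" using Cons.prems a by (auto simp: words_def)
    have c: "word_class X (a # u) = word_class X [(x, e)] \<otimes>\<^bsub>free_group X\<^esub> word_class X u"
      using u a by (simp add: free_group_mult)
    have "word_class X [(x, e)] \<in> carrier (free_group X)" "word_class X u \<in> carrier (free_group X)"
      using u by (auto simp: car)
    then show ?case using c Cons.IH[OF u(1)] letter[OF u(2)] by simp
  qed
  then show ?thesis using assms(5) by (auto simp: car)
qed

subsection \<open>Commutators and the group \<open>\<rat>/\<int>\<close>\<close>

definition commutators :: "('a, 'm) monoid_scheme \<Rightarrow> 'a set" where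
  "commutators G = {inv\<^bsub>G\<^esub> x \<otimes>\<^bsub>G\<^esub> inv\<^bsub>G\<^esub> y \<otimes>\<^bsub>G\<^esub> x \<otimes>\<^bsub>G\<^esub> y |x y. x \<in> carrier G \<and> y \<in> carrier G}"

definition rat_group :: "rat monoid" where
  "rat_group = \<lparr>carrier = UNIV, monoid.mult = (+), one = 0\<rparr>"

definition QmodZ :: "rat set monoid" where
  "QmodZ = rat_group Mod \<int>"

text \<open>Elements are made extensional, so that homomorphisms agreeing on \<open>carrier G\<close> are equal.\<close>

definition Hom_group :: "('a, 'm) monoid_scheme \<Rightarrow> ('b, 'n) monoid_scheme \<Rightarrow> ('a \<Rightarrow> 'b) monoid" where
  "Hom_group G A =
     (product_group (carrier G) (\<lambda>_. A))\<lparr>carrier := hom G A \<inter> extensional (carrier G)\<rparr>"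

subsection \<open>Second cohomology with trivial coefficients\<close>

definition cocycles2 :: "('a, 'm) monoid_scheme \<Rightarrow> ('b, 'n) monoid_scheme \<Rightarrow> ('a \<times> 'a \<Rightarrow> 'b) set" where
  "cocycles2 G A = {f \<in> carrier G \<times> carrier G \<rightarrow>\<^sub>E carrier A.
     \<forall>x\<in>carrier G. \<forall>y\<in>carrier G. \<forall>z\<in>carrier G.
       f (y, z) \<otimes>\<^bsub>A\<^esub> f (x, y \<otimes>\<^bsub>G\<^esub> z) = f (x \<otimes>\<^bsub>G\<^esub> y, z) \<otimes>\<^bsub>A\<^esub> f (x, y)}"

definition coboundaries2 :: "('a, 'm) monoid_scheme \<Rightarrow> ('b, 'n) monoid_scheme \<Rightarrow> ('a \<times> 'a \<Rightarrow> 'b) set" where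
  "coboundaries2 G A =
     {\<lambda>(x, y)\<in>carrier G \<times> carrier G. c x \<otimes>\<^bsub>A\<^esub> c y \<otimes>\<^bsub>A\<^esub> inv\<^bsub>A\<^esub> c (x \<otimes>\<^bsub>G\<^esub> y) |c.
        c \<in> carrier G \<rightarrow> carrier A}"

definition cocycle_group :: "('a, 'm) monoid_scheme \<Rightarrow> ('b, 'n) monoid_scheme \<Rightarrow> ('a \<times> 'a \<Rightarrow> 'b) monoid" where
  "cocycle_group G A =
     (product_group (carrier G \<times> carrier G) (\<lambda>_. A))\<lparr>carrier := cocycles2 G A\<rparr>"

definition H2 :: "('a, 'm) monoid_scheme \<Rightarrow> ('b, 'n) monoid_scheme \<Rightarrow> ('a \<times> 'a \<Rightarrow> 'b) set monoid" where
  "H2 G A = cocycle_group G A Mod coboundaries2 G A"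

definition cohomology_class ::
  "('a, 'm) monoid_scheme \<Rightarrow> ('b, 'n) monoid_scheme \<Rightarrow> ('a \<times> 'a \<Rightarrow> 'b) \<Rightarrow> ('a \<times> 'a \<Rightarrow> 'b) set" where
  "cohomology_class G A f = coboundaries2 G A #>\<^bsub>cocycle_group G A\<^esub> f"

text \<open>The map induced on \<open>H2\<close> by a homomorphism \<open>\<phi> : H \<rightarrow> G\<close>. As usual for maps on quotients, it is
  written as a union over all representatives; all members of the union are the same coset.\<close>

definition H2_pullback ::
  "('c, 'k) monoid_scheme \<Rightarrow> ('a, 'm) monoid_scheme \<Rightarrow> ('b, 'n) monoid_scheme \<Rightarrow> ('c \<Rightarrow> 'a)
    \<Rightarrow> ('a \<times> 'a \<Rightarrow> 'b) set \<Rightarrow> ('c \<times> 'c \<Rightarrow> 'b) set" where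
  "H2_pullback H G A \<phi> \<xi> =
     (\<Union>f\<in>\<xi>. cohomology_class H A (\<lambda>(x, y)\<in>carrier H \<times> carrier H. f (\<phi> x, \<phi> y)))"

abbreviation restricted_group :: "('a, 'm) monoid_scheme \<Rightarrow> 'a set \<Rightarrow> ('a, 'm) monoid_scheme" where
  "restricted_group G A \<equiv> G\<lparr>carrier := A\<rparr>"

definition res :: "('a, 'm) monoid_scheme \<Rightarrow> 'a set \<Rightarrow> ('a \<times> 'a \<Rightarrow> rat set) set \<Rightarrow> ('a \<times> 'a \<Rightarrow> rat set) set" where
  "res G A = H2_pullback (restricted_group G A) G QmodZ (\<lambda>x. x)"

subsection \<open>The Bogomolov multiplier\<close>

definition B0 :: "('a, 'm) monoid_scheme \<Rightarrow> ('a \<times> 'a \<Rightarrow> rat set) set monoid" where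
  "B0 G = restricted_group (H2 G QmodZ)
     (\<Inter>A\<in>{A. subgroup A G \<and> comm_group (restricted_group G A)}.
        kernel (H2 G QmodZ) (H2 (restricted_group G A) QmodZ) (res G A))"

definition inf_B0 ::
  "('a, 'm) monoid_scheme \<Rightarrow> 'a set \<Rightarrow> ('a set \<times> 'a set \<Rightarrow> rat set) set \<Rightarrow> ('a \<times> 'a \<Rightarrow> rat set) set" where
  "inf_B0 G N = H2_pullback G (G Mod N) QmodZ (\<lambda>x. N #>\<^bsub>G\<^esub> x)"

definition factor_sections :: "('a, 'm) monoid_scheme \<Rightarrow> 'a set \<Rightarrow> ('a set \<Rightarrow> 'a) set" where
  "factor_sections G N = {\<mu> \<in> carrier (G Mod N) \<rightarrow> carrier G. \<forall>c\<in>carrier (G Mod N). N #>\<^bsub>G\<^esub> \<mu> c = c}"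

definition tra_cochain ::
  "('a, 'm) monoid_scheme \<Rightarrow> 'a set \<Rightarrow> ('a set \<Rightarrow> 'a) \<Rightarrow> ('a set \<Rightarrow> rat set) \<Rightarrow> 'a set \<times> 'a set \<Rightarrow> rat set" where
  "tra_cochain G N \<mu> \<chi> =
     (\<lambda>(c, d)\<in>carrier (G Mod N) \<times> carrier (G Mod N).
        \<chi> (generate G (commutators G \<inter> N) #>\<^bsub>G\<^esub> (\<mu> c \<otimes>\<^bsub>G\<^esub> \<mu> d \<otimes>\<^bsub>G\<^esub> inv\<^bsub>G\<^esub> \<mu> (c \<otimes>\<^bsub>G Mod N\<^esub> d))))"

text \<open>For \<open>\<chi>\<close> on \<open>N / \<langle>K(G) \<inter> N\<rangle>\<close>, the union over all sections \<open>\<mu>\<close> of the class of the cocycle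
  attached to \<open>\<chi>\<close> and \<open>\<mu>\<close>. Distinct cohomology classes are disjoint, so the union is a single class
  exactly when the class does not depend on \<open>\<mu>\<close>. In \<open>tra\<close> the same is done for extensions of \<open>\<chi>\<close>.\<close>

definition tra_full ::
  "('a, 'm) monoid_scheme \<Rightarrow> 'a set \<Rightarrow> ('a set \<Rightarrow> rat set) \<Rightarrow> ('a set \<times> 'a set \<Rightarrow> rat set) set" where
  "tra_full G N \<chi> =
     (\<Union>\<mu>\<in>factor_sections G N. cohomology_class (G Mod N) QmodZ (tra_cochain G N \<mu> \<chi>))"

definition tra_source :: "('a, 'm) monoid_scheme \<Rightarrow> 'a set \<Rightarrow> 'a set monoid" where
  "tra_source G N =
     restricted_group G (N \<inter> derived G (carrier G)) Mod generate G (N \<inter> commutators G)"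

definition hom_extensions ::
  "('a, 'm) monoid_scheme \<Rightarrow> 'a set \<Rightarrow> ('a set \<Rightarrow> rat set) \<Rightarrow> ('a set \<Rightarrow> rat set) set" where
  "hom_extensions G N \<chi> =
     {\<chi>' \<in> carrier (Hom_group (restricted_group G N Mod generate G (commutators G \<inter> N)) QmodZ).
        \<forall>c\<in>carrier (tra_source G N). \<chi>' c = \<chi> c}"

definition tra ::
  "('a, 'm) monoid_scheme \<Rightarrow> 'a set \<Rightarrow> ('a set \<Rightarrow> rat set) \<Rightarrow> ('a set \<times> 'a set \<Rightarrow> rat set) set" where
  "tra G N \<chi> = (\<Union>\<chi>'\<in>hom_extensions G N \<chi>. tra_full G N \<chi>')"

definition theta_target :: "('a, 'm) monoid_scheme \<Rightarrow> 'a set \<Rightarrow> 'a set \<Rightarrow> 'a set monoid" where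
  "theta_target F R S =
     restricted_group F (R \<inter> generate F (commutators F \<inter> S)) Mod generate F (commutators F \<inter> R)"

end

theory Submission
  imports Defs "HOL-Algebra.Zassenhaus"
begin

text \<open>For an epimorphism \<open>E \<rightarrow> Q\<close> with kernel \<open>M\<close>, a cocycle on \<open>Q\<close> becomes a coboundary on \<open>E\<close> exactly when
  it is the transgression of a character \<open>\<chi>\<close> of \<open>M\<close>; its class is then trivial if and only if \<open>\<chi>\<close> extends to \<open>E\<close>,
  that is, vanishes on \<open>M \<inter> E'\<close>, and it lies in the Bogomolov multiplier if and only if \<open>\<chi>\<close> vanishes on
  \<open>M \<inter> K(E)\<close>, because a class is trivial on all abelian subgroups precisely when its cocycles are symmetric on
  commuting pairs. Both equivalences use that \<open>\<rat>/\<int>\<close> is divisible.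

  For \<open>E = G\<close> this is exactness at the first two terms. Cocycles on the free group \<open>F\<close> are coboundaries, so every
  class on \<open>G = F/R\<close> is the transgression of a character of \<open>R\<close>, and \<open>\<theta>\<close> restricts that character to
  \<open>R \<inter> \<langle>K(F) \<inter> S\<rangle>\<close>. Inflation from \<open>G/N = F/S\<close> restricts characters of \<open>S\<close> to \<open>R\<close>, so exactness at the last
  two terms amounts to extending characters from \<open>R\<close> to \<open>S\<close> and from \<open>R \<inter> \<langle>K(F) \<inter> S\<rangle>\<close> to \<open>R\<close>.\<close>

subsection \<open>Divisible coefficients\<close>

text \<open>Both uses of divisibility are instances of one splitting statement,
  \<open>central_divisible_retraction\<close>: a divisible central subgroup is a direct factor if it
  meets trivially some subgroup that contains all commutators. Splitting the extension defined by a
  symmetric cocycle exhibits the cocycle as a coboundary; splitting a direct product, with the graph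
  of a character inside the kernel of the retraction, extends the character. The groups to be split
  are in general neither finite nor abelian, so the complement comes from Zorn's lemma. The subgroup
  M is not assumed to be central in E, whereas the transgression formula calls for a character
  invariant under conjugation. Invariance is automatic: for m in M the element x m x^-1 m^-1 is a
  commutator lying in M, and a character that vanishes on the commutators in M does not see it.
  Transgression is expressed by a cochain on E and not by a section of E -> E/M, because a single
  cochain on F can then serve both F -> G and F -> G/N. This is why inflation becomes restriction of
  characters.\<close>

text \<open>The constant sum is the n-fold multiple of \<open>b\<close>, formed with addition
  alone.\<close>

class divisible_ab_group_add = ab_group_add +
  assumes divisible: "0 < (n::nat) \<Longrightarrow> \<exists>b. (\<Sum>i<n. b) = a"

lemma group_rat_group: "group rat_group"
  by (rule groupI) (auto simp: rat_group_def intro: exI[of _ "- _"])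

lemma comm_group_rat_group: "comm_group rat_group"
  by (rule group.group_comm_groupI[OF group_rat_group]) (simp add: rat_group_def)

lemma inv_rat_group: "inv\<^bsub>rat_group\<^esub> x = - x"
  by (rule group.inv_equality[OF group_rat_group]) (auto simp: rat_group_def)

lemma subgroup_Ints_rat_group: "subgroup \<int> rat_group"
  by (unfold_locales) (auto simp: inv_rat_group, auto simp: rat_group_def)

lemma normal_Ints_rat_group: "\<int> \<lhd> rat_group"
  by (rule comm_group.subgroup_imp_normal[OF comm_group_rat_group subgroup_Ints_rat_group])

lemma comm_group_QmodZ: "comm_group QmodZ"
  unfolding QmodZ_def
  by (rule comm_group.abelian_FactGroup[OF comm_group_rat_group subgroup_Ints_rat_group])

lemma group_QmodZ: "group QmodZ"
  using comm_group_QmodZ by (rule comm_group.axioms)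

text \<open>The same group as a type, so that identities between cochains become additive identities that
  the simplifier can decide.\<close>

typedef rat_mod_int = "carrier QmodZ"
  using monoid.one_closed[OF group.is_monoid[OF group_QmodZ]] by blast

setup_lifting type_definition_rat_mod_int

instantiation rat_mod_int :: ab_group_add
begin

lift_definition zero_rat_mod_int :: rat_mod_int is "\<one>\<^bsub>QmodZ\<^esub>"
  by (rule monoid.one_closed[OF group.is_monoid[OF group_QmodZ]])

lift_definition plus_rat_mod_int :: "rat_mod_int \<Rightarrow> rat_mod_int \<Rightarrow> rat_mod_int" is "(\<otimes>\<^bsub>QmodZ\<^esub>)"
  by (rule monoid.m_closed[OF group.is_monoid[OF group_QmodZ]])

lift_definition uminus_rat_mod_int :: "rat_mod_int \<Rightarrow> rat_mod_int" is "\<lambda>x. inv\<^bsub>QmodZ\<^esub> x"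
  by (rule group.inv_closed[OF group_QmodZ])

definition minus_rat_mod_int :: "rat_mod_int \<Rightarrow> rat_mod_int \<Rightarrow> rat_mod_int" where
  "minus_rat_mod_int a b = a + - b"

instance
proof
  interpret Q: comm_group QmodZ by (rule comm_group_QmodZ)
  fix a b c :: rat_mod_int
  show "a + b + c = a + (b + c)" by transfer (rule Q.m_assoc)
  show "a + b = b + a" by transfer (rule Q.m_comm)
  show "0 + a = a" by transfer (rule Q.l_one)
  show "- a + a = 0" by transfer (rule Q.l_inv)
  show "a - b = a + - b" by (rule minus_rat_mod_int_def)
qed

end

text \<open>Through this projection, divisibility of the coefficients reduces to division of
  rational numbers.\<close>

lift_definition frac_class :: "rat \<Rightarrow> rat_mod_int" is "\<lambda>q. \<int> #>\<^bsub>rat_group\<^esub> q"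
  by (auto simp: QmodZ_def carrier_FactGroup rat_group_def)

lemma frac_class_add: "frac_class (p + q) = frac_class p + frac_class q"
proof transfer
  fix p q :: rat
  show "\<int> #>\<^bsub>rat_group\<^esub> (p + q) = (\<int> #>\<^bsub>rat_group\<^esub> p) \<otimes>\<^bsub>QmodZ\<^esub> (\<int> #>\<^bsub>rat_group\<^esub> q)"
    using normal.rcos_sum[OF normal_Ints_rat_group, of p q] by (simp add: QmodZ_def rat_group_def)
qed

lemma frac_class_surj: "\<exists>q. a = frac_class q"
  by transfer (auto simp: QmodZ_def carrier_FactGroup rat_group_def)

instance rat_mod_int :: divisible_ab_group_add
proof
  fix n :: nat and a :: rat_mod_int
  assume n: "0 < n"
  obtain q where q: "a = frac_class q" using frac_class_surj by blast
  have "(\<Sum>i<m. frac_class r) = frac_class (of_nat m * r)" for m :: nat and r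
  proof (induction m)
    case 0
    show ?case using frac_class_add[of 0 0] by simp
  next
    case (Suc m)
    then show ?case by (simp add: frac_class_add[symmetric] algebra_simps)
  qed
  then show "\<exists>b. (\<Sum>i<n. b) = a"
    using n q by (intro exI[of _ "frac_class (q / of_nat n)"]) simp
qed

subsection \<open>Splitting off divisible central subgroups\<close>

text \<open>A conjugate x h x^-1 is the commutator x h x^-1 h^-1 times h, so it stays in any
  subgroup that contains h and all commutators.\<close>

lemma commutators_subset_imp_normal:
  assumes "group G" "subgroup H G" "commutators G \<subseteq> H"
  shows "H \<lhd> G"
proof -
  interpret group G by fact
  have "x \<otimes>\<^bsub>G\<^esub> h \<otimes>\<^bsub>G\<^esub> inv\<^bsub>G\<^esub> x \<in> H" if x: "x \<in> carrier G" and h: "h \<in> H" for x h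
  proof -
    have hc: "h \<in> carrier G" using assms(2) h by (rule subgroup.mem_carrier)
    \<comment> \<open>With the convention [a,b] = a^-1 b^-1 a b, the element x h x^-1 h^-1 is
      [x^-1, h^-1].\<close>
    have "inv\<^bsub>G\<^esub> (inv\<^bsub>G\<^esub> x) \<otimes>\<^bsub>G\<^esub> inv\<^bsub>G\<^esub> (inv\<^bsub>G\<^esub> h) \<otimes>\<^bsub>G\<^esub> inv\<^bsub>G\<^esub> x \<otimes>\<^bsub>G\<^esub> inv\<^bsub>G\<^esub> h \<in> H"
      using assms(3) x hc inv_closed unfolding commutators_def by blast
    then have "x \<otimes>\<^bsub>G\<^esub> h \<otimes>\<^bsub>G\<^esub> inv\<^bsub>G\<^esub> x \<otimes>\<^bsub>G\<^esub> inv\<^bsub>G\<^esub> h \<otimes>\<^bsub>G\<^esub> h \<in> H"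
      using x hc h assms(2) by (simp add: subgroup.m_closed)
    then show ?thesis using x hc by (simp add: m_assoc)
  qed
  then show ?thesis using assms(2) by (simp add: normal_inv_iff)
qed

text \<open>The kernel of the retraction is a maximal subgroup among those that contain \<open>K\<close> and meet the
  image of \<open>\<iota>\<close> trivially.\<close>

lemma central_divisible_retraction:
  fixes \<iota> :: "'b::divisible_ab_group_add \<Rightarrow> 'p" and P (structure)
  assumes P: "group P" and \<iota>: "\<And>a. \<iota> a \<in> carrier P" "\<And>a b. \<iota> (a + b) = \<iota> a \<otimes> \<iota> b"
    and central: "\<And>a x. x \<in> carrier P \<Longrightarrow> \<iota> a \<otimes> x = x \<otimes> \<iota> a"
    and K: "subgroup K P" "commutators P \<subseteq> K" "\<And>a. \<iota> a \<in> K \<Longrightarrow> a = 0"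
  shows "\<exists>\<rho>::'p \<Rightarrow> 'b. (\<forall>x\<in>carrier P. \<forall>y\<in>carrier P. \<rho> (x \<otimes> y) = \<rho> x + \<rho> y)
           \<and> (\<forall>a. \<rho> (\<iota> a) = a) \<and> (\<forall>x\<in>K. \<rho> x = 0)"
proof -
  interpret group P by fact
  have \<iota>0: "\<iota> 0 = \<one>"
    using \<iota>(2)[of 0 0] \<iota>(1)[of 0] by (simp add: l_cancel_one)
  have \<iota>inv: "\<iota> (- a) = inv (\<iota> a)" for a
    using \<iota>(2)[of "- a" a] \<iota>0 \<iota>(1) by (intro inv_equality[symmetric]) auto
  have \<iota>pow: "\<iota> (\<Sum>i<n. b) = \<iota> b [^] (n::nat)" for b n
    by (induction n) (simp_all add: \<iota>0 \<iota>)
  define \<A> where "\<A> = {C. subgroup C P \<and> K \<subseteq> C \<and> (\<forall>a. \<iota> a \<in> C \<longrightarrow> a = 0)}"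
  have ne: "\<A> \<noteq> {}" using K by (auto simp: \<A>_def)
  have ch: "\<Union>\<C> \<in> \<A>" if "\<C> \<noteq> {}" "subset.chain \<A> \<C>" for \<C>
  proof -
    have \<C>: "C \<subseteq> D \<or> D \<subseteq> C" "subgroup C P" "K \<subseteq> C" "\<forall>a. \<iota> a \<in> C \<longrightarrow> a = 0"
      if "C \<in> \<C>" "D \<in> \<C>" for C D
      using that \<open>subset.chain \<A> \<C>\<close> unfolding subset_chain_def \<A>_def by auto
    have sub: "subgroup (\<Union>\<C>) P"
    proof (rule subgroupI)
      show "\<Union>\<C> \<subseteq> carrier P" using \<C>(2) subgroup.subset by blast
      show "\<Union>\<C> \<noteq> {}" using \<C>(2) \<open>\<C> \<noteq> {}\<close> subgroup.one_closed by blast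
      show "inv x \<in> \<Union>\<C>" if x: "x \<in> \<Union>\<C>" for x
      proof -
        obtain C where "C \<in> \<C>" "x \<in> C" using x by blast
        then show ?thesis using subgroup.m_inv_closed[OF \<C>(2)] by blast
      qed
      show "x \<otimes> y \<in> \<Union>\<C>" if xy: "x \<in> \<Union>\<C>" "y \<in> \<Union>\<C>" for x y
      proof -
        obtain C D where CD: "C \<in> \<C>" "x \<in> C" "D \<in> \<C>" "y \<in> D" using xy by blast
        then obtain B where "B \<in> \<C>" "x \<in> B" "y \<in> B" using \<C>(1)[of C D] by blast
        then show ?thesis using subgroup.m_closed[OF \<C>(2)] by blast
      qed
    qed
    obtain C where "C \<in> \<C>" using \<open>\<C> \<noteq> {}\<close> by blast
    then have "K \<subseteq> \<Union>\<C>" using \<C>(3) by blast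
    moreover have "a = 0" if a: "\<iota> a \<in> \<Union>\<C>" for a using a \<C>(4) by blast
    ultimately show ?thesis using sub by (simp add: \<A>_def)
  qed
  obtain C where C: "C \<in> \<A>" and max: "\<And>D. D \<in> \<A> \<Longrightarrow> C \<subseteq> D \<Longrightarrow> D = C"
    using subset_Zorn_nonempty[OF ne ch] by blast
  have Csub: "subgroup C P" and KC: "K \<subseteq> C" and C0: "\<And>a. \<iota> a \<in> C \<Longrightarrow> a = 0"
    using C by (auto simp: \<A>_def)
  have Cn: "C \<lhd> P"
    using commutators_subset_imp_normal[OF P Csub] K(2) KC by blast
  have Cc: "c \<in> carrier P" if "c \<in> C" for c using Csub that by (rule subgroup.mem_carrier)

  \<comment> \<open>Maximality in usable form. As \<open>C\<close> is normal, the products of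
    elements of \<open>C\<close> with powers of \<open>y\<close> form a subgroup \<open>D\<close>.
    If such a product equals \<open>\<iota> a\<close>, the hypothesis puts its power of
    \<open>y\<close>, hence \<open>\<iota> a\<close>, into \<open>C\<close>, so \<open>a\<close> is
    0. Thus \<open>D\<close> competes with \<open>C\<close> and equals it.\<close>
  have adjoin: "y \<in> C" if y: "y \<in> carrier P"
    and yk: "\<And>k::int. \<And>a c. c \<in> C \<Longrightarrow> c \<otimes> y [^] k = \<iota> a \<Longrightarrow> y [^] k \<in> C" for y
  proof -
    define D where "D = C <#> range (\<lambda>k::int. y [^] k)"
    have "generate P {y} = range (\<lambda>k::int. y [^] k)"
      using generate_pow[OF y] by auto
    then have "subgroup (range (\<lambda>k::int. y [^] k)) P"
      using generate_is_subgroup[of "{y}"] y by simp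
    then have D: "subgroup D P"
      unfolding D_def using Cn by (intro mult_norm_subgroup)
    have CD: "C \<subseteq> D"
    proof
      fix c assume c: "c \<in> C"
      then have "c = c \<otimes> y [^] (0::int)" using Cc by simp
      with c show "c \<in> D" unfolding D_def set_mult_def by blast
    qed
    have "a = 0" if "\<iota> a \<in> D" for a
    proof -
      obtain c k where ck: "c \<in> C" "c \<otimes> y [^] (k::int) = \<iota> a"
        using \<open>\<iota> a \<in> D\<close> unfolding D_def set_mult_def by fastforce
      then have "\<iota> a \<in> C" using yk[OF ck] Csub subgroup.m_closed by fastforce
      then show ?thesis by (rule C0)
    qed
    then have "D = C" using D CD KC by (intro max) (auto simp: \<A>_def)
    moreover have "y \<in> D"
    proof -
      have "y = \<one> \<otimes> y [^] (1::int)" using y by simp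
      then show ?thesis
        unfolding D_def set_mult_def using subgroup.one_closed[OF Csub] by blast
    qed
    ultimately show ?thesis by simp
  qed

  \<comment> \<open>If no positive power of \<open>x\<close> lies in the product of \<open>C\<close>
    and the image of \<open>\<iota>\<close>, then \<open>x\<close> can be adjoined to
    \<open>C\<close> directly. Otherwise the least such exponent \<open>d\<close> is used, and
    divisibility corrects \<open>x\<close> by a central factor so that the corrected element can be
    adjoined.\<close>
  have decomp: "\<exists>c\<in>C. \<exists>a. x = c \<otimes> \<iota> a" if x: "x \<in> carrier P" for x
  proof -
    define I where "I = {n::nat. 0 < n \<and> (\<exists>c\<in>C. \<exists>a. x [^] n = c \<otimes> \<iota> a)}"
    show ?thesis
    proof (cases "I = {}")
      case True
      have "x \<in> C"
      proof (rule adjoin[OF x])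
        fix k :: int and a c
        assume c: "c \<in> C" and eq: "c \<otimes> x [^] k = \<iota> a"
        have "x [^] k = inv c \<otimes> \<iota> a"
          using eq Cc[OF c] x \<iota>(1)[of a] by (metis inv_solve_left int_pow_closed)
        \<comment> \<open>Both signs of the exponent are expressed in the required form because
          \<open>I\<close> contains positive exponents only.\<close>
        moreover have "x [^] (- k) = c \<otimes> \<iota> (- a)"
        proof -
          have "x [^] (- k) = inv (inv c \<otimes> \<iota> a)" using calculation x by (simp add: int_pow_neg)
          then show ?thesis using Cc[OF c] \<iota>(1) by (simp add: inv_mult_group \<iota>inv[symmetric] central)
        qed
        ultimately have pm: "\<exists>c\<in>C. \<exists>a. x [^] k = c \<otimes> \<iota> a" "\<exists>c\<in>C. \<exists>a. x [^] (- k) = c \<otimes> \<iota> a"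
          using c subgroup.m_inv_closed[OF Csub] by blast+
        have "k = 0"
        proof (rule ccontr)
          assume "k \<noteq> 0"
          then consider "k = int (nat k)" "0 < nat k" | "- k = int (nat (- k))" "0 < nat (- k)" by linarith
          then show False
          proof cases
            case 1
            then have "nat k \<in> I" unfolding I_def using pm(1) int_pow_int[of P x "nat k"] by auto
            then show False using True by blast
          next
            case 2
            then have "nat (- k) \<in> I" unfolding I_def using pm(2) int_pow_int[of P x "nat (- k)"] by auto
            then show False using True by blast
          qed
        qed
        then show "x [^] k \<in> C" using subgroup.one_closed[OF Csub] by simp
      qed
      then show ?thesis using \<iota>0 x by (metis r_one)
    next
      case False
      define d where "d = (LEAST n. n \<in> I)"
      have dI: "d \<in> I" and least: "\<And>n. n \<in> I \<Longrightarrow> d \<le> n"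
        using False LeastI_ex[of "\<lambda>n. n \<in> I"] Least_le[of "\<lambda>n. n \<in> I"] unfolding d_def by auto
      obtain c a where ca: "c \<in> C" "x [^] d = c \<otimes> \<iota> a" and d: "0 < d"
        using dI unfolding I_def by blast
      obtain b where b: "(\<Sum>i<d. b) = a" using divisible[OF d] by blast
      \<comment> \<open>As \<open>b\<close> is a d-th part of \<open>a\<close>, the correction
        cancels the central factor of \<open>x [^] d\<close> and leaves \<open>y [^] d = c\<close>
        in \<open>C\<close>.\<close>
      define y where "y = x \<otimes> \<iota> (- b)"
      have y: "y \<in> carrier P" using x \<iota> by (simp add: y_def)
      have yn: "y [^] n = x [^] n \<otimes> \<iota> (\<Sum>i<n. - b)" for n :: nat
        unfolding y_def using x \<iota>(1)[of "- b"] central[OF x, of "- b"]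
        by (simp add: pow_mult_distrib \<iota>pow)
      have yd: "y [^] d = c"
      proof -
        have "y [^] d = c \<otimes> (\<iota> a \<otimes> \<iota> (\<Sum>i<d. - b))"
          using yn[of d] ca Cc[OF ca(1)] \<iota>(1) by (simp add: m_assoc)
        also have "\<dots> = c \<otimes> \<iota> (a + (\<Sum>i<d. - b))" by (simp only: \<iota>(2))
        also have "a + (\<Sum>i<d. - b) = 0" using b by (simp add: sum_negf)
        finally show ?thesis using \<iota>0 Cc[OF ca(1)] by simp
      qed
      have "y \<in> C"
      proof (rule adjoin[OF y])
        fix k :: int and a' c'
        assume c': "c' \<in> C" and eq: "c' \<otimes> y [^] k = \<iota> a'"
        \<comment> \<open>Modulo \<open>C\<close>, the power \<open>y [^] k\<close> is
          \<open>y [^] r\<close>. A positive remainder would put \<open>x [^] r\<close> into the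
          product of \<open>C\<close> and the image of \<open>\<iota>\<close>, against the
          minimality of \<open>d\<close>.\<close>
        define r where "r = nat (k mod int d)"
        have r: "r < d" "k = int d * (k div int d) + int r"
          using d by (auto simp: r_def nat_less_iff)
        have pk: "y [^] k = c [^] (k div int d) \<otimes> y [^] r"
        proof -
          have "y [^] k = y [^] (int d * (k div int d)) \<otimes> y [^] (int r)"
            using y by (subst r(2)) (simp add: int_pow_mult)
          also have "y [^] (int d * (k div int d)) = (y [^] int d) [^] (k div int d)"
            using y by (simp add: int_pow_pow)
          also have "y [^] int d = c" using yd by (simp add: int_pow_int)
          also have "y [^] (int r) = y [^] r" by (rule int_pow_int)
          finally show ?thesis .
        qed
        have ck: "c [^] (k div int d) \<in> C"
          using Csub ca(1) subgroup_int_pow_closed by blast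
        have "r = 0"
        proof (rule ccontr)
          assume "r \<noteq> 0"
          define e where "e = c' \<otimes> c [^] (k div int d)"
          have e: "e \<in> C" using c' ck Csub subgroup.m_closed unfolding e_def by metis
          have "e \<otimes> (x [^] r \<otimes> \<iota> (\<Sum>i<r. - b)) = \<iota> a'"
            using eq pk yn[of r] Cc[OF c'] Cc[OF ck] y x \<iota>(1) unfolding e_def by (simp add: m_assoc)
          then have "x [^] r \<otimes> \<iota> (\<Sum>i<r. - b) = inv e \<otimes> \<iota> a'"
            using Cc[OF e] x \<iota>(1) by (metis inv_solve_left m_closed nat_pow_closed)
          then have "x [^] r \<otimes> (\<iota> (\<Sum>i<r. - b) \<otimes> \<iota> (- (\<Sum>i<r. - b))) = inv e \<otimes> \<iota> a' \<otimes> \<iota> (- (\<Sum>i<r. - b))"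
            using x \<iota>(1) by (metis m_assoc nat_pow_closed)
          then have "x [^] r = inv e \<otimes> \<iota> (a' + - (\<Sum>i<r. - b))"
            using Cc[OF e] x \<iota>(1) by (simp add: \<iota>(2)[symmetric] \<iota>0 m_assoc)
          then have "r \<in> I" unfolding I_def
            using \<open>r \<noteq> 0\<close> e subgroup.m_inv_closed[OF Csub] by blast
          then show False using least r(1) by fastforce
        qed
        then show "y [^] k \<in> C" using pk ck y Cc[OF ca(1)] by simp
      qed
      moreover have "x = y \<otimes> \<iota> b"
        unfolding y_def using x \<iota>(1) by (simp add: m_assoc \<iota>0 flip: \<iota>(2))
      ultimately show ?thesis by blast
    qed
  qed

  have uniq: "a = b" if "c \<in> C" "d \<in> C" "c \<otimes> \<iota> a = d \<otimes> \<iota> b" for a b c d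
  proof -
    have cc: "c \<in> carrier P" "d \<in> carrier P" using that Cc by auto
    have "inv d \<otimes> c \<otimes> (\<iota> a \<otimes> \<iota> (- b)) = inv d \<otimes> (c \<otimes> \<iota> a) \<otimes> \<iota> (- b)"
      using cc \<iota>(1) by (simp add: m_assoc)
    also have "\<dots> = \<one>" unfolding that(3) using cc \<iota>(1)
      by (simp add: m_assoc[symmetric]) (simp add: m_assoc \<iota>0 flip: \<iota>(2))
    finally have "inv d \<otimes> c \<otimes> \<iota> (a - b) = \<one>" by (simp flip: \<iota>(2))
    then have "\<iota> (a - b) = inv (inv d \<otimes> c)"
      using cc \<iota>(1) by (metis inv_closed inv_equality inv_inv m_closed)
    then have "\<iota> (a - b) \<in> C"
      using that(1,2) Csub by (simp add: subgroup.m_closed subgroup.m_inv_closed)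
    then show ?thesis using C0 by fastforce
  qed
  define \<rho> where "\<rho> = (\<lambda>x. THE a. \<exists>c\<in>C. x = c \<otimes> \<iota> a)"
  have \<rho>: "\<rho> (c \<otimes> \<iota> a) = a" if "c \<in> C" for c a
    unfolding \<rho>_def using that uniq by (intro the_equality) blast+
  have "\<rho> (x \<otimes> y) = \<rho> x + \<rho> y" if xy: "x \<in> carrier P" "y \<in> carrier P" for x y
  proof -
    obtain c a d b where *: "c \<in> C" "x = c \<otimes> \<iota> a" "d \<in> C" "y = d \<otimes> \<iota> b"
      using decomp[OF xy(1)] decomp[OF xy(2)] by blast
    have "x \<otimes> y = c \<otimes> (\<iota> a \<otimes> d) \<otimes> \<iota> b" using * Cc \<iota>(1) by (simp add: m_assoc)
    also have "\<iota> a \<otimes> d = d \<otimes> \<iota> a" using * Cc central by blast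
    finally have "x \<otimes> y = (c \<otimes> d) \<otimes> \<iota> (a + b)" using * Cc \<iota> by (simp add: m_assoc)
    then show ?thesis using * \<rho> Csub by (simp add: subgroup.m_closed)
  qed
  moreover have "\<rho> (\<iota> a) = a" for a
    using \<rho>[OF subgroup.one_closed[OF Csub], of a] \<iota>(1) by simp
  moreover have "\<rho> x = 0" if "x \<in> K" for x
    using \<rho>[of x 0] that KC Cc \<iota>0 by auto
  ultimately show ?thesis by blast
qed

subsection \<open>Additive maps and extensions by cocycles\<close>

text \<open>Characters are total functions constrained only on \<open>H\<close>. Restricting one to
  a smaller subgroup leaves the function unchanged, and values elsewhere are irrelevant.\<close>

definition additive_on :: "('a, 'm) monoid_scheme \<Rightarrow> 'a set \<Rightarrow> ('a \<Rightarrow> 'b::ab_group_add) \<Rightarrow> bool" where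
  "additive_on G H \<chi> \<longleftrightarrow> (\<forall>x\<in>H. \<forall>y\<in>H. \<chi> (x \<otimes>\<^bsub>G\<^esub> y) = \<chi> x + \<chi> y)"

definition is_cocycle :: "('a, 'm) monoid_scheme \<Rightarrow> ('a \<Rightarrow> 'a \<Rightarrow> 'b::ab_group_add) \<Rightarrow> bool" where
  "is_cocycle G f \<longleftrightarrow> (\<forall>x\<in>carrier G. \<forall>y\<in>carrier G. \<forall>z\<in>carrier G.
     f y z + f x (y \<otimes>\<^bsub>G\<^esub> z) = f (x \<otimes>\<^bsub>G\<^esub> y) z + f x y)"

definition is_coboundary :: "('a, 'm) monoid_scheme \<Rightarrow> ('a \<Rightarrow> 'a \<Rightarrow> 'b::ab_group_add) \<Rightarrow> bool" where
  "is_coboundary G f \<longleftrightarrow> (\<exists>c. \<forall>x\<in>carrier G. \<forall>y\<in>carrier G. f x y = c x + c y - c (x \<otimes>\<^bsub>G\<^esub> y))"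

text \<open>The extension of \<open>G\<close> by the coefficients with factor set \<open>f\<close>.
  Cocycles are not normalised, which is why the unit carries the correction by the value of
  \<open>f\<close> at the pair of units.\<close>

definition extension_group :: "('a, 'm) monoid_scheme \<Rightarrow> ('a \<Rightarrow> 'a \<Rightarrow> 'b::ab_group_add) \<Rightarrow> ('a \<times> 'b) monoid" where
  "extension_group G f = \<lparr>carrier = carrier G \<times> UNIV,
     monoid.mult = (\<lambda>(x, a) (y, b). (x \<otimes>\<^bsub>G\<^esub> y, a + b + f x y)),
     one = (\<one>\<^bsub>G\<^esub>, - f \<one>\<^bsub>G\<^esub> \<one>\<^bsub>G\<^esub>)\<rparr>"

lemma additive_onD: "additive_on G H \<chi> \<Longrightarrow> x \<in> H \<Longrightarrow> y \<in> H \<Longrightarrow> \<chi> (x \<otimes>\<^bsub>G\<^esub> y) = \<chi> x + \<chi> y"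
  by (simp add: additive_on_def)

lemma additive_on_subset: "additive_on G H \<chi> \<Longrightarrow> K \<subseteq> H \<Longrightarrow> additive_on G K \<chi>"
  by (auto simp: additive_on_def)

lemma additive_on_restricted_group [simp]: "additive_on (restricted_group G A) H \<chi> = additive_on G H \<chi>"
  by (simp add: additive_on_def)

lemma additive_on_add: "additive_on G H \<chi> \<Longrightarrow> additive_on G H \<psi> \<Longrightarrow> additive_on G H (\<lambda>x. \<chi> x + \<psi> x)"
  by (simp add: additive_on_def)

lemma additive_on_diff: "additive_on G H \<chi> \<Longrightarrow> additive_on G H \<psi> \<Longrightarrow> additive_on G H (\<lambda>x. \<chi> x - \<psi> x)"
  by (simp add: additive_on_def)

lemma additive_on_one:
  assumes "group G" "subgroup H G" "additive_on G H \<chi>"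
  shows "\<chi> \<one>\<^bsub>G\<^esub> = 0"
proof -
  have "\<one>\<^bsub>G\<^esub> \<otimes>\<^bsub>G\<^esub> \<one>\<^bsub>G\<^esub> = \<one>\<^bsub>G\<^esub>" using assms(1) by (simp add: group.is_monoid)
  then show ?thesis
    using additive_onD[OF assms(3), of "\<one>\<^bsub>G\<^esub>" "\<one>\<^bsub>G\<^esub>"] subgroup.one_closed[OF assms(2)] by simp
qed

lemma additive_on_inv:
  assumes "group G" "subgroup H G" "additive_on G H \<chi>" "x \<in> H"
  shows "\<chi> (inv\<^bsub>G\<^esub> x) = - \<chi> x"
proof -
  have "\<chi> (inv\<^bsub>G\<^esub> x \<otimes>\<^bsub>G\<^esub> x) = \<chi> (inv\<^bsub>G\<^esub> x) + \<chi> x"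
    using assms(2-4) by (intro additive_onD[OF assms(3)]) (auto simp: subgroup.m_inv_closed)
  moreover have "inv\<^bsub>G\<^esub> x \<otimes>\<^bsub>G\<^esub> x = \<one>\<^bsub>G\<^esub>"
    using assms by (simp add: group.l_inv subgroup.mem_carrier)
  ultimately show ?thesis
    using additive_on_one[OF assms(1-3)] by (simp add: eq_neg_iff_add_eq_0)
qed

lemma additive_on_zero_generate:
  assumes "group G" "subgroup H G" "additive_on G H \<chi>" "T \<subseteq> H" "\<And>t. t \<in> T \<Longrightarrow> \<chi> t = 0"
    and "x \<in> generate G T"
  shows "\<chi> x = 0"
proof -
  have sub: "generate G T \<subseteq> H" by (rule group.generate_subgroup_incl[OF assms(1,4,2)])
  show ?thesis
    using assms(6)
  proof (induction rule: generate.induct)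
    case one
    show ?case by (rule additive_on_one[OF assms(1-3)])
  next
    case (incl h)
    then show ?case by (rule assms(5))
  next
    case (inv h)
    then show ?case using additive_on_inv[OF assms(1-3), of h] assms(4,5) by auto
  next
    case (eng h1 h2)
    then show ?case using additive_onD[OF assms(3), of h1 h2] sub by auto
  qed
qed

lemma additive_on_commutator:
  assumes "group G" "additive_on G (carrier G) \<chi>" "x \<in> commutators G"
  shows "\<chi> x = 0"
proof -
  interpret group G by fact
  obtain a b where "x = inv\<^bsub>G\<^esub> a \<otimes>\<^bsub>G\<^esub> inv\<^bsub>G\<^esub> b \<otimes>\<^bsub>G\<^esub> a \<otimes>\<^bsub>G\<^esub> b" "a \<in> carrier G" "b \<in> carrier G"
    using assms(3) by (auto simp: commutators_def)
  then show ?thesis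
    using additive_onD[OF assms(2)] additive_on_inv[OF assms(1) subgroup_self assms(2)] by simp
qed

lemma group_extension_group:
  assumes "group G" "is_cocycle G f"
  shows "group (extension_group G f)"
proof -
  interpret group G by fact
  have co: "f y z + f x (y \<otimes>\<^bsub>G\<^esub> z) = f (x \<otimes>\<^bsub>G\<^esub> y) z + f x y"
    if "x \<in> carrier G" "y \<in> carrier G" "z \<in> carrier G" for x y z
    using assms(2) that by (simp add: is_cocycle_def)
  have l1: "f \<one>\<^bsub>G\<^esub> z = f \<one>\<^bsub>G\<^esub> \<one>\<^bsub>G\<^esub>" if "z \<in> carrier G" for z
    using co[of "\<one>\<^bsub>G\<^esub>" "\<one>\<^bsub>G\<^esub>" z] that by simp
  show ?thesis
  proof (rule groupI)
    fix p q r
    assume "p \<in> carrier (extension_group G f)" "q \<in> carrier (extension_group G f)"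
      "r \<in> carrier (extension_group G f)"
    then obtain x a y b z c where *: "p = (x, a)" "q = (y, b)" "r = (z, c)"
      "x \<in> carrier G" "y \<in> carrier G" "z \<in> carrier G"
      by (auto simp: extension_group_def)
    show "p \<otimes>\<^bsub>extension_group G f\<^esub> q \<otimes>\<^bsub>extension_group G f\<^esub> r
        = p \<otimes>\<^bsub>extension_group G f\<^esub> (q \<otimes>\<^bsub>extension_group G f\<^esub> r)"
      using * co[of x y z] by (simp add: extension_group_def m_assoc algebra_simps)
  next
    fix p assume "p \<in> carrier (extension_group G f)"
    then obtain x a where *: "p = (x, a)" "x \<in> carrier G" by (auto simp: extension_group_def)
    show "\<one>\<^bsub>extension_group G f\<^esub> \<otimes>\<^bsub>extension_group G f\<^esub> p = p"
      using * l1[of x] by (simp add: extension_group_def)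
    show "\<exists>q\<in>carrier (extension_group G f). q \<otimes>\<^bsub>extension_group G f\<^esub> p = \<one>\<^bsub>extension_group G f\<^esub>"
      using * by (intro bexI[of _ "(inv\<^bsub>G\<^esub> x, - a - f (inv\<^bsub>G\<^esub> x) x - f \<one>\<^bsub>G\<^esub> \<one>\<^bsub>G\<^esub>)"])
        (auto simp: extension_group_def)
  qed (auto simp: extension_group_def)
qed

lemma cocycle_one:
  assumes "group G" "is_cocycle G f" "x \<in> carrier G"
  shows "f \<one>\<^bsub>G\<^esub> x = f \<one>\<^bsub>G\<^esub> \<one>\<^bsub>G\<^esub>" "f x \<one>\<^bsub>G\<^esub> = f \<one>\<^bsub>G\<^esub> \<one>\<^bsub>G\<^esub>"
proof -
  interpret group G by fact
  have co: "f y z + f x (y \<otimes>\<^bsub>G\<^esub> z) = f (x \<otimes>\<^bsub>G\<^esub> y) z + f x y"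
    if "x \<in> carrier G" "y \<in> carrier G" "z \<in> carrier G" for x y z
    using assms(2) that by (simp add: is_cocycle_def)
  show "f \<one>\<^bsub>G\<^esub> x = f \<one>\<^bsub>G\<^esub> \<one>\<^bsub>G\<^esub>" using co[of "\<one>\<^bsub>G\<^esub>" "\<one>\<^bsub>G\<^esub>" x] assms(3) by simp
  show "f x \<one>\<^bsub>G\<^esub> = f \<one>\<^bsub>G\<^esub> \<one>\<^bsub>G\<^esub>" using co[of x "\<one>\<^bsub>G\<^esub>" "\<one>\<^bsub>G\<^esub>"] assms(3) by simp
qed

section \<open>Extension of characters and triviality of symmetric cocycles\<close>

text \<open>In the direct product of \<open>G\<close> with the coefficients, the pairs
  \<open>(h l, \<chi> h)\<close> form a subgroup. It contains all commutators, since these have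
  second component 0 and first component in \<open>L\<close>, and it meets the coefficients
  trivially because \<open>\<chi>\<close> vanishes on the intersection of \<open>H\<close> and
  \<open>L\<close>. A retraction onto the coefficients that kills this subgroup encodes the extended
  character.\<close>

lemma additive_extension:
  fixes \<chi> :: "'a \<Rightarrow> 'b::divisible_ab_group_add"
  assumes G: "group G" and H: "subgroup H G" and L: "subgroup L G" "commutators G \<subseteq> L"
    and \<chi>: "additive_on G H \<chi>" "\<And>x. x \<in> H \<Longrightarrow> x \<in> L \<Longrightarrow> \<chi> x = 0"
  shows "\<exists>\<psi>. additive_on G (carrier G) \<psi> \<and> (\<forall>x\<in>H. \<psi> x = \<chi> x) \<and> (\<forall>x\<in>L. \<psi> x = 0)"
proof -
  interpret group G by fact
  \<comment> \<open>The extension by the zero cocycle is the direct product.\<close>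
  define z where "z = (\<lambda>(x::'a) (y::'a). 0 :: 'b)"
  define P where "P = extension_group G z"
  have P: "group P" unfolding P_def by (rule group_extension_group[OF G]) (simp add: is_cocycle_def z_def)
  have Pc: "carrier P = carrier G \<times> UNIV" by (simp add: P_def extension_group_def)
  have Pm: "(x, a) \<otimes>\<^bsub>P\<^esub> (y, b) = (x \<otimes>\<^bsub>G\<^esub> y, a + b)" for x y a b
    by (simp add: P_def extension_group_def z_def)
  have Po: "\<one>\<^bsub>P\<^esub> = (\<one>\<^bsub>G\<^esub>, 0)" by (simp add: P_def extension_group_def z_def)
  have Pi: "inv\<^bsub>P\<^esub> (x, a) = (inv\<^bsub>G\<^esub> x, - a)" if "x \<in> carrier G" for x a
    using that by (intro group.inv_equality[OF P]) (auto simp: Pm Po Pc)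
  have Hc: "h \<in> carrier G" if "h \<in> H" for h using H that by (rule subgroup.mem_carrier)
  have Lc: "h \<in> carrier G" if "h \<in> L" for h using L(1) that by (rule subgroup.mem_carrier)
  have Ln: "L \<lhd> G" using G L by (rule commutators_subset_imp_normal)
  have \<chi>1: "\<chi> \<one>\<^bsub>G\<^esub> = 0" by (rule additive_on_one[OF G H \<chi>(1)])
  \<comment> \<open>The graph of the map that \<open>\<chi>\<close> induces on the product of
    \<open>H\<close> and \<open>L\<close>, being 0 on \<open>L\<close>. Normality of
    \<open>L\<close> makes it closed under multiplication and inversion.\<close>
  define K where "K = {(h \<otimes>\<^bsub>G\<^esub> l, \<chi> h) |h l. h \<in> H \<and> l \<in> L}"
  have conj: "inv\<^bsub>G\<^esub> h \<otimes>\<^bsub>G\<^esub> l \<otimes>\<^bsub>G\<^esub> h \<in> L" if "h \<in> carrier G" "l \<in> L" for h l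
    using normal.inv_op_closed1[OF Ln] that by blast
  have K: "subgroup K P"
  proof (rule group.subgroupI[OF P])
    show "K \<subseteq> carrier P" using Hc Lc by (auto simp: K_def Pc)
    show "K \<noteq> {}" using subgroup.one_closed[OF H] subgroup.one_closed[OF L(1)] by (auto simp: K_def)
    fix p assume "p \<in> K"
    then obtain h l where p: "p = (h \<otimes>\<^bsub>G\<^esub> l, \<chi> h)" "h \<in> H" "l \<in> L" by (auto simp: K_def)
    have c: "h \<in> carrier G" "l \<in> carrier G" using p Hc Lc by auto
    have "inv\<^bsub>G\<^esub> (h \<otimes>\<^bsub>G\<^esub> l) = inv\<^bsub>G\<^esub> h \<otimes>\<^bsub>G\<^esub> (inv\<^bsub>G\<^esub> (inv\<^bsub>G\<^esub> h) \<otimes>\<^bsub>G\<^esub> inv\<^bsub>G\<^esub> l \<otimes>\<^bsub>G\<^esub> inv\<^bsub>G\<^esub> h)"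
      using c by (simp add: inv_mult_group m_assoc[symmetric])
    moreover have "inv\<^bsub>G\<^esub> (inv\<^bsub>G\<^esub> h) \<otimes>\<^bsub>G\<^esub> inv\<^bsub>G\<^esub> l \<otimes>\<^bsub>G\<^esub> inv\<^bsub>G\<^esub> h \<in> L"
      using c subgroup.m_inv_closed[OF L(1) p(3)] by (intro conj) auto
    moreover have "\<chi> (inv\<^bsub>G\<^esub> h) = - \<chi> h" by (rule additive_on_inv[OF G H \<chi>(1) p(2)])
    ultimately show "inv\<^bsub>P\<^esub> p \<in> K"
      using c p subgroup.m_inv_closed[OF H p(2)] unfolding K_def
      by (simp add: Pi) metis
    fix q assume "q \<in> K"
    then obtain h' l' where q: "q = (h' \<otimes>\<^bsub>G\<^esub> l', \<chi> h')" "h' \<in> H" "l' \<in> L" by (auto simp: K_def)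
    have c': "h' \<in> carrier G" "l' \<in> carrier G" using q Hc Lc by auto
    have "h \<otimes>\<^bsub>G\<^esub> l \<otimes>\<^bsub>G\<^esub> (h' \<otimes>\<^bsub>G\<^esub> l') = (h \<otimes>\<^bsub>G\<^esub> h') \<otimes>\<^bsub>G\<^esub> (inv\<^bsub>G\<^esub> h' \<otimes>\<^bsub>G\<^esub> l \<otimes>\<^bsub>G\<^esub> h' \<otimes>\<^bsub>G\<^esub> l')"
    proof -
      have "h' \<otimes>\<^bsub>G\<^esub> (inv\<^bsub>G\<^esub> h' \<otimes>\<^bsub>G\<^esub> z) = z" if "z \<in> carrier G" for z
        using c' that by (simp add: m_assoc[symmetric])
      then show ?thesis using c c' by (simp add: m_assoc)
    qed
    moreover have "inv\<^bsub>G\<^esub> h' \<otimes>\<^bsub>G\<^esub> l \<otimes>\<^bsub>G\<^esub> h' \<otimes>\<^bsub>G\<^esub> l' \<in> L"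
      using conj[OF c'(1) p(3)] q(3) L(1) by (simp add: subgroup.m_closed)
    moreover have "\<chi> (h \<otimes>\<^bsub>G\<^esub> h') = \<chi> h + \<chi> h'" by (rule additive_onD[OF \<chi>(1) p(2) q(2)])
    moreover have "h \<otimes>\<^bsub>G\<^esub> h' \<in> H" using subgroup.m_closed[OF H p(2) q(2)] .
    ultimately show "p \<otimes>\<^bsub>P\<^esub> q \<in> K"
      using p q unfolding K_def by (simp add: Pm) metis
  qed
  have com: "commutators P \<subseteq> K"
  proof
    fix p assume "p \<in> commutators P"
    then obtain x a y b where xy: "x \<in> carrier G" "y \<in> carrier G"
      "p = inv\<^bsub>P\<^esub> (x, a) \<otimes>\<^bsub>P\<^esub> inv\<^bsub>P\<^esub> (y, b) \<otimes>\<^bsub>P\<^esub> (x, a) \<otimes>\<^bsub>P\<^esub> (y, b)"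
      unfolding commutators_def Pc by blast
    then have "p = (\<one>\<^bsub>G\<^esub> \<otimes>\<^bsub>G\<^esub> (inv\<^bsub>G\<^esub> x \<otimes>\<^bsub>G\<^esub> inv\<^bsub>G\<^esub> y \<otimes>\<^bsub>G\<^esub> x \<otimes>\<^bsub>G\<^esub> y), \<chi> \<one>\<^bsub>G\<^esub>)"
      by (simp add: Pi Pm \<chi>1)
    moreover have "inv\<^bsub>G\<^esub> x \<otimes>\<^bsub>G\<^esub> inv\<^bsub>G\<^esub> y \<otimes>\<^bsub>G\<^esub> x \<otimes>\<^bsub>G\<^esub> y \<in> L"
      using L(2) xy unfolding commutators_def by blast
    ultimately show "p \<in> K" using subgroup.one_closed[OF H] unfolding K_def by blast
  qed
  have K0: "a = 0" if aK: "(\<one>\<^bsub>G\<^esub>, a) \<in> K" for a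
  proof -
    obtain h l where hl: "h \<in> H" "l \<in> L" "h \<otimes>\<^bsub>G\<^esub> l = \<one>\<^bsub>G\<^esub>" "a = \<chi> h"
      using aK by (auto simp: K_def)
    have "h = inv\<^bsub>G\<^esub> l" using inv_equality[OF hl(3)] hl(1,2) Hc Lc by simp
    then have "h \<in> L" using subgroup.m_inv_closed[OF L(1) hl(2)] by simp
    then show ?thesis using \<chi>(2) hl by simp
  qed
  have "\<exists>\<rho>::'a \<times> 'b \<Rightarrow> 'b. (\<forall>p\<in>carrier P. \<forall>q\<in>carrier P. \<rho> (p \<otimes>\<^bsub>P\<^esub> q) = \<rho> p + \<rho> q)
      \<and> (\<forall>a. \<rho> (\<one>\<^bsub>G\<^esub>, a) = a) \<and> (\<forall>p\<in>K. \<rho> p = 0)"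
    by (rule central_divisible_retraction[OF P _ _ _ K com K0]) (auto simp: Pc Pm add.commute)
  then obtain \<rho> :: "'a \<times> 'b \<Rightarrow> 'b" where
    \<rho>: "\<And>p q. p \<in> carrier P \<Longrightarrow> q \<in> carrier P \<Longrightarrow> \<rho> (p \<otimes>\<^bsub>P\<^esub> q) = \<rho> p + \<rho> q"
      "\<And>a. \<rho> (\<one>\<^bsub>G\<^esub>, a) = a" "\<And>p. p \<in> K \<Longrightarrow> \<rho> p = 0"
    by blast
  \<comment> \<open>The sign is forced: \<open>(h, \<chi> h)\<close> is killed by
    \<open>\<rho>\<close>, while \<open>\<rho>\<close> returns the second component on the
    coefficients, so \<open>\<rho> (h, 0)\<close> is \<open>- \<chi> h\<close>.\<close>
  define \<psi> where "\<psi> = (\<lambda>x. - \<rho> (x, 0))"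
  have "\<psi> (x \<otimes>\<^bsub>G\<^esub> y) = \<psi> x + \<psi> y" if "x \<in> carrier G" "y \<in> carrier G" for x y
    using \<rho>(1)[of "(x, 0)" "(y, 0)"] that by (simp add: \<psi>_def Pc Pm)
  moreover have "\<psi> h = \<chi> h" if "h \<in> H" for h
  proof -
    have "(h \<otimes>\<^bsub>G\<^esub> \<one>\<^bsub>G\<^esub>, \<chi> h) \<in> K" using that subgroup.one_closed[OF L(1)] by (auto simp: K_def)
    then have "\<rho> (h, \<chi> h) = 0" using \<rho>(3) Hc[OF that] by simp
    then show ?thesis
      using \<rho>(1)[of "(h, 0)" "(\<one>\<^bsub>G\<^esub>, \<chi> h)"] \<rho>(2) Hc[OF that] by (simp add: \<psi>_def Pc Pm add_eq_0_iff)
  qed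
  moreover have "\<psi> l = 0" if "l \<in> L" for l
  proof -
    have "(\<one>\<^bsub>G\<^esub> \<otimes>\<^bsub>G\<^esub> l, \<chi> \<one>\<^bsub>G\<^esub>) \<in> K" using that subgroup.one_closed[OF H] by (auto simp: K_def)
    then show ?thesis using \<rho>(3) Lc[OF that] \<chi>1 by (simp add: \<psi>_def)
  qed
  ultimately show ?thesis unfolding additive_on_def by blast
qed

text \<open>Symmetry of \<open>f\<close> over an abelian group makes the extension group abelian, so
  the trivial subgroup already contains all commutators and the coefficients split off. Applying the
  retraction to the product of \<open>(x, 0)\<close> and \<open>(y, 0)\<close>, whose second
  component is \<open>f x y\<close>, displays \<open>f\<close> as a coboundary.\<close>

lemma symmetric_cocycle_is_coboundary:
  fixes f :: "'a \<Rightarrow> 'a \<Rightarrow> 'b::divisible_ab_group_add"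
  assumes "comm_group G" and f: "is_cocycle G f"
    and sym: "\<And>x y. x \<in> carrier G \<Longrightarrow> y \<in> carrier G \<Longrightarrow> f x y = f y x"
  shows "is_coboundary G f"
proof -
  interpret comm_group G by fact
  have G: "group G" ..
  define P where "P = extension_group G f"
  have P: "group P" unfolding P_def by (rule group_extension_group[OF G f])
  have Pc: "carrier P = carrier G \<times> UNIV" by (simp add: P_def extension_group_def)
  have Pm: "(x, a) \<otimes>\<^bsub>P\<^esub> (y, b) = (x \<otimes>\<^bsub>G\<^esub> y, a + b + f x y)" for x y a b
    by (simp add: P_def extension_group_def)
  have Po: "\<one>\<^bsub>P\<^esub> = (\<one>\<^bsub>G\<^esub>, - f \<one>\<^bsub>G\<^esub> \<one>\<^bsub>G\<^esub>)" by (simp add: P_def extension_group_def)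
  interpret P: group P by (rule P)
  have comm: "p \<otimes>\<^bsub>P\<^esub> q = q \<otimes>\<^bsub>P\<^esub> p" if "p \<in> carrier P" "q \<in> carrier P" for p q
    using that sym by (auto simp: Pc Pm m_comm add.commute)
  have com: "commutators P \<subseteq> {\<one>\<^bsub>P\<^esub>}"
  proof
    fix p assume "p \<in> commutators P"
    then obtain x y where xy: "x \<in> carrier P" "y \<in> carrier P"
      "p = inv\<^bsub>P\<^esub> x \<otimes>\<^bsub>P\<^esub> inv\<^bsub>P\<^esub> y \<otimes>\<^bsub>P\<^esub> x \<otimes>\<^bsub>P\<^esub> y"
      unfolding commutators_def by blast
    have "p = inv\<^bsub>P\<^esub> x \<otimes>\<^bsub>P\<^esub> (inv\<^bsub>P\<^esub> y \<otimes>\<^bsub>P\<^esub> (y \<otimes>\<^bsub>P\<^esub> x))"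
      using xy comm[of x y] by (simp add: P.m_assoc)
    also have "\<dots> = inv\<^bsub>P\<^esub> x \<otimes>\<^bsub>P\<^esub> ((inv\<^bsub>P\<^esub> y \<otimes>\<^bsub>P\<^esub> y) \<otimes>\<^bsub>P\<^esub> x)"
      using xy by (simp only: P.m_assoc P.inv_closed)
    finally show "p \<in> {\<one>\<^bsub>P\<^esub>}" using xy by simp
  qed
  \<comment> \<open>The coefficients embed by \<open>a\<close> going to
    \<open>(1, a - f 1 1)\<close>; the shift makes this map additive and sends 0 to the unit of the
    extension.\<close>
  have "\<exists>\<rho>::'a \<times> 'b \<Rightarrow> 'b. (\<forall>p\<in>carrier P. \<forall>q\<in>carrier P. \<rho> (p \<otimes>\<^bsub>P\<^esub> q) = \<rho> p + \<rho> q)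
      \<and> (\<forall>a. \<rho> (\<one>\<^bsub>G\<^esub>, a - f \<one>\<^bsub>G\<^esub> \<one>\<^bsub>G\<^esub>) = a) \<and> (\<forall>p\<in>{\<one>\<^bsub>P\<^esub>}. \<rho> p = 0)"
    by (rule central_divisible_retraction[OF P _ _ comm P.triv_subgroup com])
      (auto simp: Pc Pm Po algebra_simps)
  then obtain \<rho> :: "'a \<times> 'b \<Rightarrow> 'b" where
    \<rho>: "\<And>p q. p \<in> carrier P \<Longrightarrow> q \<in> carrier P \<Longrightarrow> \<rho> (p \<otimes>\<^bsub>P\<^esub> q) = \<rho> p + \<rho> q"
      "\<And>a. \<rho> (\<one>\<^bsub>G\<^esub>, a - f \<one>\<^bsub>G\<^esub> \<one>\<^bsub>G\<^esub>) = a"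
    by blast
  have *: "\<rho> (x, a) = a + \<rho> (x, 0)" if "x \<in> carrier G" for x a
    using \<rho>(1)[of "(\<one>\<^bsub>G\<^esub>, a - f \<one>\<^bsub>G\<^esub> \<one>\<^bsub>G\<^esub>)" "(x, 0)"] \<rho>(2)[of a] cocycle_one[OF G f that] that
    by (simp add: Pc Pm)
  have "f x y = \<rho> (x, 0) + \<rho> (y, 0) - \<rho> (x \<otimes>\<^bsub>G\<^esub> y, 0)" if "x \<in> carrier G" "y \<in> carrier G" for x y
    using \<rho>(1)[of "(x, 0)" "(y, 0)"] *[of "x \<otimes>\<^bsub>G\<^esub> y" "f x y"] that by (simp add: Pc Pm algebra_simps)
  then show ?thesis unfolding is_coboundary_def by (intro exI[of _ "\<lambda>x. \<rho> (x, 0)"]) simp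
qed

subsection \<open>Free groups are projective\<close>

text \<open>Lift the basis elements along \<open>p\<close> and extend to a homomorphism. Its
  composite with \<open>p\<close> agrees with the given isomorphism on the basis, hence
  everywhere.\<close>

lemma free_group_section:
  assumes "is_free_group F" "group E" "p \<in> hom E F" "p ` carrier E = carrier F"
  shows "\<exists>s\<in>hom F E. \<forall>x\<in>carrier F. p (s x) = x"
proof -
  obtain X :: "'a set" and \<phi> where F: "group F" and \<phi>: "\<phi> \<in> iso F (free_group X)"
    using assms(1) unfolding is_free_group_def is_iso_def by blast
  define \<psi> where "\<psi> = inv_into (carrier F) \<phi>"
  have \<psi>: "\<psi> \<in> iso (free_group X) F"
    unfolding \<psi>_def by (rule group.iso_set_sym[OF F \<phi>])
  have \<psi>h: "\<psi> \<in> hom (free_group X) F" and \<phi>h: "\<phi> \<in> hom F (free_group X)"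
    using \<phi> \<psi> by (auto simp: iso_def)
  have \<psi>\<phi>: "\<psi> (\<phi> x) = x" if "x \<in> carrier F" for x
    using \<phi> that unfolding \<psi>_def by (auto simp: iso_def bij_betw_def)
  have "word_class X [(x, True)] \<in> carrier (free_group X)" if "x \<in> X" for x
    using that by (simp add: free_group_def words_def)
  then have "\<forall>x\<in>X. \<exists>e\<in>carrier E. p e = \<psi> (word_class X [(x, True)])"
    using \<psi>h assms(4) by (metis hom_in_carrier imageE)
  then obtain h where h: "\<And>x. x \<in> X \<Longrightarrow> h x \<in> carrier E \<and> p (h x) = \<psi> (word_class X [(x, True)])"
    by metis
  obtain k where k: "k \<in> hom (free_group X) E" "\<And>x. x \<in> X \<Longrightarrow> k (word_class X [(x, True)]) = h x"
    using free_group_hom_exists[OF assms(2), of h X] h by blast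
  have pk: "p \<circ> k \<in> hom (free_group X) F" by (rule hom_compose[OF k(1) assms(3)])
  have "(p \<circ> k) q = \<psi> q" if "q \<in> carrier (free_group X)" for q
    by (rule free_group_hom_unique[OF F pk \<psi>h _ that]) (simp add: k h)
  then have "p ((k \<circ> \<phi>) x) = x" if "x \<in> carrier F" for x
    using that \<psi>\<phi> hom_in_carrier[OF \<phi>h] by simp
  moreover have "k \<circ> \<phi> \<in> hom F E" by (rule hom_compose[OF \<phi>h k(1)])
  ultimately show ?thesis by blast
qed

text \<open>The extension defined by \<open>f\<close> has a homomorphic section over a free group.
  Comparing second components of the section at \<open>x\<close>, \<open>y\<close> and their product
  recovers \<open>f\<close>, so minus the second component is a bounding cochain.\<close>

lemma cocycle_on_free_group_is_coboundary:
  assumes "is_free_group F" "is_cocycle F f"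
  shows "is_coboundary F f"
proof -
  have F: "group F" using assms(1) by (simp add: is_free_group_def)
  have "fst ` carrier (extension_group F f) = carrier F" by (auto simp: extension_group_def)
  moreover have "fst \<in> hom (extension_group F f) F" by (auto simp: hom_def extension_group_def)
  ultimately have "\<exists>s\<in>hom F (extension_group F f). \<forall>x\<in>carrier F. fst (s x) = x"
    by (intro free_group_section[OF assms(1) group_extension_group[OF F assms(2)]])
  then obtain s where s: "s \<in> hom F (extension_group F f)" "\<And>x. x \<in> carrier F \<Longrightarrow> fst (s x) = x"
    by (elim bexE) simp
  have "f x y = - snd (s x) + - snd (s y) - - snd (s (x \<otimes>\<^bsub>F\<^esub> y))"
    if xy: "x \<in> carrier F" "y \<in> carrier F" for x y
  proof -
    obtain a b where ab: "s x = (x, a)" "s y = (y, b)"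
      using s(2)[OF xy(1)] s(2)[OF xy(2)] prod.collapse[of "s x"] prod.collapse[of "s y"] by metis
    have "s (x \<otimes>\<^bsub>F\<^esub> y) = (x \<otimes>\<^bsub>F\<^esub> y, a + b + f x y)"
      using hom_mult[OF s(1) xy] unfolding ab by (simp add: extension_group_def)
    then show ?thesis by (simp add: ab)
  qed
  then show ?thesis unfolding is_coboundary_def by (intro exI[of _ "\<lambda>x. - snd (s x)"]) simp
qed

subsection \<open>Transgression along an epimorphism\<close>

text \<open>\<open>transgresses E M p \<chi> \<phi>\<close> says that the cocycle \<open>\<phi>\<close> on \<open>E / M\<close> is a transgression of the character \<open>\<chi>\<close>
  of \<open>M\<close>, without choosing a section: the cochain \<open>k\<close> extends \<open>\<chi>\<close> (up to a constant) to \<open>E\<close>, and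
  \<open>\<phi>\<close> measures the failure of \<open>k\<close> to be additive.\<close>

definition transgresses ::
  "('a, 'm) monoid_scheme \<Rightarrow> 'a set \<Rightarrow> ('a \<Rightarrow> 'q) \<Rightarrow> ('a \<Rightarrow> 'b::ab_group_add) \<Rightarrow> ('q \<Rightarrow> 'q \<Rightarrow> 'b) \<Rightarrow> bool" where
  "transgresses E M p \<chi> \<phi> \<longleftrightarrow> (\<exists>k.
     (\<forall>x\<in>carrier E. \<forall>y\<in>carrier E. \<phi> (p x) (p y) = k (x \<otimes>\<^bsub>E\<^esub> y) - k x - k y) \<and>
     (\<forall>m\<in>M. \<forall>x\<in>carrier E. k (m \<otimes>\<^bsub>E\<^esub> x) = \<chi> m + k x))"

text \<open>At a commuting pair every coboundary is symmetric, so this is a property of the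
  cohomology class although it is stated for a cocycle.\<close>

definition commuting_symmetric :: "('q, 'm) monoid_scheme \<Rightarrow> ('q \<Rightarrow> 'q \<Rightarrow> 'b) \<Rightarrow> bool" where
  "commuting_symmetric Q \<phi> \<longleftrightarrow> (\<forall>a\<in>carrier Q. \<forall>b\<in>carrier Q. a \<otimes>\<^bsub>Q\<^esub> b = b \<otimes>\<^bsub>Q\<^esub> a \<longrightarrow> \<phi> a b = \<phi> b a)"

lemma commuting_symmetricD:
  "commuting_symmetric Q \<phi> \<Longrightarrow> a \<in> carrier Q \<Longrightarrow> b \<in> carrier Q \<Longrightarrow> a \<otimes>\<^bsub>Q\<^esub> b = b \<otimes>\<^bsub>Q\<^esub> a \<Longrightarrow> \<phi> a b = \<phi> b a"
  by (simp add: commuting_symmetric_def)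

lemma transgresses_add:
  assumes "transgresses E M p \<chi> \<phi>" "transgresses E M p \<chi>' \<phi>'"
  shows "transgresses E M p (\<lambda>m. \<chi> m + \<chi>' m) (\<lambda>a b. \<phi> a b + \<phi>' a b)"
proof -
  obtain k k' where
    "\<And>x y. x \<in> carrier E \<Longrightarrow> y \<in> carrier E \<Longrightarrow> \<phi> (p x) (p y) = k (x \<otimes>\<^bsub>E\<^esub> y) - k x - k y"
    "\<And>m x. m \<in> M \<Longrightarrow> x \<in> carrier E \<Longrightarrow> k (m \<otimes>\<^bsub>E\<^esub> x) = \<chi> m + k x"
    "\<And>x y. x \<in> carrier E \<Longrightarrow> y \<in> carrier E \<Longrightarrow> \<phi>' (p x) (p y) = k' (x \<otimes>\<^bsub>E\<^esub> y) - k' x - k' y"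
    "\<And>m x. m \<in> M \<Longrightarrow> x \<in> carrier E \<Longrightarrow> k' (m \<otimes>\<^bsub>E\<^esub> x) = \<chi>' m + k' x"
    using assms unfolding transgresses_def by (elim exE conjE) simp
  note k = this
  show ?thesis
    unfolding transgresses_def
    by (intro exI[of _ "\<lambda>x. k x + k' x"] conjI ballI; simp only: k) (simp_all add: algebra_simps)
qed

lemma transgresses_diff:
  assumes "transgresses E M p \<chi> \<phi>" "transgresses E M p \<chi>' \<phi>'"
  shows "transgresses E M p (\<lambda>m. \<chi> m - \<chi>' m) (\<lambda>a b. \<phi> a b - \<phi>' a b)"
proof -
  obtain k k' where
    "\<And>x y. x \<in> carrier E \<Longrightarrow> y \<in> carrier E \<Longrightarrow> \<phi> (p x) (p y) = k (x \<otimes>\<^bsub>E\<^esub> y) - k x - k y"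
    "\<And>m x. m \<in> M \<Longrightarrow> x \<in> carrier E \<Longrightarrow> k (m \<otimes>\<^bsub>E\<^esub> x) = \<chi> m + k x"
    "\<And>x y. x \<in> carrier E \<Longrightarrow> y \<in> carrier E \<Longrightarrow> \<phi>' (p x) (p y) = k' (x \<otimes>\<^bsub>E\<^esub> y) - k' x - k' y"
    "\<And>m x. m \<in> M \<Longrightarrow> x \<in> carrier E \<Longrightarrow> k' (m \<otimes>\<^bsub>E\<^esub> x) = \<chi>' m + k' x"
    using assms unfolding transgresses_def by (elim exE conjE) simp
  note k = this
  show ?thesis
    unfolding transgresses_def
    by (intro exI[of _ "\<lambda>x. k x - k' x"] conjI ballI; simp only: k) (simp_all add: algebra_simps)
qed

text \<open>The same cochain \<open>k\<close> witnesses the transgression to a larger quotient.\<close>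

lemma transgresses_inflate:
  assumes "transgresses E M (\<lambda>x. q (p x)) \<chi> \<phi>" "M' \<subseteq> M"
  shows "transgresses E M' p \<chi> (\<lambda>a b. \<phi> (q a) (q b))"
  using assms unfolding transgresses_def by blast

locale epimorphism = group_hom E Q p for E (structure) and Q and p +
  assumes surj: "p ` carrier E = carrier Q"
begin

lemma preimage: "a \<in> carrier Q \<Longrightarrow> \<exists>x\<in>carrier E. p x = a"
  by (metis surj imageE)

lemma kernel_carrier: "m \<in> kernel E Q p \<Longrightarrow> m \<in> carrier E"
  by (simp add: kernel_def)

text \<open>Pulled back to \<open>E\<close>, the function is the coboundary of \<open>-k\<close>; as
  \<open>p\<close> is onto, the cocycle identity descends to \<open>Q\<close>.\<close>

lemma transgresses_cocycle:
  assumes "transgresses E (kernel E Q p) p \<chi> \<phi>"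
  shows "is_cocycle Q \<phi>"
proof -
  obtain k where k: "\<And>x y. x \<in> carrier E \<Longrightarrow> y \<in> carrier E \<Longrightarrow> \<phi> (p x) (p y) = k (x \<otimes> y) - k x - k y"
    "\<And>m x. m \<in> kernel E Q p \<Longrightarrow> x \<in> carrier E \<Longrightarrow> k (m \<otimes> x) = \<chi> m + k x"
    using assms unfolding transgresses_def by (elim exE conjE) simp
  show ?thesis unfolding is_cocycle_def
  proof (intro ballI)
    fix a b c assume "a \<in> carrier Q" "b \<in> carrier Q" "c \<in> carrier Q"
    then obtain x y z where *: "x \<in> carrier E" "y \<in> carrier E" "z \<in> carrier E" "a = p x" "b = p y" "c = p z"
      using preimage by metis
    show "\<phi> b c + \<phi> a (b \<otimes>\<^bsub>Q\<^esub> c) = \<phi> (a \<otimes>\<^bsub>Q\<^esub> b) c + \<phi> a b"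
      using * k(1)[of y z] k(1)[of x "y \<otimes> z"] k(1)[of "x \<otimes> y" z] k(1)[of x y] by (simp add: G.m_assoc)
  qed
qed

text \<open>Evaluating \<open>k\<close> at \<open>m \<otimes> n\<close> by splitting off both
  factors at once or one after the other gives the two sides, up to the common constant
  \<open>k \<one>\<close>.\<close>

lemma transgresses_additive:
  assumes "transgresses E (kernel E Q p) p \<chi> \<phi>"
  shows "additive_on E (kernel E Q p) \<chi>"
proof -
  obtain k where k: "\<And>x y. x \<in> carrier E \<Longrightarrow> y \<in> carrier E \<Longrightarrow> \<phi> (p x) (p y) = k (x \<otimes> y) - k x - k y"
    "\<And>m x. m \<in> kernel E Q p \<Longrightarrow> x \<in> carrier E \<Longrightarrow> k (m \<otimes> x) = \<chi> m + k x"
    using assms unfolding transgresses_def by (elim exE conjE) simp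
  have "\<chi> (m \<otimes> n) = \<chi> m + \<chi> n" if "m \<in> kernel E Q p" "n \<in> kernel E Q p" for m n
    using that k(2)[of "m \<otimes> n" \<one>] k(2)[of m n] k(2)[of n \<one>] subgroup.m_closed[OF subgroup_kernel that]
    by (simp add: kernel_carrier)
  then show ?thesis by (simp add: additive_on_def)
qed

section \<open>Reading properties of a transgressed cocycle off its character\<close>

lemma commutator_swap:
  assumes "x \<in> carrier E" "y \<in> carrier E"
  shows "x \<otimes> y \<otimes> inv x \<otimes> inv y \<in> commutators E"
proof -
  have "inv (inv x) \<otimes> inv (inv y) \<otimes> inv x \<otimes> inv y \<in> commutators E"
    unfolding commutators_def using assms G.inv_closed by blast
  then show ?thesis using assms by simp
qed

text \<open>The asymmetry of \<open>\<phi>\<close> at the images of x and y is k(xy) - k(yx), and xy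
  is yx multiplied on the left by x y x^-1 y^-1. If the images commute, this commutator lies in the
  kernel and the asymmetry is its value under \<open>\<chi>\<close>. Commuting pairs in
  \<open>Q\<close> and commutators in the kernel correspond to each other in this way.\<close>

lemma transgresses_commuting_symmetric_iff:
  assumes "transgresses E (kernel E Q p) p \<chi> \<phi>"
  shows "commuting_symmetric Q \<phi> \<longleftrightarrow> (\<forall>m\<in>commutators E \<inter> kernel E Q p. \<chi> m = 0)"
proof -
  obtain k where k: "\<And>x y. x \<in> carrier E \<Longrightarrow> y \<in> carrier E \<Longrightarrow> \<phi> (p x) (p y) = k (x \<otimes> y) - k x - k y"
    "\<And>m x. m \<in> kernel E Q p \<Longrightarrow> x \<in> carrier E \<Longrightarrow> k (m \<otimes> x) = \<chi> m + k x"
    using assms unfolding transgresses_def by (elim exE conjE) simp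
  have swap: "\<phi> (p x) (p y) - \<phi> (p y) (p x) = \<chi> (x \<otimes> y \<otimes> inv x \<otimes> inv y)"
    if "x \<in> carrier E" "y \<in> carrier E" "x \<otimes> y \<otimes> inv x \<otimes> inv y \<in> kernel E Q p" for x y
  proof -
    have "(x \<otimes> y \<otimes> inv x \<otimes> inv y) \<otimes> (y \<otimes> x) = x \<otimes> y \<otimes> (inv x \<otimes> (inv y \<otimes> y \<otimes> x))"
      using that by (simp only: G.m_assoc G.m_closed G.inv_closed)
    also have "\<dots> = x \<otimes> y" using that by (simp add: G.m_assoc)
    finally show ?thesis
      using k(1)[OF that(1,2)] k(1)[OF that(2,1)] k(2)[OF that(3), of "y \<otimes> x"] that(1,2) by simp
  qed
  show ?thesis
  proof
    assume sym: "commuting_symmetric Q \<phi>"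
    show "\<forall>m\<in>commutators E \<inter> kernel E Q p. \<chi> m = 0"
    proof
      fix m assume m: "m \<in> commutators E \<inter> kernel E Q p"
      then obtain x y where xy: "x \<in> carrier E" "y \<in> carrier E" "m = inv x \<otimes> inv y \<otimes> x \<otimes> y"
        unfolding commutators_def by blast
      have pm: "inv\<^bsub>Q\<^esub> p x \<otimes>\<^bsub>Q\<^esub> inv\<^bsub>Q\<^esub> p y \<otimes>\<^bsub>Q\<^esub> p x \<otimes>\<^bsub>Q\<^esub> p y = \<one>\<^bsub>Q\<^esub>"
        using m xy by (simp add: kernel_def)
      \<comment> \<open>The pair to consider is \<open>inv x\<close>, \<open>inv y\<close>: its
        commutator in the form used by \<open>swap\<close> is \<open>m\<close>, and its images
        commute because \<open>m\<close> lies in the kernel.\<close>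
      have "inv\<^bsub>Q\<^esub> p x \<otimes>\<^bsub>Q\<^esub> inv\<^bsub>Q\<^esub> p y
          = (inv\<^bsub>Q\<^esub> p x \<otimes>\<^bsub>Q\<^esub> inv\<^bsub>Q\<^esub> p y \<otimes>\<^bsub>Q\<^esub> p x \<otimes>\<^bsub>Q\<^esub> p y) \<otimes>\<^bsub>Q\<^esub> (inv\<^bsub>Q\<^esub> p y \<otimes>\<^bsub>Q\<^esub> inv\<^bsub>Q\<^esub> p x)"
      proof -
        have "p y \<otimes>\<^bsub>Q\<^esub> (inv\<^bsub>Q\<^esub> p y \<otimes>\<^bsub>Q\<^esub> z) = z" "p x \<otimes>\<^bsub>Q\<^esub> inv\<^bsub>Q\<^esub> p x = \<one>\<^bsub>Q\<^esub>" if "z \<in> carrier Q" for z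
          using xy that by (simp_all add: H.m_assoc[symmetric])
        then show ?thesis using xy by (simp add: H.m_assoc)
      qed
      then have "p (inv x) \<otimes>\<^bsub>Q\<^esub> p (inv y) = p (inv y) \<otimes>\<^bsub>Q\<^esub> p (inv x)"
        unfolding pm using xy by simp
      then have "\<phi> (p (inv x)) (p (inv y)) = \<phi> (p (inv y)) (p (inv x))"
        using xy by (intro commuting_symmetricD[OF sym]) simp_all
      then show "\<chi> m = 0"
        using swap[of "inv x" "inv y"] xy m by simp
    qed
  next
    assume *: "\<forall>m\<in>commutators E \<inter> kernel E Q p. \<chi> m = 0"
    show "commuting_symmetric Q \<phi>" unfolding commuting_symmetric_def
    proof (intro ballI impI)
      fix a b assume ab: "a \<in> carrier Q" "b \<in> carrier Q" "a \<otimes>\<^bsub>Q\<^esub> b = b \<otimes>\<^bsub>Q\<^esub> a"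
      then obtain x y where xy: "x \<in> carrier E" "y \<in> carrier E" "a = p x" "b = p y"
        using preimage by metis
      have "p (x \<otimes> y \<otimes> inv x \<otimes> inv y) = b \<otimes>\<^bsub>Q\<^esub> a \<otimes>\<^bsub>Q\<^esub> inv\<^bsub>Q\<^esub> a \<otimes>\<^bsub>Q\<^esub> inv\<^bsub>Q\<^esub> b"
        using xy ab(3) by simp
      also have "\<dots> = \<one>\<^bsub>Q\<^esub>" using ab by (simp add: H.m_assoc)
      finally have "x \<otimes> y \<otimes> inv x \<otimes> inv y \<in> kernel E Q p" using xy by (simp add: kernel_def)
      then show "\<phi> a b = \<phi> b a"
        using swap[OF xy(1,2)] * commutator_swap[OF xy(1,2)] xy by simp
    qed
  qed
qed

text \<open>If \<open>c\<close> bounds \<open>\<phi>\<close>, adding the pullback of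
  \<open>c\<close> to \<open>k\<close> cancels the failure of additivity. Conversely, an additive
  extension of \<open>\<chi>\<close> and \<open>k\<close> change alike under multiplication by the
  kernel, so their difference descends to a cochain on \<open>Q\<close>, and that cochain bounds
  \<open>\<phi>\<close>.\<close>

lemma transgresses_coboundary_iff:
  assumes "transgresses E (kernel E Q p) p \<chi> \<phi>"
  shows "is_coboundary Q \<phi> \<longleftrightarrow> (\<exists>\<psi>. additive_on E (carrier E) \<psi> \<and> (\<forall>m\<in>kernel E Q p. \<psi> m = \<chi> m))"
proof -
  obtain k where k: "\<And>x y. x \<in> carrier E \<Longrightarrow> y \<in> carrier E \<Longrightarrow> \<phi> (p x) (p y) = k (x \<otimes> y) - k x - k y"
    "\<And>m x. m \<in> kernel E Q p \<Longrightarrow> x \<in> carrier E \<Longrightarrow> k (m \<otimes> x) = \<chi> m + k x"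
    using assms unfolding transgresses_def by (elim exE conjE) simp
  show ?thesis
  proof
    assume "is_coboundary Q \<phi>"
    then obtain c where c: "\<And>a b. a \<in> carrier Q \<Longrightarrow> b \<in> carrier Q \<Longrightarrow> \<phi> a b = c a + c b - c (a \<otimes>\<^bsub>Q\<^esub> b)"
      unfolding is_coboundary_def by auto
    define \<psi> where "\<psi> = (\<lambda>x. k x + c (p x))"
    have \<psi>: "additive_on E (carrier E) \<psi>"
      unfolding additive_on_def \<psi>_def using k(1) c[of "p _" "p _"] by (simp add: algebra_simps)
    \<comment> \<open>This normalises the constant: \<open>k\<close> agrees with
      \<open>\<chi>\<close> on the kernel only up to \<open>k \<one>\<close>, and
      \<open>c \<circ> p\<close> contributes the constant \<open>c\<close> of the unit
      there.\<close>
    have "\<psi> \<one> = 0" by (rule additive_on_one[OF G.is_group G.subgroup_self \<psi>])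
    then have "\<psi> m = \<chi> m" if "m \<in> kernel E Q p" for m
      using k(2)[OF that G.one_closed] that unfolding \<psi>_def by (simp add: kernel_def add.assoc)
    with \<psi> show "\<exists>\<psi>. additive_on E (carrier E) \<psi> \<and> (\<forall>m\<in>kernel E Q p. \<psi> m = \<chi> m)" by blast
  next
    assume "\<exists>\<psi>. additive_on E (carrier E) \<psi> \<and> (\<forall>m\<in>kernel E Q p. \<psi> m = \<chi> m)"
    then obtain \<psi> where \<psi>: "additive_on E (carrier E) \<psi>" "\<And>m. m \<in> kernel E Q p \<Longrightarrow> \<psi> m = \<chi> m" by blast
    define d where "d = (\<lambda>x. \<psi> x - k x)"
    have d_eq: "d x = d y" if "x \<in> carrier E" "y \<in> carrier E" "p x = p y" for x y
    proof -
      have m: "x \<otimes> inv y \<in> kernel E Q p" using that by (simp add: kernel_def)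
      have "x = (x \<otimes> inv y) \<otimes> y" using that by (simp add: G.m_assoc)
      then show ?thesis
        using k(2)[OF m that(2)] additive_onD[OF \<psi>(1), of "x \<otimes> inv y" y] \<psi>(2)[OF m] that
        unfolding d_def by simp
    qed
    define c where "c = (\<lambda>a. d (SOME x. x \<in> carrier E \<and> p x = a))"
    have c: "c (p x) = d x" if "x \<in> carrier E" for x
      unfolding c_def using someI[of "\<lambda>y. y \<in> carrier E \<and> p y = p x" x] that by (intro d_eq) auto
    have "\<phi> a b = c a + c b - c (a \<otimes>\<^bsub>Q\<^esub> b)" if ab: "a \<in> carrier Q" "b \<in> carrier Q" for a b
    proof -
      obtain x y where xy: "x \<in> carrier E" "y \<in> carrier E" "a = p x" "b = p y"
        using preimage ab by metis
      then have "c (a \<otimes>\<^bsub>Q\<^esub> b) = d (x \<otimes> y)" using c[of "x \<otimes> y"] by simp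
      then show ?thesis using xy k(1) c additive_onD[OF \<psi>(1)] by (simp add: d_def)
    qed
    then show "is_coboundary Q \<phi>" unfolding is_coboundary_def by (intro exI[of _ c]) simp
  qed
qed

text \<open>The witness sends x to the value of \<open>\<chi>\<close> at x \<mu>(p x)^-1, the kernel
  part of x relative to the section. Its failure of additivity involves a conjugate of a kernel
  element, and \<open>\<chi>\<close> does not notice the conjugation because it vanishes on
  commutators in the kernel.\<close>

lemma transgresses_section:
  assumes \<chi>: "additive_on E (kernel E Q p) \<chi>" "\<And>m. m \<in> commutators E \<Longrightarrow> m \<in> kernel E Q p \<Longrightarrow> \<chi> m = 0"
    and \<mu>: "\<And>a. a \<in> carrier Q \<Longrightarrow> \<mu> a \<in> carrier E" "\<And>a. a \<in> carrier Q \<Longrightarrow> p (\<mu> a) = a"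
  shows "transgresses E (kernel E Q p) p \<chi> (\<lambda>a b. \<chi> (\<mu> a \<otimes> \<mu> b \<otimes> inv \<mu> (a \<otimes>\<^bsub>Q\<^esub> b)))"
proof -
  have inv_cancel: "x \<otimes> (inv x \<otimes> z) = z" "inv x \<otimes> (x \<otimes> z) = z" if "x \<in> carrier E" "z \<in> carrier E" for x z
    using that by (simp_all add: G.m_assoc[symmetric])
  have conj: "\<chi> (x \<otimes> m \<otimes> inv x) = \<chi> m" "x \<otimes> m \<otimes> inv x \<in> kernel E Q p"
    if x: "x \<in> carrier E" and m: "m \<in> kernel E Q p" for x m
  proof -
    have mc: "m \<in> carrier E" "p m = \<one>\<^bsub>Q\<^esub>" using m by (auto simp: kernel_def)
    have c: "x \<otimes> m \<otimes> inv x \<otimes> inv m \<in> commutators E" using x mc by (intro commutator_swap)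
    have K: "x \<otimes> m \<otimes> inv x \<otimes> inv m \<in> kernel E Q p" using x mc by (simp add: kernel_def)
    have "x \<otimes> m \<otimes> inv x = (x \<otimes> m \<otimes> inv x \<otimes> inv m) \<otimes> m" using x mc by (simp add: G.m_assoc)
    then show "\<chi> (x \<otimes> m \<otimes> inv x) = \<chi> m"
      using additive_onD[OF \<chi>(1) K m] \<chi>(2)[OF c K] by simp
    show "x \<otimes> m \<otimes> inv x \<in> kernel E Q p" using x mc by (simp add: kernel_def)
  qed
  define n where "n = (\<lambda>x. x \<otimes> inv \<mu> (p x))"
  have n: "n x \<in> kernel E Q p" if "x \<in> carrier E" for x
    using that \<mu>[of "p x"] by (simp add: n_def kernel_def)
  have "\<chi> (\<mu> (p x) \<otimes> \<mu> (p y) \<otimes> inv \<mu> (p x \<otimes>\<^bsub>Q\<^esub> p y)) = \<chi> (n (x \<otimes> y)) - \<chi> (n x) - \<chi> (n y)"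
    if xy: "x \<in> carrier E" "y \<in> carrier E" for x y
  proof -
    define u v w where "u = \<mu> (p x)" and "v = \<mu> (p y)" and "w = \<mu> (p x \<otimes>\<^bsub>Q\<^esub> p y)"
    have uvw: "u \<in> carrier E" "v \<in> carrier E" "w \<in> carrier E" "p u = p x" "p v = p y" "p w = p x \<otimes>\<^bsub>Q\<^esub> p y"
      using \<mu> xy by (simp_all add: u_def v_def w_def)
    \<comment> \<open>The kernel part of a product is the product of the two kernel parts, the
      second conjugated by \<open>u\<close>, and the section's own defect. Applying
      \<open>\<chi>\<close> turns this into the required sum.\<close>
    have "n (x \<otimes> y) = n x \<otimes> (u \<otimes> n y \<otimes> inv u) \<otimes> (u \<otimes> v \<otimes> inv w)"
      using xy uvw(1-3) inv_cancel unfolding n_def by (simp add: G.m_assoc flip: u_def v_def w_def)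
    moreover have "u \<otimes> v \<otimes> inv w \<in> kernel E Q p" using uvw xy by (simp add: kernel_def)
    moreover have "n x \<otimes> (u \<otimes> n y \<otimes> inv u) \<in> kernel E Q p"
      using subgroup.m_closed[OF subgroup_kernel n[OF xy(1)] conj(2)[OF uvw(1) n[OF xy(2)]]] .
    ultimately have "\<chi> (n (x \<otimes> y)) = \<chi> (n x) + \<chi> (n y) + \<chi> (u \<otimes> v \<otimes> inv w)"
      using additive_onD[OF \<chi>(1)] conj[OF uvw(1) n[OF xy(2)]] n[OF xy(1)] by simp
    then show ?thesis by (simp add: u_def v_def w_def)
  qed
  moreover have "\<chi> (n (m \<otimes> x)) = \<chi> m + \<chi> (n x)" if "m \<in> kernel E Q p" "x \<in> carrier E" for m x
  proof -
    have "n (m \<otimes> x) = m \<otimes> n x"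
      using that \<mu>(1)[of "p x"] by (simp add: n_def kernel_def G.m_assoc)
    then show ?thesis using additive_onD[OF \<chi>(1) that(1) n[OF that(2)]] by simp
  qed
  ultimately show ?thesis
    unfolding transgresses_def by (intro exI[of _ "\<lambda>x. \<chi> (n x)"]) simp
qed

lemma transgresses_exists:
  assumes "additive_on E (kernel E Q p) \<chi>" "\<And>m. m \<in> commutators E \<Longrightarrow> m \<in> kernel E Q p \<Longrightarrow> \<chi> m = 0"
  shows "\<exists>\<phi>. transgresses E (kernel E Q p) p \<chi> \<phi>"
proof -
  obtain \<mu> where "\<And>a. a \<in> carrier Q \<Longrightarrow> \<mu> a \<in> carrier E \<and> p (\<mu> a) = a"
    using preimage by metis
  then show ?thesis using transgresses_section[OF assms, of \<mu>] by blast
qed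

section \<open>Inflation along an epimorphism\<close>

text \<open>With \<open>c\<close> bounding the inflated cocycle, \<open>k\<close> is
  \<open>-c\<close>. For m in the kernel, c(m) + c(x) - c(m x) is the value of \<open>\<phi>\<close>
  with first argument 1, which is independent of x; at x = 1 it equals c(1). Hence the character is
  c(1) - c(m).\<close>

lemma inflation_coboundary_imp_transgresses:
  assumes \<phi>: "is_cocycle Q \<phi>" and "is_coboundary E (\<lambda>x y. \<phi> (p x) (p y))"
  shows "\<exists>\<chi>. transgresses E (kernel E Q p) p \<chi> \<phi>"
proof -
  obtain c where c: "\<And>x y. x \<in> carrier E \<Longrightarrow> y \<in> carrier E \<Longrightarrow> \<phi> (p x) (p y) = c x + c y - c (x \<otimes> y)"
    using assms(2) unfolding is_coboundary_def by auto
  have "- c (m \<otimes> x) = (c \<one> - c m) + - c x" if "m \<in> kernel E Q p" "x \<in> carrier E" for m x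
  proof -
    have m: "m \<in> carrier E" "p m = \<one>\<^bsub>Q\<^esub>" using that(1) by (auto simp: kernel_def)
    have "\<phi> (p m) (p x) = \<phi> (p m) (p \<one>)"
      using cocycle_one(1)[OF H.is_group \<phi>, of "p x"] m that(2) by simp
    then have "c m + c x - c (m \<otimes> x) = c m + c \<one> - c (m \<otimes> \<one>)"
      unfolding c[OF m(1) that(2)] c[OF m(1) G.one_closed] .
    then have *: "c \<one> = c m + c x - c (m \<otimes> x)" using m(1) by simp
    show ?thesis unfolding * by simp
  qed
  then show ?thesis
    unfolding transgresses_def using c
    by (intro exI[of _ "\<lambda>m. c \<one> - c m"] exI[of _ "\<lambda>x. - c x"]) simp
qed

lemma transgresses_imp_inflation_coboundary:
  assumes "transgresses E M p \<chi> \<phi>"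
  shows "is_coboundary E (\<lambda>x y. \<phi> (p x) (p y))"
proof -
  obtain k where k: "\<And>x y. x \<in> carrier E \<Longrightarrow> y \<in> carrier E \<Longrightarrow> \<phi> (p x) (p y) = k (x \<otimes> y) - k x - k y"
    "\<And>m x. m \<in> M \<Longrightarrow> x \<in> carrier E \<Longrightarrow> k (m \<otimes> x) = \<chi> m + k x"
    using assms unfolding transgresses_def by (elim exE conjE) simp
  then show ?thesis unfolding is_coboundary_def by (intro exI[of _ "\<lambda>x. - k x"]) (simp add: k(1))
qed

lemma is_cocycle_inflate: "is_cocycle Q \<phi> \<Longrightarrow> is_cocycle E (\<lambda>x y. \<phi> (p x) (p y))"
  by (simp add: is_cocycle_def)

lemma commuting_symmetric_inflate:
  assumes "commuting_symmetric Q \<phi>"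
  shows "commuting_symmetric E (\<lambda>x y. \<phi> (p x) (p y))"
  unfolding commuting_symmetric_def
proof (intro ballI impI)
  fix x y assume "x \<in> carrier E" "y \<in> carrier E" "x \<otimes> y = y \<otimes> x"
  then show "\<phi> (p x) (p y) = \<phi> (p y) (p x)"
    using commuting_symmetricD[OF assms, of "p x" "p y"] by (metis hom_closed hom_mult)
qed

end

subsection \<open>Cohomology classes of typed cocycles\<close>

text \<open>The bridge between typed cochains, on which the arguments above run, and the extensional
  functions that make up \<open>cocycles2\<close>; every extensional function with values in
  \<open>carrier QmodZ\<close> arises this way.\<close>

definition cochain_of :: "('a, 'm) monoid_scheme \<Rightarrow> ('a \<Rightarrow> 'a \<Rightarrow> rat_mod_int) \<Rightarrow> 'a \<times> 'a \<Rightarrow> rat set" where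
  "cochain_of G \<phi> = (\<lambda>(x, y)\<in>carrier G \<times> carrier G. Rep_rat_mod_int (\<phi> x y))"

definition H2_class :: "('a, 'm) monoid_scheme \<Rightarrow> ('a \<Rightarrow> 'a \<Rightarrow> rat_mod_int) \<Rightarrow> ('a \<times> 'a \<Rightarrow> rat set) set" where
  "H2_class G \<phi> = cohomology_class G QmodZ (cochain_of G \<phi>)"

lemmas Rep_arith = zero_rat_mod_int.rep_eq plus_rat_mod_int.rep_eq uminus_rat_mod_int.rep_eq

lemma cochain_of_apply [simp]:
  "x \<in> carrier G \<Longrightarrow> y \<in> carrier G \<Longrightarrow> cochain_of G \<phi> (x, y) = Rep_rat_mod_int (\<phi> x y)"
  by (simp add: cochain_of_def)

lemma cochain_of_eq_iff:
  "cochain_of G \<phi> = cochain_of G \<psi> \<longleftrightarrow> (\<forall>x\<in>carrier G. \<forall>y\<in>carrier G. \<phi> x y = \<psi> x y)"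
proof
  assume eq: "cochain_of G \<phi> = cochain_of G \<psi>"
  have "Rep_rat_mod_int (\<phi> x y) = Rep_rat_mod_int (\<psi> x y)" if "x \<in> carrier G" "y \<in> carrier G" for x y
    using fun_cong[OF eq, of "(x, y)"] that by simp
  then show "\<forall>x\<in>carrier G. \<forall>y\<in>carrier G. \<phi> x y = \<psi> x y" by (simp add: Rep_rat_mod_int_inject)
next
  assume "\<forall>x\<in>carrier G. \<forall>y\<in>carrier G. \<phi> x y = \<psi> x y"
  then show "cochain_of G \<phi> = cochain_of G \<psi>" by (auto simp: cochain_of_def fun_eq_iff restrict_def)
qed

lemma cochain_of_surj:
  assumes "f \<in> carrier G \<times> carrier G \<rightarrow>\<^sub>E carrier QmodZ"
  shows "f = cochain_of G (\<lambda>x y. Abs_rat_mod_int (f (x, y)))"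
proof
  fix z show "f z = cochain_of G (\<lambda>x y. Abs_rat_mod_int (f (x, y))) z"
  proof (cases "z \<in> carrier G \<times> carrier G")
    case True
    then have "f z \<in> carrier QmodZ" using assms by (rule PiE_mem[rotated])
    then show ?thesis using True by (auto simp: Abs_rat_mod_int_inverse)
  next
    case False
    then show ?thesis using PiE_arb[OF assms] by (simp add: cochain_of_def)
  qed
qed

lemma cocycles2_QmodZ:
  assumes "group G"
  shows "cocycles2 G QmodZ = cochain_of G ` {\<phi>. is_cocycle G \<phi>}"
proof -
  interpret group G by fact
  have *: "cochain_of G \<phi> \<in> cocycles2 G QmodZ \<longleftrightarrow> is_cocycle G \<phi>" for \<phi>
  proof -
    have "cochain_of G \<phi> \<in> carrier G \<times> carrier G \<rightarrow>\<^sub>E carrier QmodZ"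
      using Rep_rat_mod_int by (auto simp: cochain_of_def)
    then show ?thesis
      by (simp add: cocycles2_def is_cocycle_def Rep_rat_mod_int_inject flip: Rep_arith)
  qed
  show ?thesis
  proof
    show "cocycles2 G QmodZ \<subseteq> cochain_of G ` {\<phi>. is_cocycle G \<phi>}"
    proof
      fix f assume f: "f \<in> cocycles2 G QmodZ"
      then have "f = cochain_of G (\<lambda>x y. Abs_rat_mod_int (f (x, y)))"
        by (intro cochain_of_surj) (simp add: cocycles2_def)
      then show "f \<in> cochain_of G ` {\<phi>. is_cocycle G \<phi>}"
        using * f by (metis (mono_tags, lifting) image_eqI mem_Collect_eq)
    qed
    show "cochain_of G ` {\<phi>. is_cocycle G \<phi>} \<subseteq> cocycles2 G QmodZ" using * by auto
  qed
qed

lemma coboundaries2_QmodZ: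
  assumes "group G"
  shows "coboundaries2 G QmodZ = cochain_of G ` {\<phi>. is_coboundary G \<phi>}"
proof -
  interpret group G by fact
  have eq: "(\<lambda>(x, y)\<in>carrier G \<times> carrier G. c x \<otimes>\<^bsub>QmodZ\<^esub> c y \<otimes>\<^bsub>QmodZ\<^esub> inv\<^bsub>QmodZ\<^esub> c (x \<otimes>\<^bsub>G\<^esub> y))
      = cochain_of G (\<lambda>x y. d x + d y - d (x \<otimes>\<^bsub>G\<^esub> y))"
    if "\<And>x. x \<in> carrier G \<Longrightarrow> c x = Rep_rat_mod_int (d x)" for c d
    using that by (auto simp: cochain_of_def fun_eq_iff restrict_def Rep_arith diff_conv_add_uminus
        simp del: add_uminus_conv_diff)
  show ?thesis
  proof
    show "coboundaries2 G QmodZ \<subseteq> cochain_of G ` {\<phi>. is_coboundary G \<phi>}"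
    proof
      fix f assume "f \<in> coboundaries2 G QmodZ"
      then obtain c where c: "c \<in> carrier G \<rightarrow> carrier QmodZ"
        "f = (\<lambda>(x, y)\<in>carrier G \<times> carrier G. c x \<otimes>\<^bsub>QmodZ\<^esub> c y \<otimes>\<^bsub>QmodZ\<^esub> inv\<^bsub>QmodZ\<^esub> c (x \<otimes>\<^bsub>G\<^esub> y))"
        unfolding coboundaries2_def by blast
      have "c x = Rep_rat_mod_int (Abs_rat_mod_int (c x))" if "x \<in> carrier G" for x
        using c(1) that by (simp add: Abs_rat_mod_int_inverse Pi_iff)
      from eq[OF this] c(2) have "f = cochain_of G (\<lambda>x y. Abs_rat_mod_int (c x) + Abs_rat_mod_int (c y)
          - Abs_rat_mod_int (c (x \<otimes>\<^bsub>G\<^esub> y)))" by simp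
      moreover have "is_coboundary G (\<lambda>x y. Abs_rat_mod_int (c x) + Abs_rat_mod_int (c y)
          - Abs_rat_mod_int (c (x \<otimes>\<^bsub>G\<^esub> y)))"
        unfolding is_coboundary_def by (rule exI[of _ "\<lambda>x. Abs_rat_mod_int (c x)"]) simp
      ultimately show "f \<in> cochain_of G ` {\<phi>. is_coboundary G \<phi>}" by simp
    qed
    show "cochain_of G ` {\<phi>. is_coboundary G \<phi>} \<subseteq> coboundaries2 G QmodZ"
    proof clarify
      fix \<phi> :: "'a \<Rightarrow> 'a \<Rightarrow> rat_mod_int" assume "is_coboundary G \<phi>"
      then obtain d where "\<forall>x\<in>carrier G. \<forall>y\<in>carrier G. \<phi> x y = d x + d y - d (x \<otimes>\<^bsub>G\<^esub> y)"
        unfolding is_coboundary_def by blast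
      then have "cochain_of G \<phi> = cochain_of G (\<lambda>x y. d x + d y - d (x \<otimes>\<^bsub>G\<^esub> y))"
        by (simp add: cochain_of_eq_iff)
      moreover have "(\<lambda>x. Rep_rat_mod_int (d x)) \<in> carrier G \<rightarrow> carrier QmodZ"
        using Rep_rat_mod_int by auto
      ultimately show "cochain_of G \<phi> \<in> coboundaries2 G QmodZ"
        unfolding coboundaries2_def
        by (intro CollectI exI[of _ "\<lambda>x. Rep_rat_mod_int (d x)"] conjI)
          (simp_all only: eq[of "\<lambda>x. Rep_rat_mod_int (d x)" d])
    qed
  qed
qed

section \<open>Groups of cocycles and coboundaries, and their quotient\<close>

lemma is_cocycleD:
  assumes "is_cocycle G \<phi>" "x \<in> carrier G" "y \<in> carrier G" "z \<in> carrier G"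
  shows "\<phi> y z + \<phi> x (y \<otimes>\<^bsub>G\<^esub> z) = \<phi> (x \<otimes>\<^bsub>G\<^esub> y) z + \<phi> x y"
  using assms by (simp add: is_cocycle_def)

lemma is_cocycle_zero: "is_cocycle G (\<lambda>x y. 0)"
  by (simp add: is_cocycle_def)

lemma is_cocycle_add:
  assumes "is_cocycle G \<phi>" "is_cocycle G \<psi>"
  shows "is_cocycle G (\<lambda>x y. \<phi> x y + \<psi> x y)"
  unfolding is_cocycle_def
proof (intro ballI)
  fix x y z assume xyz: "x \<in> carrier G" "y \<in> carrier G" "z \<in> carrier G"
  show "\<phi> y z + \<psi> y z + (\<phi> x (y \<otimes>\<^bsub>G\<^esub> z) + \<psi> x (y \<otimes>\<^bsub>G\<^esub> z))
      = \<phi> (x \<otimes>\<^bsub>G\<^esub> y) z + \<psi> (x \<otimes>\<^bsub>G\<^esub> y) z + (\<phi> x y + \<psi> x y)"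
    using arg_cong2[OF is_cocycleD[OF assms(1) xyz] is_cocycleD[OF assms(2) xyz], of "(+)"]
    by (simp only: ac_simps)
qed

lemma is_cocycle_minus:
  assumes "is_cocycle G \<phi>"
  shows "is_cocycle G (\<lambda>x y. - \<phi> x y)"
  unfolding is_cocycle_def
proof (intro ballI)
  fix x y z assume xyz: "x \<in> carrier G" "y \<in> carrier G" "z \<in> carrier G"
  show "- \<phi> y z + - \<phi> x (y \<otimes>\<^bsub>G\<^esub> z) = - \<phi> (x \<otimes>\<^bsub>G\<^esub> y) z + - \<phi> x y"
    using arg_cong[OF is_cocycleD[OF assms xyz], of uminus] by (simp only: minus_add_distrib)
qed

lemma is_coboundary_zero: "is_coboundary G (\<lambda>x y. 0)"
  unfolding is_coboundary_def by (intro exI[of _ "\<lambda>x. 0"]) simp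

lemma is_coboundary_add:
  assumes "is_coboundary G \<phi>" "is_coboundary G \<psi>"
  shows "is_coboundary G (\<lambda>x y. \<phi> x y + \<psi> x y)"
proof -
  obtain c where "\<forall>x\<in>carrier G. \<forall>y\<in>carrier G. \<phi> x y = c x + c y - c (x \<otimes>\<^bsub>G\<^esub> y)"
    using assms(1) unfolding is_coboundary_def by (rule exE)
  note c = this[THEN bspec, THEN bspec]
  obtain d where "\<forall>x\<in>carrier G. \<forall>y\<in>carrier G. \<psi> x y = d x + d y - d (x \<otimes>\<^bsub>G\<^esub> y)"
    using assms(2) unfolding is_coboundary_def by (rule exE)
  note d = this[THEN bspec, THEN bspec]
  show ?thesis
    unfolding is_coboundary_def
    by (intro exI[of _ "\<lambda>x. c x + d x"] ballI; simp only: c d) (simp add: algebra_simps)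
qed

lemma is_coboundary_minus:
  assumes "is_coboundary G \<phi>"
  shows "is_coboundary G (\<lambda>x y. - \<phi> x y)"
proof -
  obtain c where "\<forall>x\<in>carrier G. \<forall>y\<in>carrier G. \<phi> x y = c x + c y - c (x \<otimes>\<^bsub>G\<^esub> y)"
    using assms unfolding is_coboundary_def by (rule exE)
  note c = this[THEN bspec, THEN bspec]
  show ?thesis
    unfolding is_coboundary_def by (intro exI[of _ "\<lambda>x. - c x"] ballI; simp only: c) simp
qed

lemma is_coboundary_imp_is_cocycle:
  assumes "group G" "is_coboundary G \<phi>"
  shows "is_cocycle G \<phi>"
proof -
  interpret group G by fact
  obtain c where "\<forall>x\<in>carrier G. \<forall>y\<in>carrier G. \<phi> x y = c x + c y - c (x \<otimes>\<^bsub>G\<^esub> y)"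
    using assms(2) unfolding is_coboundary_def by (rule exE)
  note c = this[THEN bspec, THEN bspec]
  show ?thesis
    unfolding is_cocycle_def by (intro ballI; simp add: c m_assoc)
qed

lemma cocycle_group_simps:
  assumes "group G"
  shows "carrier (cocycle_group G QmodZ) = cochain_of G ` {\<phi>. is_cocycle G \<phi>}"
    and "cochain_of G \<phi> \<otimes>\<^bsub>cocycle_group G QmodZ\<^esub> cochain_of G \<psi> = cochain_of G (\<lambda>x y. \<phi> x y + \<psi> x y)"
    and "\<one>\<^bsub>cocycle_group G QmodZ\<^esub> = cochain_of G (\<lambda>x y. 0)"
  using cocycles2_QmodZ[OF assms]
  by (auto simp: cocycle_group_def cochain_of_def fun_eq_iff restrict_def Rep_arith product_group_def)

lemma comm_group_cocycle_group:
  assumes "group G"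
  shows "comm_group (cocycle_group G QmodZ)"
proof (rule comm_groupI)
  note s = cocycle_group_simps[OF assms]
  fix f g h
  assume "f \<in> carrier (cocycle_group G QmodZ)" "g \<in> carrier (cocycle_group G QmodZ)"
    "h \<in> carrier (cocycle_group G QmodZ)"
  then obtain \<phi> \<psi> \<chi> where "f = cochain_of G \<phi>" "g = cochain_of G \<psi>" "h = cochain_of G \<chi>"
    unfolding s by blast
  then show "f \<otimes>\<^bsub>cocycle_group G QmodZ\<^esub> g \<otimes>\<^bsub>cocycle_group G QmodZ\<^esub> h
      = f \<otimes>\<^bsub>cocycle_group G QmodZ\<^esub> (g \<otimes>\<^bsub>cocycle_group G QmodZ\<^esub> h)"
    by (simp add: s add.assoc)
next
  note s = cocycle_group_simps[OF assms]
  fix f g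
  assume "f \<in> carrier (cocycle_group G QmodZ)" "g \<in> carrier (cocycle_group G QmodZ)"
  then obtain \<phi> \<psi> where *: "f = cochain_of G \<phi>" "g = cochain_of G \<psi>" "is_cocycle G \<phi>" "is_cocycle G \<psi>"
    unfolding s by blast
  show "f \<otimes>\<^bsub>cocycle_group G QmodZ\<^esub> g = g \<otimes>\<^bsub>cocycle_group G QmodZ\<^esub> f"
    using * by (simp add: s add.commute)
  show "f \<otimes>\<^bsub>cocycle_group G QmodZ\<^esub> g \<in> carrier (cocycle_group G QmodZ)"
    using * by (simp add: s is_cocycle_add)
  show "\<one>\<^bsub>cocycle_group G QmodZ\<^esub> \<otimes>\<^bsub>cocycle_group G QmodZ\<^esub> f = f"
    using * by (simp add: s)
  show "\<exists>h\<in>carrier (cocycle_group G QmodZ). h \<otimes>\<^bsub>cocycle_group G QmodZ\<^esub> f = \<one>\<^bsub>cocycle_group G QmodZ\<^esub>"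
    using * is_cocycle_minus[of G \<phi>] by (auto simp: s)
next
  show "\<one>\<^bsub>cocycle_group G QmodZ\<^esub> \<in> carrier (cocycle_group G QmodZ)"
    using is_cocycle_zero by (auto simp: cocycle_group_simps[OF assms])
qed

lemma inv_cocycle_group:
  assumes "group G" "is_cocycle G \<phi>"
  shows "inv\<^bsub>cocycle_group G QmodZ\<^esub> cochain_of G \<phi> = cochain_of G (\<lambda>x y. - \<phi> x y)"
  using assms is_cocycle_minus[OF assms(2)]
  by (intro group.inv_equality[OF comm_group.axioms(2)[OF comm_group_cocycle_group[OF assms(1)]]])
    (auto simp: cocycle_group_simps)

lemma subgroup_coboundaries2:
  assumes "group G"
  shows "subgroup (coboundaries2 G QmodZ) (cocycle_group G QmodZ)"
proof (rule group.subgroupI)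
  note s = cocycle_group_simps[OF assms] and b = coboundaries2_QmodZ[OF assms]
  show "group (cocycle_group G QmodZ)" using comm_group_cocycle_group[OF assms] by (rule comm_group.axioms)
  show "coboundaries2 G QmodZ \<subseteq> carrier (cocycle_group G QmodZ)"
    using is_coboundary_imp_is_cocycle[OF assms] by (auto simp: s b)
  show "coboundaries2 G QmodZ \<noteq> {}" using is_coboundary_zero by (auto simp: b)
  fix f assume "f \<in> coboundaries2 G QmodZ"
  then obtain \<phi> where \<phi>: "f = cochain_of G \<phi>" "is_coboundary G \<phi>" by (auto simp: b)
  then show "inv\<^bsub>cocycle_group G QmodZ\<^esub> f \<in> coboundaries2 G QmodZ"
    using is_coboundary_minus[OF \<phi>(2)]
    by (simp add: inv_cocycle_group[OF assms is_coboundary_imp_is_cocycle[OF assms]] b)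
  fix g assume "g \<in> coboundaries2 G QmodZ"
  then obtain \<psi> where "g = cochain_of G \<psi>" "is_coboundary G \<psi>" by (auto simp: b)
  then show "f \<otimes>\<^bsub>cocycle_group G QmodZ\<^esub> g \<in> coboundaries2 G QmodZ"
    using \<phi> is_coboundary_add by (auto simp: s b)
qed

lemma normal_coboundaries2:
  "group G \<Longrightarrow> coboundaries2 G QmodZ \<lhd> cocycle_group G QmodZ"
  by (rule comm_group.subgroup_imp_normal[OF comm_group_cocycle_group subgroup_coboundaries2])

lemma H2_class_eq_iff:
  assumes "group G" "is_cocycle G \<phi>" "is_cocycle G \<psi>"
  shows "H2_class G \<phi> = H2_class G \<psi> \<longleftrightarrow> is_coboundary G (\<lambda>x y. \<phi> x y - \<psi> x y)"
proof -
  let ?Z = "cocycle_group G QmodZ" and ?B = "coboundaries2 G QmodZ"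
  interpret Z: comm_group ?Z by (rule comm_group_cocycle_group[OF assms(1)])
  note s = cocycle_group_simps[OF assms(1)]
  have sub: "subgroup ?B ?Z" by (rule subgroup_coboundaries2[OF assms(1)])
  have c: "cochain_of G \<phi> \<in> carrier ?Z" "cochain_of G \<psi> \<in> carrier ?Z" using assms by (auto simp: s)
  have "H2_class G \<phi> = H2_class G \<psi> \<longleftrightarrow> cochain_of G \<phi> \<in> ?B #>\<^bsub>?Z\<^esub> cochain_of G \<psi>"
    unfolding H2_class_def cohomology_class_def
    using Z.repr_independence[OF _ c(2) sub] Z.rcos_self[OF c(1) sub] by metis
  also have "\<dots> \<longleftrightarrow> cochain_of G \<phi> \<otimes>\<^bsub>?Z\<^esub> inv\<^bsub>?Z\<^esub> cochain_of G \<psi> \<in> ?B"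
  proof
    assume "cochain_of G \<phi> \<in> ?B #>\<^bsub>?Z\<^esub> cochain_of G \<psi>"
    then obtain b where b: "b \<in> ?B" "cochain_of G \<phi> = b \<otimes>\<^bsub>?Z\<^esub> cochain_of G \<psi>"
      unfolding r_coset_def by blast
    then have "b \<in> carrier ?Z" using sub subgroup.mem_carrier by metis
    then show "cochain_of G \<phi> \<otimes>\<^bsub>?Z\<^esub> inv\<^bsub>?Z\<^esub> cochain_of G \<psi> \<in> ?B"
      using b c by (simp add: Z.m_assoc)
  next
    assume "cochain_of G \<phi> \<otimes>\<^bsub>?Z\<^esub> inv\<^bsub>?Z\<^esub> cochain_of G \<psi> \<in> ?B"
    moreover have "cochain_of G \<phi> = cochain_of G \<phi> \<otimes>\<^bsub>?Z\<^esub> inv\<^bsub>?Z\<^esub> cochain_of G \<psi> \<otimes>\<^bsub>?Z\<^esub> cochain_of G \<psi>"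
      using c by (simp add: Z.m_assoc)
    ultimately show "cochain_of G \<phi> \<in> ?B #>\<^bsub>?Z\<^esub> cochain_of G \<psi>"
      unfolding r_coset_def by blast
  qed
  also have "\<dots> \<longleftrightarrow> cochain_of G (\<lambda>x y. \<phi> x y - \<psi> x y) \<in> ?B"
    by (simp add: inv_cocycle_group[OF assms(1,3)] s)
  also have "\<dots> \<longleftrightarrow> is_coboundary G (\<lambda>x y. \<phi> x y - \<psi> x y)"
    unfolding coboundaries2_QmodZ[OF assms(1)] image_iff cochain_of_eq_iff is_coboundary_def by auto
  finally show ?thesis .
qed

lemma H2_simps:
  assumes "group G"
  shows "carrier (H2 G QmodZ) = H2_class G ` {\<phi>. is_cocycle G \<phi>}"
    and "is_cocycle G \<phi> \<Longrightarrow> is_cocycle G \<psi> \<Longrightarrow>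
      H2_class G \<phi> \<otimes>\<^bsub>H2 G QmodZ\<^esub> H2_class G \<psi> = H2_class G (\<lambda>x y. \<phi> x y + \<psi> x y)"
    and "\<one>\<^bsub>H2 G QmodZ\<^esub> = H2_class G (\<lambda>x y. 0)"
proof -
  let ?Z = "cocycle_group G QmodZ" and ?B = "coboundaries2 G QmodZ"
  interpret Z: comm_group ?Z by (rule comm_group_cocycle_group[OF assms(1)])
  note s = cocycle_group_simps[OF assms(1)]
  have sub: "subgroup ?B ?Z" by (rule subgroup_coboundaries2[OF assms(1)])
  show "carrier (H2 G QmodZ) = H2_class G ` {\<phi>. is_cocycle G \<phi>}"
    unfolding H2_def carrier_FactGroup s H2_class_def[abs_def] cohomology_class_def image_image ..
  show "H2_class G \<phi> \<otimes>\<^bsub>H2 G QmodZ\<^esub> H2_class G \<psi> = H2_class G (\<lambda>x y. \<phi> x y + \<psi> x y)"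
    if "is_cocycle G \<phi>" "is_cocycle G \<psi>"
    unfolding H2_def H2_class_def cohomology_class_def
    using normal.rcos_sum[OF normal_coboundaries2[OF assms], of "cochain_of G \<phi>" "cochain_of G \<psi>"] that
    by (simp add: s)
  show "\<one>\<^bsub>H2 G QmodZ\<^esub> = H2_class G (\<lambda>x y. 0)"
    unfolding H2_def H2_class_def cohomology_class_def using Z.coset_mult_one[OF subgroup.subset[OF sub]]
    by (simp add: s)
qed

section \<open>Pullback of classes along homomorphisms\<close>

text \<open>Representatives of a class differ by coboundaries, and these pull back to coboundaries.
  So all members of the union defining the pullback are the same coset, and the union is not
  empty.\<close>

lemma H2_pullback_H2_class:
  assumes "group H" "group G" "h \<in> hom H G" "is_cocycle G \<phi>"
  shows "H2_pullback H G QmodZ h (H2_class G \<phi>) = H2_class H (\<lambda>x y. \<phi> (h x) (h y))"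
proof -
  note s = cocycle_group_simps[OF assms(2)] and b = coboundaries2_QmodZ[OF assms(2)]
  interpret h: group_hom H G h using assms(1-3) by (simp add: group_hom_def group_hom_axioms_def)
  have members: "H2_class G \<phi> = {cochain_of G (\<lambda>x y. \<beta> x y + \<phi> x y) |\<beta>. is_coboundary G \<beta>}"
    unfolding H2_class_def cohomology_class_def r_coset_def b by (auto simp: s)
  have cocycle_pull: "is_cocycle H (\<lambda>x y. \<psi> (h x) (h y))" if "is_cocycle G \<psi>" for \<psi> :: "_ \<Rightarrow> _ \<Rightarrow> rat_mod_int"
    using that by (simp add: is_cocycle_def)
  have same: "cohomology_class H QmodZ (\<lambda>(x, y)\<in>carrier H \<times> carrier H. f (h x, h y)) = H2_class H (\<lambda>x y. \<phi> (h x) (h y))"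
    if f: "f \<in> H2_class G \<phi>" for f
  proof -
    obtain \<beta> where \<beta>: "is_coboundary G \<beta>" "f = cochain_of G (\<lambda>x y. \<beta> x y + \<phi> x y)"
      using f members by blast
    have "(\<lambda>(x, y)\<in>carrier H \<times> carrier H. f (h x, h y)) = cochain_of H (\<lambda>x y. \<beta> (h x) (h y) + \<phi> (h x) (h y))"
      by (auto simp: \<beta>(2) cochain_of_def fun_eq_iff restrict_def)
    moreover have "is_coboundary H (\<lambda>x y. \<beta> (h x) (h y))"
    proof -
      obtain c where "\<forall>x\<in>carrier G. \<forall>y\<in>carrier G. \<beta> x y = c x + c y - c (x \<otimes>\<^bsub>G\<^esub> y)"
        using \<beta>(1) unfolding is_coboundary_def by (rule exE)
      then show ?thesis unfolding is_coboundary_def by (intro exI[of _ "\<lambda>x. c (h x)"]) simp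
    qed
    ultimately show ?thesis
      using H2_class_eq_iff[OF assms(1), of "\<lambda>x y. \<beta> (h x) (h y) + \<phi> (h x) (h y)" "\<lambda>x y. \<phi> (h x) (h y)"]
        is_cocycle_add[OF is_coboundary_imp_is_cocycle[OF assms(2) \<beta>(1)] assms(4)] cocycle_pull assms(4)
        cocycle_pull[of "\<lambda>x y. \<beta> x y + \<phi> x y"]
      by (simp add: H2_class_def)
  qed
  have "H2_class G \<phi> \<noteq> {}" unfolding members using is_coboundary_zero by auto
  then show ?thesis unfolding H2_pullback_def using same by auto
qed

subsection \<open>The Bogomolov multiplier as commuting-symmetric classes\<close>

lemma (in group) subgroup_centralizer:
  assumes "T \<subseteq> carrier G"
  shows "subgroup {g \<in> carrier G. \<forall>t\<in>T. g \<otimes> t = t \<otimes> g} G"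
proof (rule subgroupI)
  fix g assume g: "g \<in> {g \<in> carrier G. \<forall>t\<in>T. g \<otimes> t = t \<otimes> g}"
  have "inv g \<otimes> t = t \<otimes> inv g" if t: "t \<in> T" for t
  proof -
    have c: "g \<in> carrier G" "t \<in> carrier G" "g \<otimes> t = t \<otimes> g" using g t assms by auto
    have "inv g \<otimes> t = inv g \<otimes> (t \<otimes> g) \<otimes> inv g" using c(1,2) by (simp add: m_assoc)
    also have "\<dots> = t \<otimes> inv g" unfolding c(3)[symmetric] using c(1,2) by (simp add: m_assoc[symmetric])
    finally show ?thesis .
  qed
  then show "inv g \<in> {g \<in> carrier G. \<forall>t\<in>T. g \<otimes> t = t \<otimes> g}" using g by simp
  fix h assume h: "h \<in> {g \<in> carrier G. \<forall>t\<in>T. g \<otimes> t = t \<otimes> g}"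
  have "g \<otimes> h \<otimes> t = t \<otimes> (g \<otimes> h)" if t: "t \<in> T" for t
  proof -
    have c: "g \<in> carrier G" "h \<in> carrier G" "t \<in> carrier G" "g \<otimes> t = t \<otimes> g" "h \<otimes> t = t \<otimes> h"
      using g h t assms by auto
    have "g \<otimes> h \<otimes> t = g \<otimes> (h \<otimes> t)" using c(1-3) by (simp add: m_assoc)
    also have "\<dots> = (g \<otimes> t) \<otimes> h" unfolding c(5) using c(1-3) by (simp add: m_assoc)
    finally have "g \<otimes> h \<otimes> t = (g \<otimes> t) \<otimes> h" .
    then show ?thesis unfolding c(4) using c(1-3) by (simp add: m_assoc)
  qed
  then show "g \<otimes> h \<in> {g \<in> carrier G. \<forall>t\<in>T. g \<otimes> t = t \<otimes> g}" using g h by simp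
qed (use assms in \<open>auto intro!: exI[of _ \<one>]\<close>)

text \<open>The centraliser argument is applied twice: first the generated subgroup centralises
  \<open>T\<close>, then it centralises itself.\<close>

lemma (in group) generate_commuting:
  assumes "T \<subseteq> carrier G" "\<And>x y. x \<in> T \<Longrightarrow> y \<in> T \<Longrightarrow> x \<otimes> y = y \<otimes> x"
    and "g \<in> generate G T" "h \<in> generate G T"
  shows "g \<otimes> h = h \<otimes> g"
proof -
  have "generate G T \<subseteq> {g \<in> carrier G. \<forall>t\<in>T. g \<otimes> t = t \<otimes> g}"
    using assms(1,2) by (intro generate_subgroup_incl[OF _ subgroup_centralizer]) auto
  \<comment> \<open>By the preceding inclusion \<open>T\<close> lies in the centraliser of
    \<open>generate G T\<close>, which is a subgroup and therefore contains
    \<open>generate G T\<close>.\<close>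
  then have "generate G T \<subseteq> {g \<in> carrier G. \<forall>t\<in>generate G T. g \<otimes> t = t \<otimes> g}"
    using assms(1) by (intro generate_subgroup_incl[OF _ subgroup_centralizer[OF generate_incl[OF assms(1)]]]) fastforce
  then show ?thesis using assms(3,4) by blast
qed

lemma res_H2_class:
  assumes "group G" "subgroup A G" "is_cocycle G \<phi>"
  shows "res G A (H2_class G \<phi>) = H2_class (restricted_group G A) \<phi>"
proof -
  have "(\<lambda>x. x) \<in> hom (restricted_group G A) G"
    using subgroup.mem_carrier[OF assms(2)] by (auto simp: hom_def)
  then show ?thesis
    unfolding res_def
    by (intro H2_pullback_H2_class[OF subgroup.subgroup_is_group[OF assms(2,1)] assms(1) _ assms(3)])
qed

lemma is_cocycle_restricted:
  "subgroup A G \<Longrightarrow> is_cocycle G \<phi> \<Longrightarrow> is_cocycle (restricted_group G A) \<phi>"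
  by (auto simp: is_cocycle_def subgroup.mem_carrier)

lemma H2_class_eq_one_iff:
  assumes "group G" "is_cocycle G \<phi>"
  shows "H2_class G \<phi> = \<one>\<^bsub>H2 G QmodZ\<^esub> \<longleftrightarrow> is_coboundary G \<phi>"
  using H2_class_eq_iff[OF assms is_cocycle_zero] by (simp add: H2_simps(3)[OF assms(1)])

text \<open>A commuting pair generates an abelian subgroup, and a cocycle bounding there is
  symmetric at the pair. Conversely, symmetry on commuting pairs makes the restriction to each
  abelian subgroup a symmetric cocycle, which bounds by divisibility.\<close>

lemma carrier_B0:
  assumes "group G"
  shows "carrier (B0 G) = H2_class G ` {\<phi>. is_cocycle G \<phi> \<and> commuting_symmetric G \<phi>}"
proof -
  interpret group G by fact
  have ker: "H2_class G \<phi> \<in> kernel (H2 G QmodZ) (H2 (restricted_group G A) QmodZ) (res G A)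
      \<longleftrightarrow> is_coboundary (restricted_group G A) \<phi>" if "is_cocycle G \<phi>" "subgroup A G" for A \<phi>
    using that H2_class_eq_one_iff[OF subgroup.subgroup_is_group[OF that(2) assms] is_cocycle_restricted[OF that(2,1)]]
    by (auto simp: kernel_def H2_simps(1)[OF assms] res_H2_class[OF assms])
  have iff: "H2_class G \<phi> \<in> carrier (B0 G) \<longleftrightarrow> commuting_symmetric G \<phi>" if \<phi>: "is_cocycle G \<phi>" for \<phi>
  proof
    assume B: "H2_class G \<phi> \<in> carrier (B0 G)"
    show "commuting_symmetric G \<phi>" unfolding commuting_symmetric_def
    proof (intro ballI impI)
      fix x y assume xy: "x \<in> carrier G" "y \<in> carrier G" "x \<otimes>\<^bsub>G\<^esub> y = y \<otimes>\<^bsub>G\<^esub> x"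
      define A where "A = generate G {x, y}"
      have A: "subgroup A G" unfolding A_def using xy by (intro generate_is_subgroup) auto
      have "g \<otimes>\<^bsub>G\<^esub> h = h \<otimes>\<^bsub>G\<^esub> g" if "g \<in> A" "h \<in> A" for g h
        using that unfolding A_def by (rule generate_commuting[rotated 2]) (use xy in auto)
      then have "comm_group (restricted_group G A)"
        by (intro group.group_comm_groupI[OF subgroup.subgroup_is_group[OF A assms]]) auto
      then have "is_coboundary (restricted_group G A) \<phi>"
        using B A ker[OF \<phi> A] unfolding B0_def by auto
      moreover have "x \<in> A" "y \<in> A" unfolding A_def by (auto intro: generate.incl)
      ultimately show "\<phi> x y = \<phi> y x"
        using xy(3) unfolding is_coboundary_def by (auto simp: add.commute)
    qed
  next
    assume sym: "commuting_symmetric G \<phi>"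
    have "is_coboundary (restricted_group G A) \<phi>"
      if "subgroup A G" "comm_group (restricted_group G A)" for A
    proof (rule symmetric_cocycle_is_coboundary[OF that(2) is_cocycle_restricted[OF that(1) \<phi>]])
      fix x y assume xy: "x \<in> carrier (restricted_group G A)" "y \<in> carrier (restricted_group G A)"
      then have "x \<otimes>\<^bsub>G\<^esub> y = y \<otimes>\<^bsub>G\<^esub> x"
        using comm_monoid.m_comm[OF comm_group.axioms(1)[OF that(2)], of x y] by simp
      then show "\<phi> x y = \<phi> y x"
        using xy subgroup.mem_carrier[OF that(1)] by (intro commuting_symmetricD[OF sym]) auto
    qed
    then show "H2_class G \<phi> \<in> carrier (B0 G)" unfolding B0_def by (auto simp: ker[OF \<phi>])
  qed
  \<comment> \<open>The defining intersection of kernels is over a nonempty family, as the trivial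
    subgroup is abelian, and so stays inside the second cohomology group.\<close>
  have "carrier (B0 G) \<subseteq> carrier (H2 G QmodZ)"
  proof -
    have "subgroup {\<one>\<^bsub>G\<^esub>} G" by (rule triv_subgroup)
    moreover have "comm_group (restricted_group G {\<one>\<^bsub>G\<^esub>})"
      by (intro group.group_comm_groupI[OF subgroup.subgroup_is_group[OF triv_subgroup assms]]) auto
    ultimately show ?thesis unfolding B0_def by (auto simp: kernel_def)
  qed
  then show ?thesis using iff by (auto simp: H2_simps(1)[OF assms])
qed

lemma B0_mult:
  assumes "group G" "is_cocycle G \<phi>" "is_cocycle G \<psi>"
  shows "H2_class G \<phi> \<otimes>\<^bsub>B0 G\<^esub> H2_class G \<psi> = H2_class G (\<lambda>x y. \<phi> x y + \<psi> x y)"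
  using H2_simps(2)[OF assms] by (simp add: B0_def)

lemma B0_one: "group G \<Longrightarrow> \<one>\<^bsub>B0 G\<^esub> = H2_class G (\<lambda>x y. 0)"
  by (simp add: B0_def H2_simps(3))

lemma H2_class_eq_B0_one_iff:
  assumes "group G" "is_cocycle G \<phi>"
  shows "H2_class G \<phi> = \<one>\<^bsub>B0 G\<^esub> \<longleftrightarrow> is_coboundary G \<phi>"
  using H2_class_eq_one_iff[OF assms] by (simp add: B0_def)

lemma group_B0:
  assumes "group G"
  shows "group (B0 G)"
proof (rule groupI)
  note c = carrier_B0[OF assms]
  fix f g h
  assume "f \<in> carrier (B0 G)" "g \<in> carrier (B0 G)" "h \<in> carrier (B0 G)"
  then obtain \<phi> \<psi> \<chi> where "f = H2_class G \<phi>" "g = H2_class G \<psi>" "h = H2_class G \<chi>"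
    "is_cocycle G \<phi>" "is_cocycle G \<psi>" "is_cocycle G \<chi>"
    unfolding c by blast
  then show "f \<otimes>\<^bsub>B0 G\<^esub> g \<otimes>\<^bsub>B0 G\<^esub> h = f \<otimes>\<^bsub>B0 G\<^esub> (g \<otimes>\<^bsub>B0 G\<^esub> h)"
    by (simp add: B0_mult[OF assms] is_cocycle_add add.assoc)
next
  note c = carrier_B0[OF assms]
  fix f g
  assume "f \<in> carrier (B0 G)" "g \<in> carrier (B0 G)"
  then obtain \<phi> \<psi> where *: "f = H2_class G \<phi>" "g = H2_class G \<psi>" "is_cocycle G \<phi>" "is_cocycle G \<psi>"
     "commuting_symmetric G \<phi>" "commuting_symmetric G \<psi>"
    unfolding c by blast
  have "commuting_symmetric G (\<lambda>x y. \<phi> x y + \<psi> x y)"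
    using *(5,6) by (simp add: commuting_symmetric_def)
  then show "f \<otimes>\<^bsub>B0 G\<^esub> g \<in> carrier (B0 G)"
    using * by (auto simp: c B0_mult[OF assms] is_cocycle_add)
  show "\<one>\<^bsub>B0 G\<^esub> \<otimes>\<^bsub>B0 G\<^esub> f = f"
    using * by (simp add: B0_one[OF assms] B0_mult[OF assms] is_cocycle_zero)
  have "commuting_symmetric G (\<lambda>x y. - \<phi> x y)"
    using *(5) by (simp add: commuting_symmetric_def)
  then show "\<exists>h\<in>carrier (B0 G). h \<otimes>\<^bsub>B0 G\<^esub> f = \<one>\<^bsub>B0 G\<^esub>"
    using * by (intro bexI[of _ "H2_class G (\<lambda>x y. - \<phi> x y)"])
      (auto simp: c B0_one[OF assms] B0_mult[OF assms] is_cocycle_minus)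
next
  show "\<one>\<^bsub>B0 G\<^esub> \<in> carrier (B0 G)"
    using is_cocycle_zero by (auto simp: carrier_B0[OF assms] B0_one[OF assms] commuting_symmetric_def)
qed

subsection \<open>Characters of subquotients\<close>

text \<open>The two conventions for commutators yield the same set: x y x^-1 y^-1 is
  [x^-1, y^-1].\<close>

lemma (in group) derived_eq_generate_commutators: "derived G (carrier G) = generate G (commutators G)"
proof -
  have "derived_set G (carrier G) = commutators G"
  proof
    show "derived_set G (carrier G) \<subseteq> commutators G"
    proof
      fix g assume "g \<in> derived_set G (carrier G)"
      then obtain x y where xy: "x \<in> carrier G" "y \<in> carrier G" "g = x \<otimes> y \<otimes> inv x \<otimes> inv y" by blast
      then have "g = inv (inv x) \<otimes> inv (inv y) \<otimes> inv x \<otimes> inv y" by simp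
      then show "g \<in> commutators G" unfolding commutators_def using xy inv_closed by blast
    qed
    show "commutators G \<subseteq> derived_set G (carrier G)"
    proof
      fix g assume "g \<in> commutators G"
      then obtain x y where xy: "x \<in> carrier G" "y \<in> carrier G" "g = inv x \<otimes> inv y \<otimes> x \<otimes> y"
        unfolding commutators_def by blast
      then have "g = inv x \<otimes> inv y \<otimes> inv (inv x) \<otimes> inv (inv y)" by simp
      then show "g \<in> derived_set G (carrier G)" using xy inv_closed by blast
    qed
  qed
  then show ?thesis by (simp add: derived_def)
qed

lemma (in group) commutators_closed: "commutators G \<subseteq> carrier G"
  by (auto simp: commutators_def)

text \<open>A conjugate of a commutator is the commutator of the conjugates, so the generating set
  is closed under conjugation.\<close>

lemma (in group) normal_generate_commutators_Int:
  assumes "N \<lhd> G"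
  shows "generate G (commutators G \<inter> N) \<lhd> G"
proof (rule normal_generateI)
  show "commutators G \<inter> N \<subseteq> carrier G" using commutators_closed by blast
  fix h g assume h: "h \<in> commutators G \<inter> N" and g: "g \<in> carrier G"
  then obtain x y where xy: "x \<in> carrier G" "y \<in> carrier G" "h = inv x \<otimes> inv y \<otimes> x \<otimes> y"
    unfolding commutators_def by blast
  have cancel: "inv g \<otimes> (g \<otimes> z) = z" if "z \<in> carrier G" for z
    using g that by (simp add: m_assoc[symmetric])
  have "g \<otimes> h \<otimes> inv g = inv (g \<otimes> x \<otimes> inv g) \<otimes> inv (g \<otimes> y \<otimes> inv g) \<otimes> (g \<otimes> x \<otimes> inv g) \<otimes> (g \<otimes> y \<otimes> inv g)"
    using g xy cancel by (simp add: inv_mult_group m_assoc)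
  moreover have "g \<otimes> x \<otimes> inv g \<in> carrier G" "g \<otimes> y \<otimes> inv g \<in> carrier G" using g xy by auto
  ultimately have "g \<otimes> h \<otimes> inv g \<in> commutators G" unfolding commutators_def by blast
  moreover have "g \<otimes> h \<otimes> inv g \<in> N" using normal.inv_op_closed2[OF assms g] h by blast
  ultimately show "g \<otimes> h \<otimes> inv g \<in> commutators G \<inter> N" by blast
qed

section \<open>Characters killing a subgroup and homomorphisms from the quotient\<close>

text \<open>\<open>additive_extension\<close> inside \<open>M\<close>: commutators of elements of
  \<open>M\<close> are commutators of \<open>G\<close> lying in \<open>M\<close>. It serves the
  three extensions needed later: from N \<inter> G' to N, from R \<inter> \<langle>K(F) \<inter>
  S\<rangle> to R, and from R to S.\<close>

lemma additive_extension_in_subgroup: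
  fixes \<chi> :: "'a \<Rightarrow> 'b::divisible_ab_group_add"
  assumes G: "group G" and M: "subgroup M G" and H: "subgroup H G" "H \<subseteq> M"
    and L: "subgroup L G" "L \<subseteq> M" "commutators G \<inter> M \<subseteq> L"
    and \<chi>: "additive_on G H \<chi>" "\<And>x. x \<in> H \<Longrightarrow> x \<in> L \<Longrightarrow> \<chi> x = 0"
  shows "\<exists>\<psi>. additive_on G M \<psi> \<and> (\<forall>x\<in>H. \<psi> x = \<chi> x) \<and> (\<forall>x\<in>L. \<psi> x = 0)"
proof -
  interpret group G by fact
  have "commutators (restricted_group G M) \<subseteq> L"
  proof
    fix g assume "g \<in> commutators (restricted_group G M)"
    then obtain x y where xy: "x \<in> M" "y \<in> M" "g = inv\<^bsub>G\<^esub> x \<otimes>\<^bsub>G\<^esub> inv\<^bsub>G\<^esub> y \<otimes>\<^bsub>G\<^esub> x \<otimes>\<^bsub>G\<^esub> y"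
      unfolding commutators_def using M by auto
    then have "g \<in> commutators G"
      unfolding commutators_def using subgroup.mem_carrier[OF M] by blast
    moreover have "g \<in> M" using xy M by (simp add: subgroup.m_closed subgroup.m_inv_closed)
    ultimately show "g \<in> L" using L(3) by blast
  qed
  then show ?thesis
    using additive_extension[OF subgroup.subgroup_is_group[OF M G] subgroup_incl[OF H(1) M H(2)]
        subgroup_incl[OF L(1) M L(2)], of \<chi>] \<chi> by simp
qed

text \<open>Homomorphisms from M / L are handled as additive functions on elements. Restriction and
  extension then concern one kind of function, and cosets of different subgroups need not be
  compared.\<close>

definition characters :: "('a, 'm) monoid_scheme \<Rightarrow> 'a set \<Rightarrow> 'a set \<Rightarrow> ('a \<Rightarrow> rat_mod_int) set" where
  "characters G M L = {\<chi>. additive_on G M \<chi> \<and> (\<forall>l\<in>L. \<chi> l = 0)}"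

text \<open>The chosen representative of a coset is immaterial for a character that vanishes on
  \<open>L\<close>; the restriction to the carrier gives the extensionality required by
  \<open>Hom_group\<close>.\<close>

definition descend ::
  "('a, 'm) monoid_scheme \<Rightarrow> 'a set \<Rightarrow> 'a set \<Rightarrow> ('a \<Rightarrow> rat_mod_int) \<Rightarrow> 'a set \<Rightarrow> rat set" where
  "descend G M L \<chi> = (\<lambda>c\<in>carrier (restricted_group G M Mod L).
     Rep_rat_mod_int (\<chi> (SOME m. m \<in> M \<and> L #>\<^bsub>G\<^esub> m = c)))"

lemma r_coset_restricted_group [simp]: "r_coset (restricted_group G M) L = r_coset G L"
  by (simp add: r_coset_def fun_eq_iff)

lemma set_mult_restricted_group [simp]: "set_mult (restricted_group G M) = set_mult G"
  by (simp add: set_mult_def fun_eq_iff)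

lemma characters_add: "\<chi> \<in> characters G M L \<Longrightarrow> \<psi> \<in> characters G M L \<Longrightarrow> (\<lambda>x. \<chi> x + \<psi> x) \<in> characters G M L"
  by (simp add: characters_def additive_on_add)

locale subquotient = group G for G (structure) +
  fixes M L
  assumes subgroup_M: "subgroup M G" and normal_L: "L \<lhd> G" and L_subset: "L \<subseteq> M"
begin

lemma M_carrier: "m \<in> M \<Longrightarrow> m \<in> carrier G"
  using subgroup_M by (rule subgroup.mem_carrier)

lemma carrier_Mod: "carrier (restricted_group G M Mod L) = (\<lambda>m. L #> m) ` M"
  by (simp add: carrier_FactGroup)

lemma mult_Mod:
  "m \<in> M \<Longrightarrow> n \<in> M \<Longrightarrow> (L #> m) \<otimes>\<^bsub>restricted_group G M Mod L\<^esub> (L #> n) = L #> (m \<otimes> n)"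
  using normal.rcos_sum[OF normal_L] by (simp add: M_carrier)

lemma coset_eq_imp:
  assumes "m \<in> M" "n \<in> M" "L #> m = L #> n"
  shows "\<exists>l\<in>L. m = l \<otimes> n"
proof -
  have "m \<in> L #> n"
    using rcos_self[OF M_carrier[OF assms(1)] normal_imp_subgroup[OF normal_L]] assms(3) by simp
  then show ?thesis unfolding r_coset_def by blast
qed

lemma descend_apply:
  assumes "\<chi> \<in> characters G M L" "m \<in> M"
  shows "descend G M L \<chi> (L #> m) = Rep_rat_mod_int (\<chi> m)"
proof -
  define n where "n = (SOME n. n \<in> M \<and> L #> n = L #> m)"
  have n: "n \<in> M" "L #> n = L #> m"
    using someI[of "\<lambda>n. n \<in> M \<and> L #> n = L #> m" m] assms(2) unfolding n_def by auto
  obtain l where l: "l \<in> L" "n = l \<otimes> m" using coset_eq_imp[OF n(1) assms(2) n(2)] by blast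
  have "additive_on G M \<chi>" "\<chi> l = 0" using assms(1) l(1) by (auto simp: characters_def)
  moreover have "l \<in> M" using l(1) L_subset by blast
  ultimately have "\<chi> n = \<chi> m" using additive_onD[of G M \<chi> l m] l(2) assms(2) by simp
  then show ?thesis using assms(2) by (simp add: descend_def carrier_Mod flip: n_def)
qed

lemma descend_eqI:
  assumes "f \<in> extensional (carrier (restricted_group G M Mod L))" "\<chi> \<in> characters G M L"
    "\<And>m. m \<in> M \<Longrightarrow> f (L #> m) = Rep_rat_mod_int (\<chi> m)"
  shows "f = descend G M L \<chi>"
proof (rule extensionalityI[OF assms(1)])
  show "descend G M L \<chi> \<in> extensional (carrier (restricted_group G M Mod L))"
    by (simp add: descend_def)
  fix c assume "c \<in> carrier (restricted_group G M Mod L)"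
  then show "f c = descend G M L \<chi> c" using assms(2,3) descend_apply by (auto simp: carrier_Mod)
qed

lemma descend_eq_iff:
  assumes "\<chi> \<in> characters G M L" "\<psi> \<in> characters G M L"
  shows "descend G M L \<chi> = descend G M L \<psi> \<longleftrightarrow> (\<forall>m\<in>M. \<chi> m = \<psi> m)"
proof
  assume "descend G M L \<chi> = descend G M L \<psi>"
  then show "\<forall>m\<in>M. \<chi> m = \<psi> m"
    using descend_apply[OF assms(1)] descend_apply[OF assms(2)] by (auto simp flip: Rep_rat_mod_int_inject)
next
  assume "\<forall>m\<in>M. \<chi> m = \<psi> m"
  then show "descend G M L \<chi> = descend G M L \<psi>"
    using assms(2) descend_apply[OF assms(1)] by (intro descend_eqI) (simp_all add: descend_def)
qed

lemma carrier_Hom: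
  "carrier (Hom_group (restricted_group G M Mod L) QmodZ) = descend G M L ` characters G M L"
proof
  show "carrier (Hom_group (restricted_group G M Mod L) QmodZ) \<subseteq> descend G M L ` characters G M L"
  proof
    fix f assume "f \<in> carrier (Hom_group (restricted_group G M Mod L) QmodZ)"
    then have f: "f \<in> hom (restricted_group G M Mod L) QmodZ" "f \<in> extensional (carrier (restricted_group G M Mod L))"
      by (auto simp: Hom_group_def)
    define \<chi> where "\<chi> = (\<lambda>m. Abs_rat_mod_int (f (L #> m)))"
    have Rep: "f (L #> m) = Rep_rat_mod_int (\<chi> m)" if "m \<in> M" for m
      using hom_in_carrier[OF f(1), of "L #> m"] that by (simp add: \<chi>_def carrier_Mod Abs_rat_mod_int_inverse)
    have add: "additive_on G M \<chi>"
      unfolding additive_on_def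
    proof (intro ballI)
      fix m n assume mn: "m \<in> M" "n \<in> M"
      have "Rep_rat_mod_int (\<chi> (m \<otimes> n)) = Rep_rat_mod_int (\<chi> m + \<chi> n)"
        using hom_mult[OF f(1), of "L #> m" "L #> n"] mn
        by (simp add: mult_Mod carrier_Mod Rep Rep_arith subgroup.m_closed[OF subgroup_M] del: mult_FactGroup)
      then show "\<chi> (m \<otimes> n) = \<chi> m + \<chi> n" by (simp add: Rep_rat_mod_int_inject)
    qed
    have "\<chi> l = 0" if "l \<in> L" for l
    proof -
      have "L #> l = L #> \<one>"
        using that normal_imp_subgroup[OF normal_L] M_carrier L_subset
        by (metis coset_join2 coset_mult_one subgroup.subset subsetD)
      then have "\<chi> l = \<chi> \<one>" by (simp add: \<chi>_def)
      then show ?thesis using additive_on_one[OF is_group subgroup_M add] by simp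
    qed
    then have \<chi>: "\<chi> \<in> characters G M L" using add by (simp add: characters_def)
    then show "f \<in> descend G M L ` characters G M L" using descend_eqI[OF f(2) \<chi> Rep] by blast
  qed
  show "descend G M L ` characters G M L \<subseteq> carrier (Hom_group (restricted_group G M Mod L) QmodZ)"
  proof clarify
    fix \<chi> assume \<chi>: "\<chi> \<in> characters G M L"
    have "descend G M L \<chi> \<in> hom (restricted_group G M Mod L) QmodZ"
    proof (rule homI)
      fix c d assume "c \<in> carrier (restricted_group G M Mod L)" "d \<in> carrier (restricted_group G M Mod L)"
      then obtain m n where mn: "m \<in> M" "n \<in> M" "c = L #> m" "d = L #> n" by (auto simp: carrier_Mod)
      show "descend G M L \<chi> c \<in> carrier QmodZ" using mn descend_apply[OF \<chi>] Rep_rat_mod_int by simp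
      have "\<chi> (m \<otimes> n) = \<chi> m + \<chi> n" using \<chi> mn by (simp add: characters_def additive_on_def)
      then show "descend G M L \<chi> (c \<otimes>\<^bsub>restricted_group G M Mod L\<^esub> d) = descend G M L \<chi> c \<otimes>\<^bsub>QmodZ\<^esub> descend G M L \<chi> d"
        using mn by (simp add: mult_Mod descend_apply[OF \<chi>] subgroup.m_closed[OF subgroup_M] Rep_arith
            del: mult_FactGroup)
    qed
    then show "descend G M L \<chi> \<in> carrier (Hom_group (restricted_group G M Mod L) QmodZ)"
      by (simp add: Hom_group_def descend_def)
  qed
qed

lemma mult_Hom:
  assumes "\<chi> \<in> characters G M L" "\<psi> \<in> characters G M L"
  shows "descend G M L \<chi> \<otimes>\<^bsub>Hom_group (restricted_group G M Mod L) QmodZ\<^esub> descend G M L \<psi>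
    = descend G M L (\<lambda>x. \<chi> x + \<psi> x)"
  using characters_add[OF assms] descend_apply[OF assms(1)] descend_apply[OF assms(2)]
  by (intro descend_eqI) (auto simp: Hom_group_def Rep_arith carrier_Mod)

lemma zero_characters: "(\<lambda>x. 0) \<in> characters G M L"
  by (simp add: characters_def additive_on_def)

lemma one_Hom: "\<one>\<^bsub>Hom_group (restricted_group G M Mod L) QmodZ\<^esub> = descend G M L (\<lambda>x. 0)"
  by (intro descend_eqI zero_characters) (auto simp: Hom_group_def Rep_arith carrier_Mod)

lemma descend_eq_one_iff:
  "\<chi> \<in> characters G M L \<Longrightarrow>
    descend G M L \<chi> = \<one>\<^bsub>Hom_group (restricted_group G M Mod L) QmodZ\<^esub> \<longleftrightarrow> (\<forall>m\<in>M. \<chi> m = 0)"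
  by (simp add: one_Hom descend_eq_iff zero_characters)

lemma group_Hom: "group (Hom_group (restricted_group G M Mod L) QmodZ)"
proof (rule groupI)
  fix f g h
  assume "f \<in> carrier (Hom_group (restricted_group G M Mod L) QmodZ)"
    "g \<in> carrier (Hom_group (restricted_group G M Mod L) QmodZ)"
    "h \<in> carrier (Hom_group (restricted_group G M Mod L) QmodZ)"
  then obtain \<phi> \<psi> \<chi> where "f = descend G M L \<phi>" "g = descend G M L \<psi>" "h = descend G M L \<chi>"
    "\<phi> \<in> characters G M L" "\<psi> \<in> characters G M L" "\<chi> \<in> characters G M L"
    unfolding carrier_Hom by blast
  then show "f \<otimes>\<^bsub>Hom_group (restricted_group G M Mod L) QmodZ\<^esub> g \<otimes>\<^bsub>Hom_group (restricted_group G M Mod L) QmodZ\<^esub> h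
      = f \<otimes>\<^bsub>Hom_group (restricted_group G M Mod L) QmodZ\<^esub> (g \<otimes>\<^bsub>Hom_group (restricted_group G M Mod L) QmodZ\<^esub> h)"
    by (simp add: mult_Hom characters_add add.assoc)
next
  fix f g
  assume "f \<in> carrier (Hom_group (restricted_group G M Mod L) QmodZ)"
    "g \<in> carrier (Hom_group (restricted_group G M Mod L) QmodZ)"
  then obtain \<phi> \<psi> where *: "f = descend G M L \<phi>" "g = descend G M L \<psi>"
    "\<phi> \<in> characters G M L" "\<psi> \<in> characters G M L"
    unfolding carrier_Hom by blast
  show "f \<otimes>\<^bsub>Hom_group (restricted_group G M Mod L) QmodZ\<^esub> g \<in> carrier (Hom_group (restricted_group G M Mod L) QmodZ)"
    using * by (simp add: mult_Hom carrier_Hom characters_add)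
  show "\<one>\<^bsub>Hom_group (restricted_group G M Mod L) QmodZ\<^esub> \<otimes>\<^bsub>Hom_group (restricted_group G M Mod L) QmodZ\<^esub> f = f"
    using * by (simp add: one_Hom mult_Hom zero_characters)
  have "(\<lambda>x. - \<phi> x) \<in> characters G M L" using *(3) by (simp add: characters_def additive_on_def)
  then show "\<exists>h\<in>carrier (Hom_group (restricted_group G M Mod L) QmodZ).
      h \<otimes>\<^bsub>Hom_group (restricted_group G M Mod L) QmodZ\<^esub> f = \<one>\<^bsub>Hom_group (restricted_group G M Mod L) QmodZ\<^esub>"
    using * by (intro bexI[of _ "descend G M L (\<lambda>x. - \<phi> x)"]) (auto simp: one_Hom mult_Hom carrier_Hom)
next
  show "\<one>\<^bsub>Hom_group (restricted_group G M Mod L) QmodZ\<^esub> \<in> carrier (Hom_group (restricted_group G M Mod L) QmodZ)"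
    using zero_characters by (simp add: one_Hom carrier_Hom)
qed

end

subsection \<open>Transgression and inflation\<close>

lemma epimorphism_factor:
  assumes "N \<lhd> G"
  shows "epimorphism G (G Mod N) (\<lambda>x. N #>\<^bsub>G\<^esub> x)"
proof -
  have "group G" using assms by (simp add: normal.axioms)
  then show ?thesis
    using normal.factorgroup_is_group[OF assms] normal.r_coset_hom_Mod[OF assms]
    by (auto simp: epimorphism_def epimorphism_axioms_def group_hom_def group_hom_axioms_def carrier_FactGroup)
qed

lemma kernel_factor:
  assumes "N \<lhd> G"
  shows "kernel G (G Mod N) (\<lambda>x. N #>\<^bsub>G\<^esub> x) = N"
proof -
  interpret group G using assms by (simp add: normal.axioms)
  have sub: "subgroup N G" using assms by (rule normal_imp_subgroup)
  show ?thesis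
    using coset_join1[OF _ _ sub] coset_join2[OF _ sub] subgroup.mem_carrier[OF sub]
    by (auto simp: kernel_def)
qed

text \<open>The difference of the cocycles is a transgression of the difference of the characters,
  so the coboundary criterion decides equality of classes.\<close>

lemma (in epimorphism) H2_class_eq_iff_extends:
  assumes "transgresses E (kernel E Q p) p \<chi> \<phi>" "transgresses E (kernel E Q p) p \<chi>' \<phi>'"
  shows "H2_class Q \<phi> = H2_class Q \<phi>' \<longleftrightarrow>
    (\<exists>\<psi>. additive_on E (carrier E) \<psi> \<and> (\<forall>m\<in>kernel E Q p. \<psi> m = \<chi> m - \<chi>' m))"
  using H2_class_eq_iff[OF H.is_group transgresses_cocycle[OF assms(1)] transgresses_cocycle[OF assms(2)]]
    transgresses_coboundary_iff[OF transgresses_diff[OF assms]] by simp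

lemma (in epimorphism) H2_class_eqI:
  assumes "transgresses E (kernel E Q p) p \<chi> \<phi>" "transgresses E (kernel E Q p) p \<chi>' \<phi>'"
    and "\<And>m. m \<in> kernel E Q p \<Longrightarrow> \<chi> m = \<chi>' m"
  shows "H2_class Q \<phi> = H2_class Q \<phi>'"
  unfolding H2_class_eq_iff_extends[OF assms(1,2)]
  using assms(3) by (intro exI[of _ "\<lambda>x. 0"]) (simp add: additive_on_def)

lemma (in group) commutator_characters_iff:
  assumes "subgroup N G"
  shows "\<chi> \<in> characters G N (generate G (commutators G \<inter> N)) \<longleftrightarrow>
    additive_on G N \<chi> \<and> (\<forall>m\<in>commutators G \<inter> N. \<chi> m = 0)"
  using additive_on_zero_generate[OF is_group assms, of \<chi> "commutators G \<inter> N"]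
    generate.incl[of _ "commutators G \<inter> N" G]
  by (auto simp: characters_def)

lemma (in group) generate_commutators_Int_subset:
  "subgroup N G \<Longrightarrow> generate G (commutators G \<inter> N) \<subseteq> N"
  by (rule generate_subgroup_incl) auto

locale normal_pair = normal N G for N and G (structure)
begin

abbreviation "\<pi> \<equiv> \<lambda>x. N #> x"
abbreviation "L \<equiv> generate G (commutators G \<inter> N)"
abbreviation "D \<equiv> N \<inter> derived G (carrier G)"

sublocale \<pi>: epimorphism G "G Mod N" \<pi>
  by (rule epimorphism_factor) (rule normal_axioms)

lemma kernel_\<pi> [simp]: "kernel G (G Mod N) \<pi> = N"
  by (rule kernel_factor) (rule normal_axioms)

lemma subgroup_D: "subgroup D G"
  using subgroup_axioms derived_is_subgroup[of "carrier G"] by (intro subgroups_Inter_pair) auto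

lemma L_subset_D: "L \<subseteq> D"
  using generate_commutators_Int_subset[OF subgroup_axioms] mono_generate[of "commutators G \<inter> N" "commutators G"]
  by (auto simp: derived_eq_generate_commutators)

sublocale N_L: subquotient G N L
  using subgroup_axioms normal_generate_commutators_Int[OF normal_axioms]
    generate_commutators_Int_subset[OF subgroup_axioms]
  by (intro subquotient.intro subquotient_axioms.intro is_group)

sublocale D_L: subquotient G D L
  using subgroup_D normal_generate_commutators_Int[OF normal_axioms] L_subset_D
  by (intro subquotient.intro subquotient_axioms.intro is_group)

lemma tra_source_eq: "tra_source G N = restricted_group G D Mod L"
  by (simp add: tra_source_def Int_commute)

text \<open>For every section the defining cochain is a transgression of \<open>\<chi>\<close>, and
  any two transgressions of the same character are cohomologous. Since sections exist, the union
  collapses to one class.\<close>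

lemma tra_full_descend:
  assumes \<chi>: "\<chi> \<in> characters G N L" and \<phi>: "transgresses G N \<pi> \<chi> \<phi>"
  shows "tra_full G N (descend G N L \<chi>) = H2_class (G Mod N) \<phi>"
proof -
  have \<chi>': "additive_on G N \<chi>" "\<And>m. m \<in> commutators G \<Longrightarrow> m \<in> N \<Longrightarrow> \<chi> m = 0"
    using \<chi> commutator_characters_iff[OF subgroup_axioms] by auto
  have *: "cohomology_class (G Mod N) QmodZ (tra_cochain G N \<mu> (descend G N L \<chi>)) = H2_class (G Mod N) \<phi>"
    if "\<mu> \<in> factor_sections G N" for \<mu>
  proof -
    have \<mu>: "\<mu> a \<in> carrier G" "\<pi> (\<mu> a) = a" if "a \<in> carrier (G Mod N)" for a
      using \<open>\<mu> \<in> factor_sections G N\<close> that by (auto simp: factor_sections_def)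
    have t: "transgresses G N \<pi> \<chi> (\<lambda>a b. \<chi> (\<mu> a \<otimes> \<mu> b \<otimes> inv \<mu> (a \<otimes>\<^bsub>G Mod N\<^esub> b)))"
      using \<pi>.transgresses_section[of \<chi> \<mu>] \<chi>' \<mu> by simp
    have N: "\<mu> a \<otimes> \<mu> b \<otimes> inv \<mu> (a \<otimes>\<^bsub>G Mod N\<^esub> b) \<in> N" if "a \<in> carrier (G Mod N)" "b \<in> carrier (G Mod N)" for a b
    proof -
      have ab: "a \<otimes>\<^bsub>G Mod N\<^esub> b \<in> carrier (G Mod N)" using that by (rule \<pi>.H.m_closed)
      have "\<mu> a \<otimes> \<mu> b \<otimes> inv \<mu> (a \<otimes>\<^bsub>G Mod N\<^esub> b) \<in> kernel G (G Mod N) \<pi>"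
        using that ab \<mu>[OF that(1)] \<mu>[OF that(2)] \<mu>[OF ab] by (simp add: kernel_def del: kernel_\<pi> mult_FactGroup one_FactGroup)
      then show ?thesis by simp
    qed
    have "tra_cochain G N \<mu> (descend G N L \<chi>) = cochain_of (G Mod N) (\<lambda>a b. \<chi> (\<mu> a \<otimes> \<mu> b \<otimes> inv \<mu> (a \<otimes>\<^bsub>G Mod N\<^esub> b)))"
      using N N_L.descend_apply[OF \<chi>] unfolding tra_cochain_def cochain_of_def
      by (intro restrict_ext) (auto simp del: mult_FactGroup)
    moreover have "H2_class (G Mod N) (\<lambda>a b. \<chi> (\<mu> a \<otimes> \<mu> b \<otimes> inv \<mu> (a \<otimes>\<^bsub>G Mod N\<^esub> b))) = H2_class (G Mod N) \<phi>"
      using t \<phi> by (intro \<pi>.H2_class_eqI[of \<chi> _ \<chi>]) simp_all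
    ultimately show ?thesis by (simp add: H2_class_def)
  qed
  have "factor_sections G N \<noteq> {}"
  proof -
    obtain \<mu> where "\<And>a. a \<in> carrier (G Mod N) \<Longrightarrow> \<mu> a \<in> carrier G \<and> \<pi> (\<mu> a) = a"
      using \<pi>.preimage by metis
    then have "\<mu> \<in> factor_sections G N" by (simp add: factor_sections_def)
    then show ?thesis by blast
  qed
  then show ?thesis unfolding tra_full_def using * by auto
qed

lemma extend_character:
  assumes "\<chi> \<in> characters G D L"
  shows "\<exists>\<chi>'\<in>characters G N L. \<forall>m\<in>D. \<chi>' m = \<chi> m"
proof -
  have "commutators G \<inter> N \<subseteq> L" by (auto intro: generate.incl)
  moreover have "subgroup L G" using normal_imp_subgroup[OF N_L.normal_L] .
  ultimately have "\<exists>\<psi>. additive_on G N \<psi> \<and> (\<forall>x\<in>D. \<psi> x = \<chi> x) \<and> (\<forall>x\<in>L. \<psi> x = 0)"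
    using assms by (intro additive_extension_in_subgroup[OF is_group subgroup_axioms subgroup_D _ _ N_L.L_subset])
      (auto simp: characters_def)
  then show ?thesis by (auto simp: characters_def)
qed

lemma additive_on_zero_derived:
  "additive_on G (carrier G) \<psi> \<Longrightarrow> x \<in> derived G (carrier G) \<Longrightarrow> \<psi> x = 0"
  unfolding derived_eq_generate_commutators
  by (rule additive_on_zero_generate[OF is_group subgroup_self _ commutators_closed])
    (auto simp: additive_on_commutator[OF is_group])

text \<open>Additive maps on \<open>G\<close> vanish on the derived subgroup. Conversely, vanishing
  on \<open>D\<close> is the compatibility condition for extending \<open>\<chi>\<close> together
  with the value 0 on the derived subgroup.\<close>

lemma extends_iff_zero_on_D:
  assumes "additive_on G N \<chi>"
  shows "(\<exists>\<psi>::'a \<Rightarrow> 'c::divisible_ab_group_add. additive_on G (carrier G) \<psi> \<and> (\<forall>m\<in>N. \<psi> m = \<chi> m))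
    \<longleftrightarrow> (\<forall>m\<in>D. \<chi> m = 0)"
proof
  assume "\<exists>\<psi>. additive_on G (carrier G) \<psi> \<and> (\<forall>m\<in>N. \<psi> m = \<chi> m)"
  then obtain \<psi> where \<psi>: "additive_on G (carrier G) \<psi>" "\<And>m. m \<in> N \<Longrightarrow> \<psi> m = \<chi> m" by auto
  show "\<forall>m\<in>D. \<chi> m = 0"
  proof
    fix m assume "m \<in> D"
    then show "\<chi> m = 0" using additive_on_zero_derived[OF \<psi>(1)] \<psi>(2) by fastforce
  qed
next
  assume "\<forall>m\<in>D. \<chi> m = 0"
  moreover have "commutators G \<subseteq> derived G (carrier G)"
    by (auto simp: derived_eq_generate_commutators intro: generate.incl)
  ultimately show "\<exists>\<psi>. additive_on G (carrier G) \<psi> \<and> (\<forall>m\<in>N. \<psi> m = \<chi> m)"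
    using additive_extension[OF is_group subgroup_axioms derived_is_subgroup[of "carrier G"], of \<chi>] assms by auto
qed

text \<open>Two extensions of \<open>\<chi>\<close> to \<open>N\<close> differ by a character
  vanishing on \<open>D\<close>. That difference extends to \<open>G\<close>, so the transgressions
  are cohomologous and the union over extensions is a single class.\<close>

lemma tra_descend:
  assumes \<chi>: "\<chi> \<in> characters G D L" and \<chi>': "\<chi>' \<in> characters G N L" "\<And>m. m \<in> D \<Longrightarrow> \<chi>' m = \<chi> m"
    and \<phi>: "transgresses G N \<pi> \<chi>' \<phi>"
  shows "tra G N (descend G D L \<chi>) = H2_class (G Mod N) \<phi>"
proof -
  have ext: "hom_extensions G N (descend G D L \<chi>) = descend G N L ` {\<psi> \<in> characters G N L. \<forall>m\<in>D. \<psi> m = \<chi> m}"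
  proof -
    have "(\<forall>c\<in>carrier (tra_source G N). descend G N L \<psi> c = descend G D L \<chi> c) \<longleftrightarrow> (\<forall>m\<in>D. \<psi> m = \<chi> m)"
      if "\<psi> \<in> characters G N L" for \<psi>
      using N_L.descend_apply[OF that] D_L.descend_apply[OF \<chi>]
      by (simp add: tra_source_eq D_L.carrier_Mod Rep_rat_mod_int_inject)
    then show ?thesis unfolding hom_extensions_def N_L.carrier_Hom by blast
  qed
  have *: "tra_full G N (descend G N L \<psi>) = H2_class (G Mod N) \<phi>"
    if \<psi>: "\<psi> \<in> characters G N L" "\<forall>m\<in>D. \<psi> m = \<chi> m" for \<psi>
  proof -
    have \<psi>': "additive_on G N \<psi>" "\<And>m. m \<in> commutators G \<Longrightarrow> m \<in> N \<Longrightarrow> \<psi> m = 0"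
      using \<psi>(1) commutator_characters_iff[OF subgroup_axioms] by auto
    obtain \<rho> where \<rho>: "transgresses G N \<pi> \<psi> \<rho>"
      using \<pi>.transgresses_exists[of \<psi>] \<psi>' by auto
    have "additive_on G N (\<lambda>m. \<psi> m - \<chi>' m)"
      using \<psi>'(1) \<chi>'(1) by (intro additive_on_diff) (auto simp: characters_def)
    then have "H2_class (G Mod N) \<rho> = H2_class (G Mod N) \<phi>"
      using \<pi>.H2_class_eq_iff_extends[of \<psi> \<rho> \<chi>' \<phi>] \<rho> \<phi> extends_iff_zero_on_D[of "\<lambda>m. \<psi> m - \<chi>' m"] \<psi>(2) \<chi>'(2)
      by simp
    then show ?thesis using tra_full_descend[OF \<psi>(1) \<rho>] by simp
  qed
  have "{\<psi> \<in> characters G N L. \<forall>m\<in>D. \<psi> m = \<chi> m} \<noteq> {}" using \<chi>' by blast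
  then show ?thesis unfolding tra_def ext using * by auto
qed

lemma tra_descend_exists:
  assumes "\<chi> \<in> characters G D L"
  obtains \<chi>' \<phi> where "\<chi>' \<in> characters G N L" "\<forall>m\<in>D. \<chi>' m = \<chi> m" "transgresses G N \<pi> \<chi>' \<phi>"
    "is_cocycle (G Mod N) \<phi>" "commuting_symmetric (G Mod N) \<phi>"
    "tra G N (descend G D L \<chi>) = H2_class (G Mod N) \<phi>"
proof -
  obtain \<chi>' where \<chi>': "\<chi>' \<in> characters G N L" "\<forall>m\<in>D. \<chi>' m = \<chi> m"
    using extend_character[OF assms] by blast
  have add: "additive_on G N \<chi>'" and zero: "\<forall>m\<in>commutators G \<inter> N. \<chi>' m = 0"
    using \<chi>'(1) commutator_characters_iff[OF subgroup_axioms] by auto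
  obtain \<phi> where \<phi>: "transgresses G N \<pi> \<chi>' \<phi>"
    using \<pi>.transgresses_exists[of \<chi>'] add zero by auto
  have "is_cocycle (G Mod N) \<phi>" using \<pi>.transgresses_cocycle \<phi> by simp
  moreover have "commuting_symmetric (G Mod N) \<phi>"
    using \<pi>.transgresses_commuting_symmetric_iff[of \<chi>' \<phi>] \<phi> zero by simp
  moreover have "tra G N (descend G D L \<chi>) = H2_class (G Mod N) \<phi>"
    using tra_descend[OF assms \<chi>'(1) _ \<phi>] \<chi>'(2) by blast
  ultimately show thesis using that \<chi>' \<phi> by blast
qed

section \<open>Transgression as an injective homomorphism\<close>

lemma group_hom_tra: "group_hom (Hom_group (tra_source G N) QmodZ) (B0 (G Mod N)) (tra G N)"
proof -
  have Q: "group (G Mod N)" by (rule \<pi>.H.is_group)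
  have "tra G N \<in> hom (Hom_group (restricted_group G D Mod L) QmodZ) (B0 (G Mod N))"
  proof (rule homI)
    fix f assume "f \<in> carrier (Hom_group (restricted_group G D Mod L) QmodZ)"
    then obtain \<chi> where "f = descend G D L \<chi>" "\<chi> \<in> characters G D L" unfolding D_L.carrier_Hom by blast
    then show "tra G N f \<in> carrier (B0 (G Mod N))"
      by (metis (mono_tags, lifting) tra_descend_exists carrier_B0[OF Q] imageI mem_Collect_eq)
  next
    fix f g
    assume "f \<in> carrier (Hom_group (restricted_group G D Mod L) QmodZ)"
      "g \<in> carrier (Hom_group (restricted_group G D Mod L) QmodZ)"
    then obtain \<chi> \<psi> where *: "f = descend G D L \<chi>" "\<chi> \<in> characters G D L" "g = descend G D L \<psi>" "\<psi> \<in> characters G D L"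
      unfolding D_L.carrier_Hom by blast
    obtain \<chi>' \<phi> where 1: "\<chi>' \<in> characters G N L" "\<forall>m\<in>D. \<chi>' m = \<chi> m" "transgresses G N \<pi> \<chi>' \<phi>"
      "is_cocycle (G Mod N) \<phi>" "tra G N f = H2_class (G Mod N) \<phi>"
      using tra_descend_exists[OF *(2)] *(1) by metis
    obtain \<psi>' \<rho> where 2: "\<psi>' \<in> characters G N L" "\<forall>m\<in>D. \<psi>' m = \<psi> m" "transgresses G N \<pi> \<psi>' \<rho>"
      "is_cocycle (G Mod N) \<rho>" "tra G N g = H2_class (G Mod N) \<rho>"
      using tra_descend_exists[OF *(4)] *(3) by metis
    have "tra G N (descend G D L (\<lambda>x. \<chi> x + \<psi> x)) = H2_class (G Mod N) (\<lambda>a b. \<phi> a b + \<rho> a b)"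
      using 1(2) 2(2)
      by (intro tra_descend[OF characters_add[OF *(2,4)] characters_add[OF 1(1) 2(1)] _ transgresses_add[OF 1(3) 2(3)]]) simp
    then show "tra G N (f \<otimes>\<^bsub>Hom_group (restricted_group G D Mod L) QmodZ\<^esub> g) = tra G N f \<otimes>\<^bsub>B0 (G Mod N)\<^esub> tra G N g"
      using 1(5) 2(5) * by (simp add: D_L.mult_Hom B0_mult[OF Q 1(4) 2(4)])
  qed
  then show ?thesis
    using D_L.group_Hom group_B0[OF Q] by (simp add: tra_source_eq group_hom_def group_hom_axioms_def)
qed

text \<open>If the transgressed class is trivial, the extension of \<open>\<chi>\<close> to
  \<open>N\<close> extends further to \<open>G\<close>. It is then zero on \<open>D\<close>, where
  it agrees with \<open>\<chi>\<close>.\<close>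

lemma kernel_tra:
  "kernel (Hom_group (tra_source G N) QmodZ) (B0 (G Mod N)) (tra G N) = {\<one>\<^bsub>Hom_group (tra_source G N) QmodZ\<^esub>}"
proof -
  interpret tra: group_hom "Hom_group (tra_source G N) QmodZ" "B0 (G Mod N)" "tra G N"
    by (rule group_hom_tra)
  have Q: "group (G Mod N)" by (rule \<pi>.H.is_group)
  have "f = \<one>\<^bsub>Hom_group (tra_source G N) QmodZ\<^esub>"
    if f: "f \<in> kernel (Hom_group (tra_source G N) QmodZ) (B0 (G Mod N)) (tra G N)" for f
  proof -
    obtain \<chi> where \<chi>: "f = descend G D L \<chi>" "\<chi> \<in> characters G D L"
      using f unfolding kernel_def tra_source_eq D_L.carrier_Hom by blast
    obtain \<chi>' \<phi> where 1: "\<chi>' \<in> characters G N L" "\<forall>m\<in>D. \<chi>' m = \<chi> m" "transgresses G N \<pi> \<chi>' \<phi>"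
      "is_cocycle (G Mod N) \<phi>" "tra G N f = H2_class (G Mod N) \<phi>"
      using tra_descend_exists[OF \<chi>(2)] \<chi>(1) by metis
    have "is_coboundary (G Mod N) \<phi>"
      using f 1(5) H2_class_eq_B0_one_iff[OF Q 1(4)] by (simp add: kernel_def)
    then have "\<forall>m\<in>D. \<chi>' m = 0"
      using \<pi>.transgresses_coboundary_iff[of \<chi>' \<phi>] 1(1,3) extends_iff_zero_on_D[of \<chi>']
      by (simp add: characters_def)
    then show ?thesis using 1(2) D_L.descend_eq_one_iff[OF \<chi>(2)] \<chi>(1) by (simp add: tra_source_eq)
  qed
  then show ?thesis
    using tra.hom_one tra.G.one_closed by (auto simp: kernel_def)
qed

section \<open>Inflation, and exactness at the multiplier of the quotient\<close>

lemma inf_B0_H2_class: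
  "is_cocycle (G Mod N) \<phi> \<Longrightarrow> inf_B0 G N (H2_class (G Mod N) \<phi>) = H2_class G (\<lambda>x y. \<phi> (\<pi> x) (\<pi> y))"
  unfolding inf_B0_def
  by (rule H2_pullback_H2_class[OF is_group \<pi>.H.is_group \<pi>.homh])

lemma group_hom_inf: "group_hom (B0 (G Mod N)) (B0 G) (inf_B0 G N)"
proof -
  have Q: "group (G Mod N)" by (rule \<pi>.H.is_group)
  have "inf_B0 G N \<in> hom (B0 (G Mod N)) (B0 G)"
  proof (rule homI)
    fix f assume "f \<in> carrier (B0 (G Mod N))"
    then obtain \<phi> where "f = H2_class (G Mod N) \<phi>" "is_cocycle (G Mod N) \<phi>" "commuting_symmetric (G Mod N) \<phi>"
      unfolding carrier_B0[OF Q] by blast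
    then show "inf_B0 G N f \<in> carrier (B0 G)"
      using \<pi>.is_cocycle_inflate[of \<phi>] \<pi>.commuting_symmetric_inflate[of \<phi>]
      by (auto simp: inf_B0_H2_class carrier_B0[OF is_group])
  next
    fix f g assume "f \<in> carrier (B0 (G Mod N))" "g \<in> carrier (B0 (G Mod N))"
    then obtain \<phi> \<psi> where "f = H2_class (G Mod N) \<phi>" "is_cocycle (G Mod N) \<phi>"
      "g = H2_class (G Mod N) \<psi>" "is_cocycle (G Mod N) \<psi>"
      unfolding carrier_B0[OF Q] by blast
    then show "inf_B0 G N (f \<otimes>\<^bsub>B0 (G Mod N)\<^esub> g) = inf_B0 G N f \<otimes>\<^bsub>B0 G\<^esub> inf_B0 G N g"
      using \<pi>.is_cocycle_inflate[of \<phi>] \<pi>.is_cocycle_inflate[of \<psi>]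
      by (simp add: inf_B0_H2_class B0_mult[OF Q] B0_mult[OF is_group] is_cocycle_add)
  qed
  then show ?thesis
    using group_B0[OF Q] group_B0[OF is_group] by (simp add: group_hom_def group_hom_axioms_def)
qed

text \<open>A transgressed cocycle is bounded on \<open>G\<close> by its own cochain. Conversely, a
  cochain bounding the inflated cocycle yields a character of \<open>N\<close>, and symmetry on
  commuting pairs forces this character to vanish on the commutators in \<open>N\<close>, so it
  comes from the source of \<open>tra\<close>.\<close>

lemma image_tra_eq_kernel_inf:
  "tra G N ` carrier (Hom_group (tra_source G N) QmodZ) = kernel (B0 (G Mod N)) (B0 G) (inf_B0 G N)"
proof -
  have Q: "group (G Mod N)" by (rule \<pi>.H.is_group)
  show ?thesis
  proof
    show "tra G N ` carrier (Hom_group (tra_source G N) QmodZ) \<subseteq> kernel (B0 (G Mod N)) (B0 G) (inf_B0 G N)"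
    proof
      fix \<xi> assume \<xi>: "\<xi> \<in> tra G N ` carrier (Hom_group (tra_source G N) QmodZ)"
      then obtain \<chi> where \<chi>: "\<xi> = tra G N (descend G D L \<chi>)" "\<chi> \<in> characters G D L"
        unfolding tra_source_eq D_L.carrier_Hom by blast
      obtain \<chi>' \<phi> where 1: "transgresses G N \<pi> \<chi>' \<phi>" "is_cocycle (G Mod N) \<phi>"
        "tra G N (descend G D L \<chi>) = H2_class (G Mod N) \<phi>"
        using tra_descend_exists[OF \<chi>(2)] by metis
      have "inf_B0 G N \<xi> = \<one>\<^bsub>B0 G\<^esub>"
        using \<pi>.transgresses_imp_inflation_coboundary[OF 1(1)] \<pi>.is_cocycle_inflate[OF 1(2)]
        by (simp add: \<chi>(1) 1(3) inf_B0_H2_class[OF 1(2)] H2_class_eq_B0_one_iff[OF is_group])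
      moreover have "\<xi> \<in> carrier (B0 (G Mod N))"
        using \<xi> group_hom.hom_closed[OF group_hom_tra] by blast
      ultimately show "\<xi> \<in> kernel (B0 (G Mod N)) (B0 G) (inf_B0 G N)" by (simp add: kernel_def)
    qed
    show "kernel (B0 (G Mod N)) (B0 G) (inf_B0 G N) \<subseteq> tra G N ` carrier (Hom_group (tra_source G N) QmodZ)"
    proof
      fix \<xi> assume \<xi>: "\<xi> \<in> kernel (B0 (G Mod N)) (B0 G) (inf_B0 G N)"
      then obtain \<phi> where \<phi>: "\<xi> = H2_class (G Mod N) \<phi>" "is_cocycle (G Mod N) \<phi>" "commuting_symmetric (G Mod N) \<phi>"
        unfolding kernel_def carrier_B0[OF Q] by blast
      have "is_coboundary G (\<lambda>x y. \<phi> (\<pi> x) (\<pi> y))"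
        using \<xi> H2_class_eq_B0_one_iff[OF is_group \<pi>.is_cocycle_inflate[OF \<phi>(2)]]
        by (simp add: \<phi>(1) inf_B0_H2_class[OF \<phi>(2)] kernel_def)
      then obtain \<chi> where \<chi>: "transgresses G N \<pi> \<chi> \<phi>"
        using \<pi>.inflation_coboundary_imp_transgresses[OF \<phi>(2)] by auto
      have "additive_on G N \<chi>" using \<pi>.transgresses_additive[of \<chi> \<phi>] \<chi> by simp
      then have N: "\<chi> \<in> characters G N L"
        using \<pi>.transgresses_commuting_symmetric_iff[of \<chi> \<phi>] \<chi> \<phi>(3)
        by (simp add: commutator_characters_iff[OF subgroup_axioms])
      \<comment> \<open>The same function is read as a character of \<open>D\<close>, and it is its
        own extension to \<open>N\<close>.\<close>
      then have D: "\<chi> \<in> characters G D L"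
        unfolding characters_def using additive_on_subset[of G N \<chi> D] by simp
      have "tra G N (descend G D L \<chi>) = \<xi>"
        unfolding \<phi>(1) by (rule tra_descend[OF D N _ \<chi>]) simp
      then show "\<xi> \<in> tra G N ` carrier (Hom_group (tra_source G N) QmodZ)"
        unfolding tra_source_eq D_L.carrier_Hom using D by blast
    qed
  qed
qed

end

subsection \<open>The map \<open>\<theta>\<close> of a free presentation\<close>

locale free_presentation =
  fixes F :: "('a, 'm) monoid_scheme" (structure) and R S :: "'a set"
    and G :: "'a set monoid" and N :: "'a set set"
  assumes free: "is_free_group F" and R: "R \<lhd> F" and S: "S \<lhd> F" and R_S: "R \<subseteq> S"
    and G_def: "G = F Mod R" and N_def: "N = carrier (restricted_group F S Mod R)" and N: "N \<lhd> G"
begin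

abbreviation "\<rho> \<equiv> \<lambda>x. R #> x"
abbreviation "p \<equiv> \<lambda>x. N #>\<^bsub>G\<^esub> \<rho> x"
abbreviation "K\<^sub>R \<equiv> generate F (commutators F \<inter> R)"
abbreviation "K\<^sub>S \<equiv> generate F (commutators F \<inter> S)"
abbreviation "D \<equiv> R \<inter> K\<^sub>S"

sublocale F: group F
  using free by (simp add: is_free_group_def)

sublocale \<rho>: epimorphism F G \<rho>
  unfolding G_def by (rule epimorphism_factor[OF R])

lemma kernel_\<rho> [simp]: "kernel F G \<rho> = R"
  unfolding G_def by (rule kernel_factor[OF R])

sublocale NG: normal_pair N G
  using N by (simp add: normal_pair_def)

text \<open>The composite F -> G -> G/N presents the quotient as F/S, so the criteria for
  epimorphisms apply to both quotients of the same free group.\<close>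

sublocale p: epimorphism F "G Mod N" p
proof -
  have "p \<in> hom F (G Mod N)"
    using hom_compose[OF \<rho>.homh NG.\<pi>.homh] by (simp add: comp_def)
  moreover have "p ` carrier F = carrier (G Mod N)"
    using \<rho>.surj NG.\<pi>.surj by (metis image_image)
  ultimately show "epimorphism F (G Mod N) p"
    using NG.\<pi>.H.is_group
    by (simp add: epimorphism_def epimorphism_axioms_def group_hom_def group_hom_axioms_def F.is_group)
qed

lemma N_eq: "N = \<rho> ` S"
  unfolding N_def carrier_FactGroup by simp

lemma subgroup_R: "subgroup R F" and subgroup_S: "subgroup S F"
  using R S by (simp_all add: normal_imp_subgroup)

lemma kernel_p [simp]: "kernel F (G Mod N) p = S"
proof -
  have "p x = N \<longleftrightarrow> x \<in> S" if x: "x \<in> carrier F" for x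
  proof -
    have \<rho>x: "\<rho> x \<in> carrier G" using x by (rule \<rho>.hom_closed)
    have "p x = N \<longleftrightarrow> \<rho> x \<in> N"
      using group.coset_join1[OF \<rho>.H.is_group _ \<rho>x NG.subgroup_axioms] group.coset_join2[OF \<rho>.H.is_group \<rho>x NG.subgroup_axioms] NG.subset by blast
    also have "\<dots> \<longleftrightarrow> x \<in> S"
    proof
      assume "\<rho> x \<in> N"
      then obtain s where s: "s \<in> S" "\<rho> x = \<rho> s" unfolding N_eq by blast
      have "x \<in> \<rho> s" using F.rcos_self[OF x subgroup_R] s(2) by simp
      then show "x \<in> S"
        using R_S s(1) subgroup.m_closed[OF subgroup_S] unfolding r_coset_def by blast
    qed (simp add: N_eq)
    finally show ?thesis .
  qed
  then show ?thesis using subgroup.mem_carrier[OF subgroup_S] by (auto simp: kernel_def)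
qed

lemma subgroup_D: "subgroup D F"
  by (intro F.subgroups_Inter_pair subgroup_R F.generate_is_subgroup) (use F.commutators_closed in blast)

lemma K\<^sub>R_subset: "K\<^sub>R \<subseteq> D"
  using F.generate_commutators_Int_subset[OF subgroup_R] F.mono_generate[of "commutators F \<inter> R" "commutators F \<inter> S"] R_S
  by auto

sublocale D_K: subquotient F D "K\<^sub>R"
  using subgroup_D F.normal_generate_commutators_Int[OF R] K\<^sub>R_subset
  by (intro subquotient.intro subquotient_axioms.intro F.is_group)

lemma theta_target_eq: "theta_target F R S = restricted_group F D Mod K\<^sub>R"
  by (simp add: theta_target_def)

lemma transgresses_R_exists:
  assumes "is_cocycle G \<phi>"
  shows "\<exists>\<chi>. transgresses F R \<rho> \<chi> \<phi>"
  using \<rho>.inflation_coboundary_imp_transgresses[OF assms]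
    cocycle_on_free_group_is_coboundary[OF free \<rho>.is_cocycle_inflate[OF assms]] by simp

lemma transgresses_S_exists:
  assumes "is_cocycle (G Mod N) \<phi>"
  shows "\<exists>\<chi>. transgresses F S p \<chi> \<phi>"
  using p.inflation_coboundary_imp_transgresses[OF assms]
    cocycle_on_free_group_is_coboundary[OF free p.is_cocycle_inflate[OF assms]] by simp

lemma transgresses_R_characters:
  assumes "transgresses F R \<rho> \<chi> \<phi>" "commuting_symmetric G \<phi>"
  shows "\<chi> \<in> characters F D K\<^sub>R"
proof -
  have "additive_on F R \<chi>" using \<rho>.transgresses_additive assms(1) by simp
  moreover have "\<forall>m\<in>commutators F \<inter> R. \<chi> m = 0"
    using \<rho>.transgresses_commuting_symmetric_iff[of \<chi> \<phi>] assms by simp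
  ultimately have "\<chi> \<in> characters F R K\<^sub>R"
    using F.commutator_characters_iff[OF subgroup_R] by blast
  then show ?thesis unfolding characters_def using additive_on_subset[of F R \<chi> D] by simp
qed

text \<open>The choice covers the cocycle as well as its character. Symmetry of the cocycle ensures
  that the chosen character vanishes on \<open>K\<^sub>R\<close>, so that \<open>descend\<close> is
  meaningful.\<close>

definition theta :: "('a set \<times> 'a set \<Rightarrow> rat set) set \<Rightarrow> 'a set \<Rightarrow> rat set" where
  "theta \<xi> = descend F D K\<^sub>R (SOME \<chi>. \<exists>\<phi>. commuting_symmetric G \<phi> \<and> \<xi> = H2_class G \<phi> \<and> transgresses F R \<rho> \<chi> \<phi>)"

text \<open>Two choices differ by the restriction of an additive map on \<open>F\<close>, which vanishes on \<open>[F, F]\<close> and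
  hence on \<open>D\<close>.\<close>

lemma theta_H2_class:
  assumes "transgresses F R \<rho> \<chi> \<phi>" "commuting_symmetric G \<phi>"
  shows "theta (H2_class G \<phi>) = descend F D K\<^sub>R \<chi>"
proof -
  define \<chi>' where "\<chi>' = (SOME \<chi>. \<exists>\<phi>'. commuting_symmetric G \<phi>' \<and> H2_class G \<phi> = H2_class G \<phi>' \<and> transgresses F R \<rho> \<chi> \<phi>')"
  have "\<exists>\<phi>'. commuting_symmetric G \<phi>' \<and> H2_class G \<phi> = H2_class G \<phi>' \<and> transgresses F R \<rho> \<chi>' \<phi>'"
    unfolding \<chi>'_def by (rule someI[of _ \<chi>]) (use assms in blast)
  then obtain \<phi>' where \<phi>': "commuting_symmetric G \<phi>'" "H2_class G \<phi> = H2_class G \<phi>'" "transgresses F R \<rho> \<chi>' \<phi>'"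
    by blast
  obtain \<psi> where \<psi>: "additive_on F (carrier F) \<psi>" "\<forall>m\<in>R. \<psi> m = \<chi>' m - \<chi> m"
    using \<rho>.H2_class_eq_iff_extends[of \<chi>' \<phi>' \<chi> \<phi>] \<phi>' assms(1) by auto
  have "\<chi>' m = \<chi> m" if m: "m \<in> D" for m
  proof -
    have "m \<in> generate F (commutators F)"
      using m F.mono_generate[of "commutators F \<inter> S" "commutators F"] by auto
    then have "\<psi> m = 0"
      by (rule additive_on_zero_generate[OF F.is_group F.subgroup_self \<psi>(1) F.commutators_closed, rotated])
        (rule additive_on_commutator[OF F.is_group \<psi>(1)])
    then show ?thesis using \<psi>(2) m by simp
  qed
  then have "descend F D K\<^sub>R \<chi>' = descend F D K\<^sub>R \<chi>"
    using D_K.descend_eq_iff[OF transgresses_R_characters[OF \<phi>'(3,1)] transgresses_R_characters[OF assms]] by blast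
  then show ?thesis by (simp add: theta_def \<chi>'_def)
qed

lemma B0_G_cases:
  assumes "\<xi> \<in> carrier (B0 G)"
  obtains \<phi> \<chi> where "\<xi> = H2_class G \<phi>" "is_cocycle G \<phi>" "commuting_symmetric G \<phi>" "transgresses F R \<rho> \<chi> \<phi>"
proof -
  obtain \<phi> where \<phi>: "\<xi> = H2_class G \<phi>" "is_cocycle G \<phi>" "commuting_symmetric G \<phi>"
    using assms unfolding carrier_B0[OF \<rho>.H.is_group] by blast
  obtain \<chi> where "transgresses F R \<rho> \<chi> \<phi>" using transgresses_R_exists[OF \<phi>(2)] by (rule exE)
  then show thesis using that \<phi> by blast
qed

section \<open>Additivity and surjectivity of the last map\<close>

lemma group_hom_theta: "group_hom (B0 G) (Hom_group (theta_target F R S) QmodZ) theta"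
proof -
  have G: "group G" by (rule \<rho>.H.is_group)
  have "theta \<in> hom (B0 G) (Hom_group (restricted_group F D Mod K\<^sub>R) QmodZ)"
  proof (rule homI)
    fix \<xi> assume "\<xi> \<in> carrier (B0 G)"
    then obtain \<phi> \<chi> where *: "\<xi> = H2_class G \<phi>" "commuting_symmetric G \<phi>" "transgresses F R \<rho> \<chi> \<phi>"
      by (rule B0_G_cases)
    show "theta \<xi> \<in> carrier (Hom_group (restricted_group F D Mod K\<^sub>R) QmodZ)"
      unfolding *(1) theta_H2_class[OF *(3,2)] D_K.carrier_Hom using transgresses_R_characters[OF *(3,2)] by (rule imageI)
  next
    fix \<xi> \<eta> assume \<xi>: "\<xi> \<in> carrier (B0 G)" and \<eta>: "\<eta> \<in> carrier (B0 G)"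
    obtain \<phi> \<chi> where 1: "\<xi> = H2_class G \<phi>" "is_cocycle G \<phi>" "commuting_symmetric G \<phi>" "transgresses F R \<rho> \<chi> \<phi>"
      using \<xi> by (rule B0_G_cases)
    obtain \<phi>' \<chi>' where 2: "\<eta> = H2_class G \<phi>'" "is_cocycle G \<phi>'" "commuting_symmetric G \<phi>'" "transgresses F R \<rho> \<chi>' \<phi>'"
      using \<eta> by (rule B0_G_cases)
    have "commuting_symmetric G (\<lambda>a b. \<phi> a b + \<phi>' a b)" using 1(3) 2(3) by (simp add: commuting_symmetric_def)
    then show "theta (\<xi> \<otimes>\<^bsub>B0 G\<^esub> \<eta>) = theta \<xi> \<otimes>\<^bsub>Hom_group (restricted_group F D Mod K\<^sub>R) QmodZ\<^esub> theta \<eta>"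
      using theta_H2_class[OF transgresses_add[OF 1(4) 2(4)]]
      by (simp add: 1(1) 2(1) B0_mult[OF G 1(2) 2(2)] theta_H2_class[OF 1(4,3)] theta_H2_class[OF 2(4,3)]
          D_K.mult_Hom[OF transgresses_R_characters[OF 1(4,3)] transgresses_R_characters[OF 2(4,3)]])
  qed
  then show ?thesis
    using D_K.group_Hom group_B0[OF G] by (simp add: theta_target_eq group_hom_def group_hom_axioms_def)
qed

text \<open>A character of \<open>D\<close> is extended to \<open>R\<close> while it is kept zero on
  \<open>K\<^sub>R\<close>. This vanishing lets it transgress to \<open>G\<close> and puts the
  resulting class into the Bogomolov multiplier.\<close>

lemma theta_surj: "theta ` carrier (B0 G) = carrier (Hom_group (theta_target F R S) QmodZ)"
proof
  show "theta ` carrier (B0 G) \<subseteq> carrier (Hom_group (theta_target F R S) QmodZ)"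
    using group_hom.hom_closed[OF group_hom_theta] by blast
  show "carrier (Hom_group (theta_target F R S) QmodZ) \<subseteq> theta ` carrier (B0 G)"
  proof
    fix f assume "f \<in> carrier (Hom_group (theta_target F R S) QmodZ)"
    then obtain \<chi> where \<chi>: "f = descend F D K\<^sub>R \<chi>" "\<chi> \<in> characters F D K\<^sub>R"
      unfolding theta_target_eq D_K.carrier_Hom by blast
    have "commutators F \<inter> R \<subseteq> K\<^sub>R" by (auto intro: generate.incl)
    then have "\<exists>\<psi>. additive_on F R \<psi> \<and> (\<forall>x\<in>D. \<psi> x = \<chi> x) \<and> (\<forall>x\<in>K\<^sub>R. \<psi> x = 0)"
      using \<chi>(2) K\<^sub>R_subset normal_imp_subgroup[OF D_K.normal_L]
      by (intro additive_extension_in_subgroup[OF F.is_group subgroup_R subgroup_D]) (auto simp: characters_def)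
    then obtain \<psi> where \<psi>: "additive_on F R \<psi>" "\<forall>x\<in>D. \<psi> x = \<chi> x" "\<forall>x\<in>K\<^sub>R. \<psi> x = 0" by blast
    have zero: "\<psi> m = 0" if "m \<in> commutators F" "m \<in> R" for m
      using \<psi>(3) that \<open>commutators F \<inter> R \<subseteq> K\<^sub>R\<close> by blast
    obtain \<phi> where \<phi>: "transgresses F R \<rho> \<psi> \<phi>"
      using \<rho>.transgresses_exists[of \<psi>] \<psi>(1) zero by auto
    have co: "is_cocycle G \<phi>" using \<rho>.transgresses_cocycle \<phi> by simp
    have sym: "commuting_symmetric G \<phi>"
      using \<rho>.transgresses_commuting_symmetric_iff[of \<psi> \<phi>] \<phi> zero by simp
    have "theta (H2_class G \<phi>) = f"
      using theta_H2_class[OF \<phi> sym] \<chi> \<psi>(2) D_K.descend_eq_iff[OF transgresses_R_characters[OF \<phi> sym] \<chi>(2)] by simp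
    moreover have "H2_class G \<phi> \<in> carrier (B0 G)"
      using co sym by (simp add: carrier_B0[OF \<rho>.H.is_group])
    ultimately show "f \<in> theta ` carrier (B0 G)" by blast
  qed
qed

section \<open>Exactness at the multiplier of the whole group\<close>

text \<open>Classes from the quotient belong to characters of \<open>S\<close> vanishing on
  \<open>K\<^sub>S\<close>, which contains \<open>D\<close>. Conversely, a character of
  \<open>R\<close> that vanishes on \<open>D\<close>, the intersection of \<open>R\<close> and
  \<open>K\<^sub>S\<close>, is compatible with the value 0 on \<open>K\<^sub>S\<close> and extends
  to \<open>S\<close>.\<close>

lemma image_inf_eq_kernel_theta:
  "inf_B0 G N ` carrier (B0 (G Mod N)) = kernel (B0 G) (Hom_group (theta_target F R S) QmodZ) theta"
proof
  have Q: "group (G Mod N)" by (rule NG.\<pi>.H.is_group)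
  show "inf_B0 G N ` carrier (B0 (G Mod N)) \<subseteq> kernel (B0 G) (Hom_group (theta_target F R S) QmodZ) theta"
  proof
    fix \<xi> assume \<xi>: "\<xi> \<in> inf_B0 G N ` carrier (B0 (G Mod N))"
    then obtain \<phi> where \<phi>: "\<xi> = inf_B0 G N (H2_class (G Mod N) \<phi>)" "is_cocycle (G Mod N) \<phi>" "commuting_symmetric (G Mod N) \<phi>"
      unfolding carrier_B0[OF Q] by blast
    obtain \<chi> where \<chi>: "transgresses F S p \<chi> \<phi>" using transgresses_S_exists[OF \<phi>(2)] by (rule exE)
    \<comment> \<open>The inflated cocycle has the same character, now used on \<open>R\<close>
      only, so \<open>theta\<close> of its class is computed from \<open>\<chi>\<close>.\<close>
    have "transgresses F R \<rho> \<chi> (\<lambda>x y. \<phi> (N #>\<^bsub>G\<^esub> x) (N #>\<^bsub>G\<^esub> y))"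
      by (rule transgresses_inflate[where q = "\<lambda>x. N #>\<^bsub>G\<^esub> x", OF \<chi> R_S])
    note t = this NG.\<pi>.commuting_symmetric_inflate[OF \<phi>(3)]
    have "additive_on F S \<chi>" using p.transgresses_additive \<chi> by simp
    moreover have "\<forall>m\<in>commutators F \<inter> S. \<chi> m = 0"
      using p.transgresses_commuting_symmetric_iff[of \<chi> \<phi>] \<chi> \<phi>(3) by simp
    ultimately have "\<chi> \<in> characters F S K\<^sub>S"
      using F.commutator_characters_iff[OF subgroup_S] by blast
    then have "\<forall>m\<in>D. \<chi> m = 0" by (simp add: characters_def)
    then have "theta \<xi> = \<one>\<^bsub>Hom_group (theta_target F R S) QmodZ\<^esub>"
      unfolding \<phi>(1) NG.inf_B0_H2_class[OF \<phi>(2)] theta_H2_class[OF t] theta_target_eq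
      using D_K.descend_eq_one_iff[OF transgresses_R_characters[OF t]] by blast
    moreover have "\<xi> \<in> carrier (B0 G)" using \<xi> group_hom.hom_closed[OF NG.group_hom_inf] by blast
    ultimately show "\<xi> \<in> kernel (B0 G) (Hom_group (theta_target F R S) QmodZ) theta"
      by (simp add: kernel_def)
  qed
  show "kernel (B0 G) (Hom_group (theta_target F R S) QmodZ) theta \<subseteq> inf_B0 G N ` carrier (B0 (G Mod N))"
  proof
    fix \<xi> assume \<xi>: "\<xi> \<in> kernel (B0 G) (Hom_group (theta_target F R S) QmodZ) theta"
    then have "\<xi> \<in> carrier (B0 G)" by (simp add: kernel_def)
    then obtain \<phi> \<chi> where 1: "\<xi> = H2_class G \<phi>" "commuting_symmetric G \<phi>" "transgresses F R \<rho> \<chi> \<phi>"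
      by (rule B0_G_cases)
    have D0: "\<forall>m\<in>D. \<chi> m = 0"
      using \<xi> D_K.descend_eq_one_iff[OF transgresses_R_characters[OF 1(3,2)]]
      by (simp add: 1(1) theta_H2_class[OF 1(3,2)] kernel_def theta_target_eq)
    have "additive_on F R \<chi>" using \<rho>.transgresses_additive 1(3) by simp
    moreover have "commutators F \<inter> S \<subseteq> K\<^sub>S" by (auto intro: generate.incl)
    moreover have "subgroup K\<^sub>S F" using F.normal_generate_commutators_Int[OF S] by (rule normal_imp_subgroup)
    ultimately have "\<exists>\<psi>. additive_on F S \<psi> \<and> (\<forall>x\<in>R. \<psi> x = \<chi> x) \<and> (\<forall>x\<in>K\<^sub>S. \<psi> x = 0)"
      using D0 F.generate_commutators_Int_subset[OF subgroup_S]
      by (intro additive_extension_in_subgroup[OF F.is_group subgroup_S subgroup_R R_S]) auto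
    then obtain \<psi> where \<psi>: "additive_on F S \<psi>" "\<forall>x\<in>R. \<psi> x = \<chi> x" "\<forall>x\<in>K\<^sub>S. \<psi> x = 0" by blast
    have zero: "\<psi> m = 0" if "m \<in> commutators F" "m \<in> S" for m
      using \<psi>(3) that \<open>commutators F \<inter> S \<subseteq> K\<^sub>S\<close> by blast
    obtain \<eta> where \<eta>: "transgresses F S p \<psi> \<eta>"
      using p.transgresses_exists[of \<psi>] \<psi>(1) zero by auto
    have co: "is_cocycle (G Mod N) \<eta>" using p.transgresses_cocycle \<eta> by simp
    have sym: "commuting_symmetric (G Mod N) \<eta>"
      using p.transgresses_commuting_symmetric_iff[of \<psi> \<eta>] \<eta> zero by simp
    have "transgresses F R \<rho> \<psi> (\<lambda>x y. \<eta> (N #>\<^bsub>G\<^esub> x) (N #>\<^bsub>G\<^esub> y))"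
      by (rule transgresses_inflate[where q = "\<lambda>x. N #>\<^bsub>G\<^esub> x", OF \<eta> R_S])
    \<comment> \<open>Inflating the new cocycle gives a transgression of \<open>\<psi>\<close>
      restricted to \<open>R\<close>, which is \<open>\<chi>\<close> again; equal characters give
      equal classes.\<close>
    then have "H2_class G (\<lambda>x y. \<eta> (N #>\<^bsub>G\<^esub> x) (N #>\<^bsub>G\<^esub> y)) = \<xi>"
      unfolding 1(1) using 1(3) \<psi>(2) by (intro \<rho>.H2_class_eqI[of \<psi> _ \<chi>]) simp_all
    then have "\<xi> = inf_B0 G N (H2_class (G Mod N) \<eta>)"
      by (simp add: NG.inf_B0_H2_class[OF co])
    moreover have "H2_class (G Mod N) \<eta> \<in> carrier (B0 (G Mod N))"
      using co sym by (simp add: carrier_B0[OF Q])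
    ultimately show "\<xi> \<in> inf_B0 G N ` carrier (B0 (G Mod N))" by blast
  qed
qed

end

theorem theorem1p2:
  fixes F :: "'a monoid" and R S :: "'a set"
    and G :: "'a set monoid" and N :: "'a set set"
  assumes "is_free_group F"
    and "R \<lhd> F"
    and "G = F Mod R"
    and "finite (carrier G)"
    and "S \<lhd> F"
    and "R \<subseteq> S"
    and "N = carrier (F\<lparr>carrier := S\<rparr> Mod R)"
    and "N \<lhd> G"
  shows "\<exists>\<theta>.
      group_hom (Hom_group (tra_source G N) QmodZ) (B0 (G Mod N)) (tra G N) \<and>
      group_hom (B0 (G Mod N)) (B0 G) (inf_B0 G N) \<and>
      group_hom (B0 G) (Hom_group (theta_target F R S) QmodZ) \<theta> \<and>
      kernel (Hom_group (tra_source G N) QmodZ) (B0 (G Mod N)) (tra G N)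
        = {\<one>\<^bsub>Hom_group (tra_source G N) QmodZ\<^esub>} \<and>
      tra G N ` carrier (Hom_group (tra_source G N) QmodZ)
        = kernel (B0 (G Mod N)) (B0 G) (inf_B0 G N) \<and>
      inf_B0 G N ` carrier (B0 (G Mod N))
        = kernel (B0 G) (Hom_group (theta_target F R S) QmodZ) \<theta> \<and>
      \<theta> ` carrier (B0 G) = carrier (Hom_group (theta_target F R S) QmodZ)"
proof -
  interpret free_presentation F R S G N
    using assms by (simp add: free_presentation_def)
  show ?thesis
    using NG.group_hom_tra NG.group_hom_inf group_hom_theta NG.kernel_tra NG.image_tra_eq_kernel_inf
      image_inf_eq_kernel_theta theta_surj
    by (intro exI[of _ theta] conjI)
qed

end
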